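(* Let $\alpha,\beta\ge-\frac12$. The Lebesgue constant of the Lagrange interpolation polynomial $\mathcal{L}_n^{\alpha,\beta}f$ based on the nodes of the minimal cubature rule of degree $4n-1$ for $\mathcal{W}_{\alpha,\beta}$ satisfies, as $n\to\infty$, $$\|\mathcal{L}_n^{\alpha,\beta}\|_\infty=\mathcal{O}(1)\begin{cases}n^{2\max\{\alpha,\beta\}+1},&\max\{\alpha,\beta\}>-1/2,\\(\log n)^2,&\max\{\alpha,\beta\}=-1/2.\end{cases}$$
   Context: For $a,b>-1$ let $w_{a,b}(x)=(1-x)^a(1+x)^b$ on $[-1,1]$, $c_{a,b}=\big(\int_{-1}^1w_{a,b}\big)^{-1}$, and let $p_m^{(a,b)}$ be the orthonormal Jacobi polynomials, $c_{a,b}\int_{-1}^1p_m^{(a,b)}p_l^{(a,b)}w_{a,b}\,dx=\delta_{m,l}$. The weight is $$\mathcal{W}_{\alpha,\beta}(x_1,x_2)=c_{\alpha,\beta}^2\frac{|x_1-x_2|^{2\alpha+1}|x_1+x_2|^{2\beta+1}}{\sqrt{1-x_1^2}\sqrt{1-x_2^2}}\quad\text{on }[-1,1]^2.$$ Let $\cos\theta_{k,n}$, $0<\theta_{k,n}<\pi$, $1\le k\le n$, be the zeros of $p_n^{(\alpha,\beta)}$, and $s_{j,k}=\cos\frac{\theta_{j,n}-\theta_{k,n}}2$, $t_{j,k}=\cos\frac{\theta_{j,n}+\theta_{k,n}}2$. The nodes of the minimal cubature rule of degree $4n-1$ for $\mathcal{W}_{\alpha,\beta}$ are the $2n(n+1)$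 points $(s_{j,k},t_{j,k})$, $(t_{j,k},s_{j,k})$, $(-s_{j,k},-t_{j,k})$, $(-t_{j,k},-s_{j,k})$, $1\le j\le k\le n$. For $x=(x_1,x_2)=(\cos\theta,\cos\phi)$ and $0\le k\le n-1$ let ${}_2Q_{k,2n}$ be the polynomial of degree $2n$ in $(x_1,x_2)$ which is a nonzero constant multiple of $$(x_1^2-x_2^2)\left[p_{n-1}^{(\alpha+1,\beta+1)}(\cos(\theta-\phi))\,p_k^{(\alpha+1,\beta+1)}(\cos(\theta+\phi))+p_k^{(\alpha+1,\beta+1)}(\cos(\theta-\phi))\,p_{n-1}^{(\alpha+1,\beta+1)}(\cos(\theta+\phi))\right].$$ Let $\Pi_{2n-1}^2$ be the space of polynomials in two variables of total degree $\le2n-1$ and $\Pi_{2n}^*=\Pi_{2n-1}^2+\mathrm{span}\{{}_2Q_{k,2n}:0\le k\le n-1\}$. For $f\in C([-1,1]^2)$, $\mathcal{L}_n^{\alpha,\beta}f$ is the unique element of $\Pi_{2n}^*$ agreeing with $f$ at all the nodes. The Lebesgue constant $\|\mathcal{L}_n^{\alpha,\beta}\|_\infty$ is the operator norm of $f\mapsto\mathcal{L}_n^{\alpha,\beta}f$ on $C([-1,1]^2)$ with the uniform norm. The constant in $\mathcal{O}(1)$ may depend on $\alpha,\beta$ but not on $n$. *)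

theory Defs
  imports "HOL-Analysis.Analysis" "HOL-Computational_Algebra.Polynomial"
begin

definition jacobi_weight :: "real \<Rightarrow> real \<Rightarrow> real \<Rightarrow> real" where
  "jacobi_weight a b x = (1 - x) powr a * (1 + x) powr b"

definition jacobi_const :: "real \<Rightarrow> real \<Rightarrow> real" where
  "jacobi_const a b = inverse (integral {-1..1} (jacobi_weight a b))"

text \<open>Orthonormality determines the polynomials up to sign; the usual convention of
  positive leading coefficients makes the system unique for \<open>a, b > -1\<close>. Nothing below
  depends on the choice of signs.\<close>

definition orthonormal_jacobi_system :: "real \<Rightarrow> real \<Rightarrow> (nat \<Rightarrow> real poly) \<Rightarrow> bool" where
  "orthonormal_jacobi_system a b p \<longleftrightarrow>
     (\<forall>m. degree (p m) = m \<and> lead_coeff (p m) > 0) \<and>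
     (\<forall>m l. jacobi_const a b *
        integral {-1..1} (\<lambda>x. poly (p m) x * poly (p l) x * jacobi_weight a b x)
        = (if m = l then 1 else 0))"

definition jacobi :: "real \<Rightarrow> real \<Rightarrow> nat \<Rightarrow> real poly" where
  "jacobi a b = (THE p. orthonormal_jacobi_system a b p)"

text \<open>The angles \<open>\<theta>\<^sub>k\<^sub>,\<^sub>n\<close>, \<open>1 \<le> k \<le> n\<close>, are enumerated increasingly; the set of nodes below
  does not depend on the enumeration.\<close>

definition jacobi_angle :: "real \<Rightarrow> real \<Rightarrow> nat \<Rightarrow> nat \<Rightarrow> real" where
  "jacobi_angle \<alpha> \<beta> n k =
     sorted_list_of_set {\<theta>. 0 < \<theta> \<and> \<theta> < pi \<and> poly (jacobi \<alpha> \<beta> n) (cos \<theta>) = 0} ! (k - 1)"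

definition node_s :: "real \<Rightarrow> real \<Rightarrow> nat \<Rightarrow> nat \<Rightarrow> nat \<Rightarrow> real" where
  "node_s \<alpha> \<beta> n j k = cos ((jacobi_angle \<alpha> \<beta> n j - jacobi_angle \<alpha> \<beta> n k) / 2)"

definition node_t :: "real \<Rightarrow> real \<Rightarrow> nat \<Rightarrow> nat \<Rightarrow> nat \<Rightarrow> real" where
  "node_t \<alpha> \<beta> n j k = cos ((jacobi_angle \<alpha> \<beta> n j + jacobi_angle \<alpha> \<beta> n k) / 2)"

text \<open>The nodes of the minimal cubature rule of degree \<open>4n - 1\<close> for the weight
  \<open>c\<^sup>2 |x\<^sub>1 - x\<^sub>2|\<^bsup>2\<alpha>+1\<^esup> |x\<^sub>1 + x\<^sub>2|\<^bsup>2\<beta>+1\<^esup> / (\<surd>(1 - x\<^sub>1\<^sup>2) \<surd>(1 - x\<^sub>2\<^sup>2))\<close> on \<open>[-1,1]\<^sup>2\<close>.\<close>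

definition cubature_nodes :: "real \<Rightarrow> real \<Rightarrow> nat \<Rightarrow> (real \<times> real) set" where
  "cubature_nodes \<alpha> \<beta> n =
     (\<Union>k\<in>{1..n}. \<Union>j\<in>{1..k}.
        {( node_s \<alpha> \<beta> n j k,  node_t \<alpha> \<beta> n j k),
         ( node_t \<alpha> \<beta> n j k,  node_s \<alpha> \<beta> n j k),
         (-node_s \<alpha> \<beta> n j k, -node_t \<alpha> \<beta> n j k),
         (-node_t \<alpha> \<beta> n j k, -node_s \<alpha> \<beta> n j k)})"

text \<open>Real polynomials in two variables of total degree at most \<open>d\<close>, identified with the
  functions on the plane that they induce.\<close>

definition bipoly_space :: "nat \<Rightarrow> (real \<times> real \<Rightarrow> real) set" where
  "bipoly_space d =
     {f. \<exists>c :: nat \<Rightarrow> nat \<Rightarrow> real.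
           f = (\<lambda>(x, y). \<Sum>i\<le>d. \<Sum>j\<le>d - i. c i j * x ^ i * y ^ j)}"

definition Q2_condition ::
    "real \<Rightarrow> real \<Rightarrow> nat \<Rightarrow> nat \<Rightarrow> (real \<times> real \<Rightarrow> real) \<Rightarrow> bool" where
  "Q2_condition \<alpha> \<beta> n k q \<longleftrightarrow>
     q \<in> bipoly_space (2 * n) \<and> q \<notin> bipoly_space (2 * n - 1) \<and>
     (\<exists>C. C \<noteq> 0 \<and> (\<forall>\<theta> \<phi>. q (cos \<theta>, cos \<phi>) =
        C * (((cos \<theta>)\<^sup>2 - (cos \<phi>)\<^sup>2) *
          (poly (jacobi (\<alpha> + 1) (\<beta> + 1) (n - 1)) (cos (\<theta> - \<phi>)) *
             poly (jacobi (\<alpha> + 1) (\<beta> + 1) k) (cos (\<theta> + \<phi>)) +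
           poly (jacobi (\<alpha> + 1) (\<beta> + 1) k) (cos (\<theta> - \<phi>)) *
             poly (jacobi (\<alpha> + 1) (\<beta> + 1) (n - 1)) (cos (\<theta> + \<phi>))))))"

text \<open>The polynomial \<open>\<^sub>2Q\<^sub>k\<^sub>,\<^sub>2\<^sub>n\<close> is fixed only up to a nonzero constant factor, which does not
  affect the span it enters.\<close>

definition Q2 :: "real \<Rightarrow> real \<Rightarrow> nat \<Rightarrow> nat \<Rightarrow> real \<times> real \<Rightarrow> real" where
  "Q2 \<alpha> \<beta> n k = (SOME q. Q2_condition \<alpha> \<beta> n k q)"

definition interp_space :: "real \<Rightarrow> real \<Rightarrow> nat \<Rightarrow> (real \<times> real \<Rightarrow> real) set" where
  "interp_space \<alpha> \<beta> n =
     {f. \<exists>P \<in> bipoly_space (2 * n - 1). \<exists>c :: nat \<Rightarrow> real.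
           f = (\<lambda>z. P z + (\<Sum>k<n. c k * Q2 \<alpha> \<beta> n k z))}"

definition lagrange_interp ::
    "real \<Rightarrow> real \<Rightarrow> nat \<Rightarrow> (real \<times> real \<Rightarrow> real) \<Rightarrow> real \<times> real \<Rightarrow> real" where
  "lagrange_interp \<alpha> \<beta> n f =
     (THE q. q \<in> interp_space \<alpha> \<beta> n \<and> (\<forall>z\<in>cubature_nodes \<alpha> \<beta> n. q z = f z))"

definition square :: "(real \<times> real) set" where
  "square = {-1..1} \<times> {-1..1}"

definition uniform_norm :: "(real \<times> real \<Rightarrow> real) \<Rightarrow> ennreal" where
  "uniform_norm f = (SUP z\<in>square. ennreal \<bar>f z\<bar>)"

text \<open>The operator norm on \<open>C([-1,1]\<^sup>2)\<close>. It takes values in \<open>[0,\<infinity>]\<close> so that an upper bound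
  includes the boundedness of the operator.\<close>

definition lebesgue_constant :: "real \<Rightarrow> real \<Rightarrow> nat \<Rightarrow> ennreal" where
  "lebesgue_constant \<alpha> \<beta> n =
     (SUP f\<in>{f. continuous_on square f \<and> uniform_norm f \<le> 1}.
        uniform_norm (lagrange_interp \<alpha> \<beta> n f))"

end

theory Submission
  imports Defs
begin

text \<open>
  The proof separates variables. Put \<open>s = x + y\<close> and \<open>d = x - y\<close>, and for \<open>x = cos \<theta>\<close>, \<open>y = cos \<phi>\<close>
  let \<open>u = cos (\<theta> - \<phi>)\<close> and \<open>v = cos (\<theta> + \<phi>)\<close>. Then \<open>s\<^sup>2 = (1 + u) (1 + v)\<close> and
  \<open>d\<^sup>2 = (1 - u) (1 - v)\<close>. In these coordinates the nodes are the points with \<open>u\<close> and \<open>v\<close> zeros of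
  the Jacobi polynomial \<open>p\<^sub>n\<close> and with all four choices of the signs of \<open>s\<close> and \<open>d\<close>. Sorting monomials
  by parity in \<open>s\<close> and \<open>d\<close> shows that the interpolation space consists exactly of the functions
  \<open>A + s B + d C + s d E\<close>, where \<open>A, B, C, E\<close> are symmetric polynomials in \<open>u, v\<close> of degree at most
  \<open>n - 1\<close> in each variable; the additional polynomials of degree \<open>2n\<close> complete the last summand, in
  which total degree \<open>2n - 1\<close> falls short by one (\<open>interp_space_iff\<close>). So interpolation splits into four
  tensor product problems on the grid of zeros, one for each parity (\<open>interp_space_unisolvent\<close>,
  \<open>lagrange_interp_bound\<close>). Dividing by \<open>s\<close> or \<open>d\<close> at a node and multiplying by it at the point of
  evaluation costs factors \<open>sqrt ((1 + t) / (1 + x))\<close> and \<open>sqrt ((1 - t) / (1 - x))\<close> in each variable.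
  The norm is therefore at most four times the square of a bound for the correspondingly weighted
  univariate Lebesgue functions.

  It remains to bound these by a multiple of \<open>n\<close> to the power \<open>\<gamma> = max \<alpha> \<beta> + 1/2\<close>, or of \<open>ln n\<close> if
  \<open>\<gamma> = 0\<close> (\<open>weighted_lebesgue_bound\<close>). This uses only the differential equation of \<open>p\<^sub>n\<close>, and no
  asymptotic formula. Let \<open>U \<theta>\<close> be \<open>p\<^sub>n (cos \<theta>)\<close> times the factor that removes the first order term
  of the equation in \<open>\<theta>\<close>. Then \<open>U'' = (h - L\<^sup>2) U\<close> with \<open>L\<close> of order \<open>n\<close> and \<open>h = O(1 / sin\<^sup>2 \<theta>)\<close>,
  so the logarithmic derivative of the energy \<open>U'\<^sup>2 + L\<^sup>2 U\<^sup>2\<close> is at most \<open>\<bar>h\<bar> / L\<close>. Its integral over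
  the interval from \<open>1/L\<close> to \<open>\<pi> - 1/L\<close> is bounded independently of \<open>n\<close>, hence the energy is constant
  there up to a factor (\<open>energy_comparable\<close>). All zeros lie in that interval, because the equation at
  the endpoint \<open>1\<close> evaluates the sum of \<open>1 / (1 - x)\<close> over the zeros \<open>x\<close>. Constancy of the energy
  gives at once the size of \<open>U\<close>, the size of \<open>U'\<close> at the zeros, and the separation of the zeros.
  These bound every term of the Lebesgue function (\<open>lebesgue_term_bound\<close>), and the separation turns
  the sum over the zeros into an elementary sum (\<open>sum_over_zeros_le\<close>).
\<close>

section \<open>Jacobi polynomials and their differential equation\<close>

text \<open>The equation is stated between polynomials, so that orders of vanishing can be compared.\<close>

definition jacobi_ode :: "real \<Rightarrow> real \<Rightarrow> nat \<Rightarrow> real poly \<Rightarrow> bool" where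
  "jacobi_ode a b n P \<longleftrightarrow>
     [:1, 0, -1:] * pderiv (pderiv P) + [:b - a, - (a + b + 2):] * pderiv P
       + smult (real n * (real n + a + b + 1)) P = 0"

lemma jacobi_ode_iff:
  "jacobi_ode a b n P \<longleftrightarrow>
     (\<forall>x. (1 - x\<^sup>2) * poly (pderiv (pderiv P)) x + (b - a - (a + b + 2) * x) * poly (pderiv P) x
       + real n * (real n + a + b + 1) * poly P x = 0)"
  unfolding jacobi_ode_def poly_eq_poly_eq_iff[symmetric] fun_eq_iff
  by (simp add: algebra_simps power2_eq_square)

lemma jacobi_ode_smult:
  assumes "jacobi_ode a b n P"
  shows "jacobi_ode a b n (smult c P)"
proof -
  have "(1 - x\<^sup>2) * (c * p2) + (b - a - (a + b + 2) * x) * (c * p1)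
       + real n * (real n + a + b + 1) * (c * p0)
     = c * ((1 - x\<^sup>2) * p2 + (b - a - (a + b + 2) * x) * p1
       + real n * (real n + a + b + 1) * p0)" for x p0 p1 p2
    by (simp add: algebra_simps)
  then show ?thesis
    using assms unfolding jacobi_ode_iff by (simp add: pderiv_smult)
qed

lemma jacobi_eigenvalue_strict_mono:
  fixes s :: real
  assumes "s > -1" "k < n"
  shows "real k * (real k + s) < real n * (real n + s)"
proof -
  have "real n * (real n + s) - real k * (real k + s) = (real n - real k) * (real n + real k + s)"
    by (simp add: algebra_simps)
  moreover have "real n + real k + s > 0" using assms by linarith
  ultimately show ?thesis
    using assms by (smt (verit) mult_pos_pos of_nat_less_iff)
qed

text \<open>In the variable \<open>t = 1 - x\<close> the equation is a two-term recursion for the coefficients. Its factor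
  \<open>k (k + s) - n (n + s)\<close> first vanishes at \<open>k = n\<close>, so the hypergeometric series ends exactly at degree \<open>n\<close>.\<close>

lemma jacobi_ode_solution_exists:
  assumes "a > -1" "b > -1"
  obtains P where "degree P = n" "P \<noteq> 0" "jacobi_ode a b n P"
proof -
  define s where "s = a + b + 1"
  define c where "c = rec_nat 1 (\<lambda>k ck. (real k * (real k + s) - real n * (real n + s)) /
                                       (2 * (real k + 1) * (real k + a + 1)) * ck)"
  have c0: "c 0 = 1" and cS: "c (Suc k) = (real k * (real k + s) - real n * (real n + s)) /
              (2 * (real k + 1) * (real k + a + 1)) * c k" for k
    by (simp_all add: c_def)
  have cn: "c k \<noteq> 0" if "k \<le> n" for k
    using that
  proof (induction k)
    case (Suc k)
    have "real k + a + 1 \<noteq> 0" "real k + 1 \<noteq> 0" using assms by linarith+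
    then show ?case
      using Suc jacobi_eigenvalue_strict_mono[of s k n] assms by (auto simp: cS s_def)
  qed (simp add: c0)
  \<comment> \<open>The recursion factor is zero at \<open>k = n\<close>, so all later coefficients vanish.\<close>
  have cz: "c k = 0" if "k > n" for k
    using that
  proof (induction k)
    case (Suc k)
    then show ?case by (cases "k = n") (auto simp: cS)
  qed simp
  \<comment> \<open>Coefficients in powers of \<open>t = 1 - x\<close>; substituted back at the end.\<close>
  define R where "R = (\<Sum>k\<le>n. monom (c k) k)"
  have cR: "coeff R k = c k" for k
    using cz by (auto simp: R_def coeff_sum)
  have degR: "degree R = n"
    by (metis cR cn cz coeff_eq_0 le_degree leading_coeff_0_iff le_refl linorder_le_less_linear order_antisym degree_le)
  have rec: "2 * (real k + 1) * (real k + a + 1) * c (Suc k) = (real k * (real k + s) - real n * (real n + s)) * c k" for k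
  proof -
    have "2 * (real k + 1) * (real k + a + 1) \<noteq> 0" using assms by auto
    then show ?thesis unfolding cS by simp
  qed
  have R0: "[:0, 2, -1:] * pderiv (pderiv R) + [:2 * (a + 1), - (a + b + 2):] * pderiv R
        + smult (real n * (real n + s)) R = 0"
  proof (rule poly_eqI)
    fix k
    show "coeff ([:0, 2, -1:] * pderiv (pderiv R) + [:2 * (a + 1), - (a + b + 2):] * pderiv R
        + smult (real n * (real n + s)) R) k = coeff 0 k"
    proof (cases k)
      case 0
      then show ?thesis using rec[of 0]
        by (simp add: coeff_pderiv cR algebra_simps)
    next
      case (Suc m)
      show ?thesis
      proof (cases m)
        case 0
        then show ?thesis using rec[of 1] Suc
          by (simp add: coeff_pderiv cR algebra_simps s_def)
      next
        case (Suc l)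
        then show ?thesis using rec[of k] \<open>k = Suc m\<close>
          by (simp add: coeff_pderiv cR algebra_simps s_def)
      qed
    qed
  qed
  define P where "P = pcompose R [:1, -1:]"
  have d1: "pderiv P = - pcompose (pderiv R) [:1, -1:]"
    by (simp add: P_def pderiv_pcompose pderiv_pCons)
  have d2: "pderiv (pderiv P) = pcompose (pderiv (pderiv R)) [:1, -1:]"
    by (simp add: d1 pderiv_pcompose pderiv_pCons pderiv_minus)
  have "jacobi_ode a b n P"
    unfolding jacobi_ode_iff
  proof
    fix x :: real
    define t where "t = 1 - x"
    have x: "x = 1 - t" by (simp add: t_def)
    have "poly ([:0, 2, -1:] * pderiv (pderiv R) + [:2 * (a + 1), - (a + b + 2):] * pderiv R
        + smult (real n * (real n + s)) R) t = 0"
      unfolding R0 by simp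
    then show "(1 - x\<^sup>2) * poly (pderiv (pderiv P)) x + (b - a - (a + b + 2) * x) * poly (pderiv P) x
       + real n * (real n + a + b + 1) * poly P x = 0"
      unfolding d2 unfolding d1 unfolding P_def poly_pcompose x
      by (simp add: poly_pcompose algebra_simps power2_eq_square s_def)
  qed
  moreover have "degree P = n"
    by (simp add: P_def degree_pcompose degR)
  moreover have "P \<noteq> 0"
    by (metis P_def cR c0 coeff_0 pcompose_eq_0 degree_pCons_eq_if one_neq_zero pCons_eq_0_iff zero_less_one One_nat_def neg_equal_0_iff_equal)
  ultimately show ?thesis using that by blast
qed

text \<open>At a zero of order \<open>k + 2\<close> inside the interval the term with the second derivative would vanish only
  to order \<open>k\<close>, but the other two terms to order at least \<open>k + 1\<close>.\<close>

lemma jacobi_ode_simple_zero: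
  assumes "jacobi_ode a b n P" "P \<noteq> 0" "-1 < x" "x < 1" "poly P x = 0"
  shows "poly (pderiv P) x \<noteq> 0"
proof
  assume P1: "poly (pderiv P) x = 0"
  have pderiv_nz: "pderiv Q \<noteq> 0" if "Q \<noteq> 0" "poly Q x = 0" for Q :: "real poly"
  proof
    assume "pderiv Q = 0"
    then obtain c where "Q = [:c:]" using degree_eq_zeroE pderiv_eq_0_iff by metis
    then show False using that by simp
  qed
  have nz: "pderiv P \<noteq> 0" and nz2: "pderiv (pderiv P) \<noteq> 0"
    using pderiv_nz assms(2,5) P1 by auto
  define k where "k = order x (pderiv (pderiv P))"
  have o1: "order x (pderiv P) = Suc k"
    unfolding k_def using nz nz2 P1 by (intro order_pderiv) (auto simp: order_root)
  have o0: "order x P = Suc (Suc k)"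
    unfolding o1[symmetric] using nz assms(2,5) by (intro order_pderiv) (auto simp: order_root)
  have d1: "[:-x, 1:] ^ Suc k dvd pderiv P" using o1 order_1 by metis
  have d0: "[:-x, 1:] ^ Suc k dvd P" using o0 order_1 by (metis le_imp_power_dvd dvd_trans lessI less_imp_le)
  have eq: "[:1, 0, -1:] * pderiv (pderiv P) = - ([:b - a, - (a + b + 2):] * pderiv P
       + smult (real n * (real n + a + b + 1)) P)"
    using assms(1) unfolding jacobi_ode_def eq_neg_iff_add_eq_0 by (metis add.assoc)
  have "[:-x, 1:] ^ Suc k dvd [:1, 0, -1:] * pderiv (pderiv P)"
    unfolding eq using d1 d0 by (intro dvd_minus_iff[THEN iffD2] dvd_add dvd_mult dvd_smult)
  moreover have nz3: "[:1, 0, -1:] * pderiv (pderiv P) \<noteq> 0" using nz2 by (intro no_zero_divisors) auto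
  ultimately have "Suc k \<le> order x ([:1, 0, -1:] * pderiv (pderiv P))"
    using order_divides by blast
  also have "\<dots> = order x [:1, 0, -1:] + k"
    unfolding k_def by (rule order_mult[OF nz3])
  also have "order x [:1, 0, -1:] = 0"
  proof (rule order_0I)
    have "1 - x * x = (1 - x) * (1 + x)" by (simp add: algebra_simps)
    then show "poly [:1, 0, -1:] x \<noteq> 0" using assms(3,4) by simp
  qed
  finally show False by simp
qed

text \<open>The substitution \<open>x = 2 t - 1\<close> gives a Beta integral.\<close>

lemma jacobi_weight_absolutely_integrable:
  assumes "a > -1" "b > -1"
  shows "jacobi_weight a b absolutely_integrable_on {-1..1}"
proof -
  have "((\<lambda>t. t powr b * (1 - t) powr a) has_integral Beta (b+1) (a+1)) {0..1}"
    using has_integral_Beta_real[of "b+1" "a+1"] assms by simp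
  then have "((\<lambda>t. t powr b * (1 - t) powr a) has_integral Beta (b+1) (a+1)) (cbox 0 1)"
    by simp
  from has_integral_affinity'[OF this, of "1/2" "1/2"]
  have "((\<lambda>x. (x/2+1/2) powr b * (1 - (x/2+1/2)) powr a) has_integral 2 * Beta (b+1) (a+1)) {-1..1}"
    by simp
  then have "((\<lambda>x. (2 powr a * 2 powr b) * ((x/2+1/2) powr b * (1 - (x/2+1/2)) powr a)) has_integral
       (2 powr a * 2 powr b) * (2 * Beta (b+1) (a+1))) {-1..1}"
    by (rule has_integral_mult_right)
  moreover have "(2 powr a * 2 powr b) * ((x/2+1/2) powr b * (1 - (x/2+1/2)) powr a) = jacobi_weight a b x"
    if "x \<in> {-1..1}" for x
  proof -
    have e: "x/2+1/2 = (1+x)/2" "1 - (1+x)/2 = (1-x)/2" by (auto simp: field_simps)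
    show ?thesis using that unfolding jacobi_weight_def e
      by (simp add: powr_divide)
  qed
  ultimately have "(jacobi_weight a b has_integral (2 powr a * 2 powr b) * (2 * Beta (b+1) (a+1))) {-1..1}"
    by (rule has_integral_eq[rotated]) auto
  then show ?thesis
    by (intro nonnegative_absolutely_integrable_1) (auto simp: jacobi_weight_def integrable_on_def)
qed

lemma poly_times_jacobi_weight_integrable:
  assumes "a > -1" "b > -1"
  shows "(\<lambda>x. poly p x * jacobi_weight a b x) integrable_on {-1..1}"
proof -
  have "(\<lambda>x. poly p x * jacobi_weight a b x) absolutely_integrable_on {-1..1}"
  proof (rule absolutely_integrable_bounded_measurable_product_real)
    show "poly p \<in> borel_measurable (lebesgue_on {-1..1})"
      by (intro continuous_imp_measurable_on_sets_lebesgue continuous_intros) auto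
    show "bounded (poly p ` {-1..1})"
      by (intro compact_imp_bounded compact_continuous_image continuous_intros) auto
  qed (use jacobi_weight_absolutely_integrable[OF assms] in auto)
  then show ?thesis by (simp add: absolutely_integrable_on_def)
qed

definition jacobi_inner :: "real \<Rightarrow> real \<Rightarrow> real poly \<Rightarrow> real poly \<Rightarrow> real" where
  "jacobi_inner a b p q = integral {-1..1} (\<lambda>x. poly p x * poly q x * jacobi_weight a b x)"

lemma jacobi_inner_eq: "jacobi_inner a b p q = integral {-1..1} (\<lambda>x. poly (p * q) x * jacobi_weight a b x)"
  by (simp add: jacobi_inner_def)

lemma jacobi_inner_commute: "jacobi_inner a b p q = jacobi_inner a b q p"
  by (simp add: jacobi_inner_def mult.commute)

lemma jacobi_inner_add_right:
  assumes "a > -1" "b > -1"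
  shows "jacobi_inner a b p (q + r) = jacobi_inner a b p q + jacobi_inner a b p r"
proof -
  have "jacobi_inner a b p (q + r) = integral {-1..1} (\<lambda>x. poly (p * q) x * jacobi_weight a b x
      + poly (p * r) x * jacobi_weight a b x)"
    unfolding jacobi_inner_eq by (simp add: algebra_simps)
  also have "\<dots> = jacobi_inner a b p q + jacobi_inner a b p r"
    unfolding jacobi_inner_eq
    by (intro integral_add poly_times_jacobi_weight_integrable assms)
  finally show ?thesis .
qed

lemma jacobi_inner_smult_right: "jacobi_inner a b p (smult c q) = c * jacobi_inner a b p q"
proof -
  have "jacobi_inner a b p (smult c q) =
     integral {-1..1} (\<lambda>x. c * (poly p x * poly q x * jacobi_weight a b x))"
    by (simp add: jacobi_inner_def algebra_simps)
  then show ?thesis by (simp add: jacobi_inner_def)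
qed

lemma jacobi_inner_zero_right [simp]: "jacobi_inner a b p 0 = 0"
  by (simp add: jacobi_inner_def)

text \<open>The part of the integral over \<open>[-1/2, 1/2]\<close>, where the weight is continuous and positive, is
  already positive.\<close>

lemma jacobi_weighted_integral_pos:
  assumes "a > -1" "b > -1" "p \<noteq> 0" and nonneg: "\<And>x. -1 < x \<Longrightarrow> x < 1 \<Longrightarrow> poly p x \<ge> 0"
  shows "integral {-1..1} (\<lambda>x. poly p x * jacobi_weight a b x) > 0"
proof -
  let ?f = "\<lambda>x. poly p x * jacobi_weight a b x"
  have int: "?f integrable_on {-1..1}" by (rule poly_times_jacobi_weight_integrable[OF assms(1,2)])
  have nonneg': "poly p x \<ge> 0" if "x \<in> {-1..1}" for x
  proof -
    have "closed {x. poly p x \<ge> 0}"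
      by (intro closed_Collect_le continuous_intros)
    moreover have "{-1<..<1} \<subseteq> {x. poly p x \<ge> 0}" using nonneg by auto
    ultimately have "closure {-1<..<1} \<subseteq> {x. poly p x \<ge> 0}"
      by (rule closure_minimal[rotated])
    then show ?thesis using that by auto
  qed
  have fn: "?f x \<ge> 0" if "x \<in> {-1..1}" for x
    using nonneg'[OF that] by (simp add: jacobi_weight_def)
  have cont: "continuous_on {-1/2..1/2} ?f"
    unfolding jacobi_weight_def by (intro continuous_intros) auto
  have int2: "?f integrable_on {-1/2..1/2}" using cont by (rule integrable_continuous_real)
  have "integral {-1/2..1/2} ?f \<le> integral {-1..1} ?f"
    using fn by (intro integral_subset_le int int2) auto
  moreover have "integral {-1/2..1/2} ?f \<ge> 0" using fn by (intro integral_nonneg int2) auto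
  moreover have "integral {-1/2..1/2} ?f \<noteq> 0"
  proof
    assume "integral {-1/2..1/2} ?f = 0"
    then have z: "\<forall>x\<in>{-1/2..1/2}. ?f x = 0"
      by (subst (asm) integral_eq_0_iff) (use cont fn in auto)
    have "{-1/2..1/2} \<subseteq> {x. poly p x = 0}"
    proof
      fix x :: real assume x: "x \<in> {-1/2..1/2}"
      then have "jacobi_weight a b x > 0" by (auto simp: jacobi_weight_def)
      then show "x \<in> {x. poly p x = 0}" using z x by auto
    qed
    moreover have "finite {x. poly p x = 0}" using assms(3) by (rule poly_roots_finite)
    ultimately have "finite {-1/2..1/2::real}" using finite_subset by blast
    then show False by (simp add: infinite_Icc)
  qed
  ultimately show ?thesis by linarith
qed

lemma jacobi_inner_self_pos:
  assumes "a > -1" "b > -1" "p \<noteq> 0"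
  shows "jacobi_inner a b p p > 0"
  unfolding jacobi_inner_eq using assms by (intro jacobi_weighted_integral_pos) auto

lemma jacobi_const_pos:
  assumes "a > -1" "b > -1"
  shows "jacobi_const a b > 0"
  using jacobi_weighted_integral_pos[OF assms, of 1] by (simp add: jacobi_const_def)

text \<open>Lagrange's identity: \<open>(1 - x)\<close> to the power \<open>a + 1\<close> times \<open>(1 + x)\<close> to the power \<open>b + 1\<close> times the
  Wronskian has derivative \<open>(\<lambda>\<^sub>m - \<lambda>\<^sub>l) p q w\<close>, and it vanishes at both endpoints because the two exponents
  are positive.\<close>

lemma jacobi_ode_orthogonal:
  assumes ab: "a > -1" "b > -1" and p: "jacobi_ode a b m p" and q: "jacobi_ode a b l q" and "m \<noteq> l"
  shows "jacobi_inner a b p q = 0"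
proof -
  let ?lm = "real m * (real m + a + b + 1)" and ?ll = "real l * (real l + a + b + 1)"
  let ?F = "\<lambda>x. (1 - x) powr (a+1) * (1 + x) powr (b+1) *
     (poly p x * poly (pderiv q) x - poly (pderiv p) x * poly q x)"
  have "((\<lambda>x. (?lm - ?ll) * (poly p x * poly q x * jacobi_weight a b x)) has_integral (?F 1 - ?F (-1))) {-1..1}"
  proof (rule fundamental_theorem_of_calculus_interior)
    show "continuous_on {-1..1} ?F"
      using ab by (intro continuous_intros continuous_on_powr') (auto intro!: continuous_intros)
    fix x :: real assume x: "x \<in> {-1<..<1}"
    let ?A = "(1-x) powr a" and ?B = "(1+x) powr b"
    have powA: "(1-x) powr (a+1) = ?A * (1-x)" and powB: "(1+x) powr (b+1) = ?B * (1+x)"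
      using x by (simp_all add: powr_add)
    have x': "1 - x > 0" "1 + x > 0" using x by auto
    have dA: "((\<lambda>x. (1 - x) powr (a+1)) has_real_derivative - ((a+1) * ?A)) (at x)"
      using x' by (auto intro!: derivative_eq_intros)
    have dB: "((\<lambda>x. (1 + x) powr (b+1)) has_real_derivative (b+1) * ?B) (at x)"
      using x' by (auto intro!: derivative_eq_intros)
    have dp: "((\<lambda>x. poly r x) has_real_derivative poly (pderiv r) x) (at x)" for r
      by (rule poly_DERIV)
    let ?p0 = "poly p x" and ?p1 = "poly (pderiv p) x" and ?p2 = "poly (pderiv (pderiv p)) x"
    let ?q0 = "poly q x" and ?q1 = "poly (pderiv q) x" and ?q2 = "poly (pderiv (pderiv q)) x"
    have D: "(?F has_real_derivative
        ((- ((a+1) * ?A)) * (1+x) powr (b+1) + (1-x) powr (a+1) * ((b+1) * ?B)) * (?p0 * ?q1 - ?p1 * ?q0)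
        + (1 - x) powr (a+1) * (1 + x) powr (b+1) * (?p0 * ?q2 - ?p2 * ?q0)) (at x)"
      by (rule derivative_eq_intros dA dB dp refl)+ (simp add: algebra_simps)
    have ep: "(1 - x\<^sup>2) * ?p2 + (b - a - (a + b + 2) * x) * ?p1 + ?lm * ?p0 = 0"
      using p by (simp add: jacobi_ode_iff)
    have eq: "(1 - x\<^sup>2) * ?q2 + (b - a - (a + b + 2) * x) * ?q1 + ?ll * ?q0 = 0"
      using q by (simp add: jacobi_ode_iff)
    have "((- ((a+1) * ?A)) * (1+x) powr (b+1) + (1-x) powr (a+1) * ((b+1) * ?B)) * (?p0 * ?q1 - ?p1 * ?q0)
        + (1 - x) powr (a+1) * (1 + x) powr (b+1) * (?p0 * ?q2 - ?p2 * ?q0)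
       = ?A * ?B * (?p0 * ((1 - x\<^sup>2) * ?q2 + (b - a - (a + b + 2) * x) * ?q1)
                  - ?q0 * ((1 - x\<^sup>2) * ?p2 + (b - a - (a + b + 2) * x) * ?p1))"
      unfolding powA powB by (simp add: algebra_simps power2_eq_square)
    also have "\<dots> = ?A * ?B * (?p0 * (- (?ll * ?q0)) - ?q0 * (- (?lm * ?p0)))"
    proof -
      have "(1 - x\<^sup>2) * ?q2 + (b - a - (a + b + 2) * x) * ?q1 = - (?ll * ?q0)"
        "(1 - x\<^sup>2) * ?p2 + (b - a - (a + b + 2) * x) * ?p1 = - (?lm * ?p0)"
        using ep eq by linarith+
      then show ?thesis by simp
    qed
    also have "\<dots> = (?lm - ?ll) * (?p0 * ?q0 * jacobi_weight a b x)"
      by (simp add: jacobi_weight_def algebra_simps)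
    finally show "(?F has_vector_derivative (?lm - ?ll) * (?p0 * ?q0 * jacobi_weight a b x)) (at x)"
      using D by (simp add: has_real_derivative_iff_has_vector_derivative)
  qed simp
  moreover have "?F 1 - ?F (-1) = 0" using ab by simp
  ultimately have "integral {-1..1} (\<lambda>x. (?lm - ?ll) * (poly p x * poly q x * jacobi_weight a b x)) = 0"
    by (metis integral_unique)
  then have "(?lm - ?ll) * jacobi_inner a b p q = 0" by (simp add: jacobi_inner_def)
  moreover have "?lm \<noteq> ?ll"
    using jacobi_eigenvalue_strict_mono[of "a+b+1" m l] jacobi_eigenvalue_strict_mono[of "a+b+1" l m]
      \<open>m \<noteq> l\<close> ab by (cases "m < l") (auto simp: add.assoc)
  ultimately show ?thesis by simp
qed

lemma poly_in_span_of_graded_system: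
  fixes p :: "nat \<Rightarrow> 'a::field poly"
  assumes deg: "\<And>m. degree (p m) = m" and nz: "\<And>m. p m \<noteq> 0" and "q = 0 \<or> degree q < n"
  shows "\<exists>c. q = (\<Sum>m<n. smult (c m) (p m))"
  using assms(3)
proof (induction n arbitrary: q)
  case 0
  then show ?case by auto
next
  case (Suc n)
  define k where "k = coeff q n / lead_coeff (p n)"
  define r where "r = q - smult k (p n)"
  have "coeff (p n) n \<noteq> 0" using deg[of n] nz[of n] by (metis leading_coeff_0_iff)
  then have cn: "coeff r n = 0" using deg[of n] by (simp add: r_def k_def)
  have "degree r \<le> n" unfolding r_def using Suc.prems deg[of n]
    by (intro degree_diff_le) (auto intro: order.trans[OF degree_smult_le])
  then have "r = 0 \<or> degree r < n" using cn
    by (metis leading_coeff_0_iff le_neq_implies_less)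
  from Suc.IH[OF this] obtain c where c: "r = (\<Sum>m<n. smult (c m) (p m))" by blast
  have "q = (\<Sum>m<Suc n. smult ((c(n := k)) m) (p m))"
  proof -
    have "(\<Sum>m<n. smult ((c(n := k)) m) (p m)) = r" unfolding c by (intro sum.cong) auto
    then show ?thesis by (simp add: r_def)
  qed
  then show ?case by blast
qed

lemma jacobi_inner_sum_right:
  assumes "a > -1" "b > -1"
  shows "jacobi_inner a b p (\<Sum>i\<in>A. f i) = (\<Sum>i\<in>A. jacobi_inner a b p (f i))"
  by (induction A rule: infinite_finite_induct) (auto simp: jacobi_inner_add_right[OF assms])

lemma orthonormal_jacobi_systemD:
  assumes "orthonormal_jacobi_system a b p"
  shows "degree (p m) = m" "p m \<noteq> 0"
proof -
  have "degree (p m) = m \<and> lead_coeff (p m) > 0"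
    using assms unfolding orthonormal_jacobi_system_def by blast
  then show "degree (p m) = m" "p m \<noteq> 0" by (blast, metis leading_coeff_0_iff less_irrefl)
qed

lemma orthonormal_jacobi_system_orthogonal_lower_degree:
  assumes ab: "a > -1" "b > -1" and "orthonormal_jacobi_system a b p" and "degree q < n \<or> q = 0"
  shows "jacobi_inner a b (p n) q = 0"
proof -
  have d: "degree (p m) = m" and nz: "p m \<noteq> 0" for m
    using orthonormal_jacobi_systemD[OF assms(3)] by auto
  have o: "jacobi_inner a b (p m) (p l) = 0" if "m \<noteq> l" for m l
  proof -
    have "jacobi_const a b * jacobi_inner a b (p m) (p l) = 0"
      using assms(3) that unfolding orthonormal_jacobi_system_def jacobi_inner_def by presburger
    then show ?thesis using jacobi_const_pos[OF ab] by simp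
  qed
  obtain c where c: "q = (\<Sum>m<n. smult (c m) (p m))"
    using poly_in_span_of_graded_system[of p q n] d nz assms(4) by blast
  show ?thesis
    unfolding c jacobi_inner_sum_right[OF ab] by (intro sum.neutral) (auto simp: jacobi_inner_smult_right o)
qed

lemma orthonormal_jacobi_system_exists:
  assumes ab: "a > -1" "b > -1"
  shows "\<exists>p. orthonormal_jacobi_system a b p \<and> (\<forall>n. jacobi_ode a b n (p n))"
proof -
  have "\<exists>P. degree P = n \<and> P \<noteq> 0 \<and> jacobi_ode a b n P" for n
    using jacobi_ode_solution_exists[OF ab] by metis
  then obtain P where P: "\<And>n. degree (P n) = n" "\<And>n. P n \<noteq> 0" "\<And>n. jacobi_ode a b n (P n)"
    by metis
  define N where "N n = jacobi_const a b * jacobi_inner a b (P n) (P n)" for n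
  have Npos: "N n > 0" for n unfolding N_def
    using jacobi_const_pos[OF ab] jacobi_inner_self_pos[OF ab P(2)] by simp
  \<comment> \<open>The sign makes the leading coefficient positive.\<close>
  define k where "k n = sgn (lead_coeff (P n)) / sqrt (N n)" for n
  have ksq: "k n * k n = 1 / N n" for n
    using Npos[of n] P(2)[of n] by (simp add: k_def sgn_if)
  have k0: "k n \<noteq> 0" for n using ksq[of n] Npos[of n] by auto
  define p where "p n = smult (k n) (P n)" for n
  have "orthonormal_jacobi_system a b p"
    unfolding orthonormal_jacobi_system_def
  proof (intro conjI allI)
    fix m l
    show "degree (p m) = m" using P k0 by (simp add: p_def)
    have "lead_coeff (p m) = \<bar>lead_coeff (P m)\<bar> / sqrt (N m)"
      by (simp add: p_def k_def abs_sgn mult.commute)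
    also have "\<dots> > 0" using P(2)[of m] Npos[of m] by simp
    finally show "lead_coeff (p m) > 0" .
    have "jacobi_inner a b (p m) (p l) = k l * k m * jacobi_inner a b (P m) (P l)"
      unfolding p_def jacobi_inner_smult_right
      by (subst jacobi_inner_commute) (simp add: jacobi_inner_smult_right jacobi_inner_commute)
    moreover have "jacobi_const a b * (k m * k m * jacobi_inner a b (P m) (P m)) = 1"
      using Npos[of m] unfolding ksq N_def by (metis divide_self mult.commute mult.left_commute
        nless_le times_divide_eq_left mult.right_neutral)
    ultimately show "jacobi_const a b * integral {-1..1} (\<lambda>x. poly (p m) x * poly (p l) x * jacobi_weight a b x)
        = (if m = l then 1 else 0)"
      using jacobi_ode_orthogonal[OF ab P(3) P(3), of m l] unfolding jacobi_inner_def[symmetric] by auto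
  qed
  moreover have "jacobi_ode a b n (p n)" for n unfolding p_def by (intro jacobi_ode_smult P)
  ultimately show ?thesis by blast
qed

text \<open>After the leading coefficients are matched, the difference of the two polynomials has lower degree,
  so it is orthogonal to both of them and hence to itself.\<close>

lemma orthonormal_jacobi_system_unique:
  assumes ab: "a > -1" "b > -1" and p: "orthonormal_jacobi_system a b p" and q: "orthonormal_jacobi_system a b q"
  shows "p = q"
proof
  fix m
  have dp: "degree (p m) = m" "lead_coeff (p m) > 0" and dq: "degree (q m) = m" "lead_coeff (q m) > 0"
    using p q unfolding orthonormal_jacobi_system_def by blast+
  define c where "c = lead_coeff (q m) / lead_coeff (p m)"
  have c: "c > 0" using dp dq by (simp add: c_def)
  define r where "r = q m - smult c (p m)"
  have "coeff r m = 0" using dp dq by (simp add: r_def c_def)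
  moreover have "degree r \<le> m" unfolding r_def using dp dq
    by (intro degree_diff_le) (auto intro: order.trans[OF degree_smult_le])
  ultimately have r: "degree r < m \<or> r = 0"
    by (metis leading_coeff_0_iff le_neq_implies_less)
  have "jacobi_inner a b r r = jacobi_inner a b r (q m) + (- c) * jacobi_inner a b r (p m)"
    using jacobi_inner_add_right[OF ab, of r "q m" "smult (-c) (p m)"]
    by (simp add: r_def jacobi_inner_smult_right del: smult_minus_left) (simp add: r_def)
  also have "\<dots> = 0"
    using orthonormal_jacobi_system_orthogonal_lower_degree[OF ab p r] orthonormal_jacobi_system_orthogonal_lower_degree[OF ab q r]
    by (simp add: jacobi_inner_commute)
  finally have "r = 0" using jacobi_inner_self_pos[OF ab, of r] by force
  then have qm: "q m = smult c (p m)" by (simp add: r_def)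
  have np: "jacobi_const a b * jacobi_inner a b (p m) (p m) = 1"
    and nq: "jacobi_const a b * jacobi_inner a b (q m) (q m) = 1"
    using p q unfolding orthonormal_jacobi_system_def jacobi_inner_def by auto
  have "jacobi_inner a b (q m) (q m) = c * (c * jacobi_inner a b (p m) (p m))"
    unfolding qm jacobi_inner_smult_right by (subst jacobi_inner_commute) (simp add: jacobi_inner_smult_right)
  then have "c * c = 1" using np nq by (metis mult.left_commute mult.right_neutral)
  then have "c = 1" using c by (metis mult_cancel_left mult.right_neutral power2_eq_square power2_eq_1_iff
     less_asym neg_less_0_iff_less zero_less_one)
  then show "p m = q m" using qm by simp
qed

lemma
  assumes ab: "a > -1" "b > -1"
  shows orthonormal_jacobi_system_jacobi: "orthonormal_jacobi_system a b (jacobi a b)"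
    and jacobi_ode_jacobi: "jacobi_ode a b n (jacobi a b n)"
proof -
  obtain p where p: "orthonormal_jacobi_system a b p" "\<And>n. jacobi_ode a b n (p n)"
    using orthonormal_jacobi_system_exists[OF ab] by blast
  have "jacobi a b = p" unfolding jacobi_def
    using p(1) orthonormal_jacobi_system_unique[OF ab] by (intro the_equality) auto
  then show "orthonormal_jacobi_system a b (jacobi a b)" "jacobi_ode a b n (jacobi a b n)"
    using p by auto
qed

lemma
  assumes ab: "a > -1" "b > -1"
  shows degree_jacobi: "degree (jacobi a b n) = n" and jacobi_nonzero: "jacobi a b n \<noteq> 0"
  using orthonormal_jacobi_systemD[OF orthonormal_jacobi_system_jacobi[OF ab]] by auto

lemma prod_linear_dvd:
  fixes P :: "'a::field poly"
  assumes "finite X" "\<And>x. x \<in> X \<Longrightarrow> poly P x = 0"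
  shows "(\<Prod>x\<in>X. [:-x, 1:]) dvd P"
  using assms
proof (induction X arbitrary: P rule: finite_induct)
  case (insert x X)
  obtain Q where Q: "P = [:-x, 1:] * Q" using insert.prems[of x] by (auto simp: poly_eq_0_iff_dvd)
  have "poly Q y = 0" if "y \<in> X" for y
    using insert.prems[of y] that insert.hyps by (auto simp: Q)
  then have "(\<Prod>x\<in>X. [:-x, 1:]) dvd Q" by (rule insert.IH)
  then show ?case unfolding Q prod.insert[OF insert.hyps] by (rule mult_dvd_mono[OF dvd_refl])
qed simp

lemma degree_prod_linear:
  fixes X :: "'a::field set"
  shows "degree (\<Prod>x\<in>X. [:-x, 1:]) = card X"
proof (induction X rule: infinite_finite_induct)
  case (insert x F)
  have "(\<Prod>x\<in>F. [:-x, 1:]) \<noteq> 0" using insert.hyps by auto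
  then have "degree ([:-x, 1:] * (\<Prod>x\<in>F. [:-x, 1:])) = Suc (card F)"
    using insert.IH by (subst degree_mult_eq) auto
  then show ?case unfolding prod.insert[OF insert.hyps] using insert.hyps by simp
qed auto

text \<open>If there were fewer than \<open>n\<close> zeros, the product \<open>q\<close> of the corresponding linear factors would be
  orthogonal to the polynomial; but since the zeros are simple, their product has constant sign.\<close>

lemma card_jacobi_zeros:
  assumes ab: "a > -1" "b > -1"
  shows "card {x. -1 < x \<and> x < 1 \<and> poly (jacobi a b n) x = 0} = n"
proof -
  let ?P = "jacobi a b n"
  define X where "X = {x. -1 < x \<and> x < 1 \<and> poly ?P x = 0}"
  have P0: "?P \<noteq> 0" and degP: "degree ?P = n"
    using jacobi_nonzero[OF ab] degree_jacobi[OF ab] by auto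
  have finX: "finite X" unfolding X_def using poly_roots_finite[OF P0] by (rule rev_finite_subset) auto
  define q where "q = (\<Prod>x\<in>X. [:-x, 1:])"
  have "q dvd ?P" unfolding q_def by (rule prod_linear_dvd) (use finX in \<open>auto simp: X_def\<close>)
  then obtain r where r: "?P = q * r" by blast
  have r0: "poly r x \<noteq> 0" if "-1 < x" "x < 1" for x
  proof
    assume rx: "poly r x = 0"
    then have "x \<in> X" using that r by (auto simp: X_def)
    then have "poly q x = 0" by (auto simp: q_def poly_prod finX)
    then have "poly (pderiv ?P) x = 0" unfolding r pderiv_mult using rx by simp
    then show False using jacobi_ode_simple_zero[OF jacobi_ode_jacobi[OF ab] P0] \<open>x \<in> X\<close>
      by (auto simp: X_def)
  qed
  have "(\<forall>x. -1 < x \<longrightarrow> x < 1 \<longrightarrow> poly r x \<ge> 0) \<or> (\<forall>x. -1 < x \<longrightarrow> x < 1 \<longrightarrow> poly (-r) x \<ge> 0)"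
  proof (rule ccontr)
    assume "\<not> ?thesis"
    then obtain x y where xy: "-1 < x" "x < 1" "-1 < y" "y < 1" "poly r x < 0" "poly r y > 0"
      by (auto simp: not_le)
    then have "\<exists>z. min x y \<le> z \<and> z \<le> max x y \<and> poly r z = 0"
      using poly_IVT_pos[of x y r] poly_IVT_neg[of y x r]
      by (cases x y rule: linorder_cases) (auto intro: less_imp_le)
    then show False using r0 xy by (metis less_le_trans min_less_iff_conj le_less_trans max_less_iff_conj)
  qed
  then obtain r' where r': "r' = r \<or> r' = - r" "\<And>x. -1 < x \<Longrightarrow> x < 1 \<Longrightarrow> poly r' x \<ge> 0"
    by blast
  have "q \<noteq> 0" "r' \<noteq> 0" using P0 r r' by auto
  then have pos: "integral {-1..1} (\<lambda>x. poly (q * q * r') x * jacobi_weight a b x) > 0"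
    using r'(2) by (intro jacobi_weighted_integral_pos ab) auto
  have "q * q * r' = ?P * q \<or> q * q * r' = ?P * - q"
    using r'(1) r by auto
  then have "jacobi_inner a b ?P q \<noteq> 0"
  proof
    assume "q * q * r' = ?P * - q"
    then have "jacobi_inner a b ?P (smult (-1) q) > 0" using pos by (simp add: jacobi_inner_eq)
    then show ?thesis unfolding jacobi_inner_smult_right by simp
  next
    assume e: "q * q * r' = ?P * q"
    have "jacobi_inner a b ?P q > 0" using pos unfolding e jacobi_inner_eq .
    then show ?thesis by simp
  qed
  then have "\<not> degree q < n"
    using orthonormal_jacobi_system_orthogonal_lower_degree[OF ab orthonormal_jacobi_system_jacobi[OF ab]] by blast
  then have "n \<le> card X" by (simp add: q_def degree_prod_linear)
  moreover have "card X \<le> n"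
    using dvd_imp_degree_le[OF \<open>q dvd ?P\<close> P0] degP by (simp add: q_def degree_prod_linear)
  ultimately show ?thesis by (simp add: X_def)
qed

section \<open>Zeros of a polynomial solution\<close>

definition lagrange_poly :: "real set \<Rightarrow> real \<Rightarrow> real poly" where
  "lagrange_poly X x = (\<Prod>y\<in>X - {x}. smult (inverse (x - y)) [:-y, 1:])"

lemma poly_lagrange_poly: "poly (lagrange_poly X x) t = (\<Prod>y\<in>X - {x}. (t - y) / (x - y))"
  unfolding lagrange_poly_def poly_prod by (intro prod.cong refl) (simp add: divide_inverse algebra_simps)

lemma lagrange_poly_node:
  assumes "finite X" "x \<in> X" "y \<in> X"
  shows "poly (lagrange_poly X x) y = (if x = y then 1 else 0)"
  using assms by (auto simp: poly_lagrange_poly intro!: prod.neutral prod_zero)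

lemma degree_lagrange_poly:
  assumes "finite X" "x \<in> X"
  shows "degree (lagrange_poly X x) \<le> card X - 1"
proof -
  have "degree (lagrange_poly X x) \<le> (\<Sum>y\<in>X - {x}. degree (smult (inverse (x - y)) [:-y, 1:]))"
    unfolding lagrange_poly_def
    using degree_prod_sum_le[of "X - {x}" "\<lambda>y. smult (inverse (x - y)) [:-y, 1:]"] assms
    by (simp only: o_def finite_Diff)
  also have "\<dots> \<le> (\<Sum>y\<in>X - {x}. 1)"
    by (intro sum_mono order.trans[OF degree_smult_le]) auto
  also have "\<dots> = card X - 1" using assms by simp
  finally show ?thesis .
qed

lemma lagrange_poly_reflect:
  "poly (lagrange_poly (uminus ` X) (- x)) (- t) = poly (lagrange_poly X x) t"
proof -
  have eq: "uminus ` X - {- x} = uminus ` (X - {x})" by auto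
  have "(\<Prod>y\<in>uminus ` (X - {x}). (- t - y) / (- x - y)) = (\<Prod>y\<in>X - {x}. (- t - - y) / (- x - - y))"
    by (subst prod.reindex) (auto simp: inj_on_def)
  also have "\<dots> = (\<Prod>y\<in>X - {x}. (t - y) / (x - y))"
    by (intro prod.cong refl) (metis minus_diff_minus minus_divide_divide)
  finally show ?thesis unfolding poly_lagrange_poly eq .
qed

text \<open>A weak form of Jordan's inequality; the constant only enters final constants.\<close>

lemma half_le_sin:
  fixes x :: real
  assumes "0 \<le> x" "x \<le> pi / 2"
  shows "x / 2 \<le> sin x"
proof (cases "x \<le> pi / 3")
  case True
  have "sin 0 - 0 / 2 \<le> sin x - x / 2"
  proof (rule DERIV_nonneg_imp_nondecreasing[OF assms(1), where f = "\<lambda>x. sin x - x / 2"])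
    fix y assume y: "0 \<le> y" "y \<le> x"
    have "cos (pi / 3) \<le> cos y" using y True by (intro cos_monotone_0_pi_le) auto
    then have "cos y - 1 / 2 \<ge> 0" by (simp add: cos_60)
    moreover have "((\<lambda>x. sin x - x / 2) has_real_derivative cos y - 1 / 2) (at y)"
      by (auto intro!: derivative_eq_intros)
    ultimately show "\<exists>d. ((\<lambda>x. sin x - x / 2) has_real_derivative d) (at y) \<and> d \<ge> 0" by blast
  qed
  then show ?thesis by simp
next
  case False
  then have "sin (pi / 3) \<le> sin x" using assms by (intro sin_monotone_2pi_le) auto
  moreover have "sqrt 3 \<ge> 17 / 10" by (rule real_le_rsqrt) (simp add: power2_eq_square)
  moreover have "pi < 3.2" using pi_approx by simp
  ultimately show ?thesis using assms by (simp add: sin_60)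
qed

text \<open>The exponents \<open>\<sigma> = \<alpha> + 1/2\<close> and \<open>\<tau> = \<beta> + 1/2\<close> are those of the Liouville factor below, and the lower
  bound \<open>-1/2\<close> for \<open>\<alpha>, \<beta>\<close> becomes nonnegativity. The polynomial is not normalized, because Lagrange
  basis polynomials do not see scalar factors; so \<open>x \<mapsto> -x\<close> maps the setting to itself with \<open>\<sigma>\<close> and \<open>\<tau>\<close>
  exchanged. Every constant defined in this locale depends on \<open>\<sigma>\<close> and \<open>\<tau>\<close> (and an exponent) only.\<close>

locale jacobi_zeros =
  fixes \<sigma> \<tau> :: real and n :: nat and P :: "real poly"
  assumes \<sigma>_nonneg: "\<sigma> \<ge> 0" and \<tau>_nonneg: "\<tau> \<ge> 0" and n_pos: "n \<ge> 1"
    and degree_P: "degree P = n"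
    and ode: "jacobi_ode (\<sigma> - 1 / 2) (\<tau> - 1 / 2) n P"
    and card_zeros: "card {x. -1 < x \<and> x < 1 \<and> poly P x = 0} = n"
begin

definition X where "X = {x. -1 < x \<and> x < 1 \<and> poly P x = 0}"
definition lam where "lam = real n * (real n + \<sigma> + \<tau>)"

text \<open>The frequency of the oscillation in the angle: it has order \<open>n\<close>, and all distances between angles
  are compared with \<open>1 / L\<close>.\<close>

definition L where "L = sqrt lam"

lemma P_nonzero: "P \<noteq> 0"
  using degree_P n_pos by auto

lemma finite_X [simp]: "finite X"
  using poly_roots_finite[OF P_nonzero] by (rule rev_finite_subset) (auto simp: X_def)

lemma zero_bounds: "x \<in> X \<Longrightarrow> -1 < x \<and> x < 1"
  by (simp add: X_def)

lemma zero_of_P: "x \<in> X \<Longrightarrow> poly P x = 0"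
  by (simp add: X_def)

lemma card_X: "card X = n"
  using card_zeros by (simp add: X_def)

lemma lam_ge: "lam \<ge> real n ^ 2"
  using \<sigma>_nonneg \<tau>_nonneg by (simp add: lam_def power2_eq_square algebra_simps)

lemma lam_le: "lam \<le> (1 + \<sigma> + \<tau>) * real n ^ 2"
proof -
  have "real n * (\<sigma> + \<tau>) * 1 \<le> real n * (\<sigma> + \<tau>) * real n"
    using \<sigma>_nonneg \<tau>_nonneg n_pos by (intro mult_left_mono) auto
  then show ?thesis by (simp add: lam_def power2_eq_square algebra_simps)
qed

lemma L_ge: "L \<ge> real n"
  unfolding L_def using lam_ge by (intro real_le_rsqrt)

lemma L_ge_1: "L \<ge> 1"
  using L_ge n_pos by linarith

lemma L_pos: "L > 0" using L_ge_1 by linarith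

lemma L_sq: "L\<^sup>2 = lam"
proof -
  have "lam \<ge> 0" using lam_ge by (meson order.trans zero_le_power2)
  then show ?thesis by (simp add: L_def)
qed

lemma lam_pos: "lam > 0" unfolding L_sq[symmetric] using L_pos by simp

lemma L_le: "L \<le> (1 + \<sigma> + \<tau>) * real n"
  unfolding L_def
proof (rule real_le_lsqrt)
  have "(1 + \<sigma> + \<tau>) * 1 \<le> (1 + \<sigma> + \<tau>) * (1 + \<sigma> + \<tau>)" using \<sigma>_nonneg \<tau>_nonneg by (intro mult_left_mono) auto
  then have "(1 + \<sigma> + \<tau>) * real n ^ 2 \<le> ((1 + \<sigma> + \<tau>) * (1 + \<sigma> + \<tau>)) * real n ^ 2"
    by (intro mult_right_mono) auto
  then show "lam \<le> ((1 + \<sigma> + \<tau>) * real n)\<^sup>2"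
    using lam_le by (simp add: power2_eq_square algebra_simps)
qed (use \<sigma>_nonneg \<tau>_nonneg in auto)

lemma ode_at: "(1 - x\<^sup>2) * poly (pderiv (pderiv P)) x
     + (\<tau> - \<sigma> - (\<sigma> + \<tau> + 1) * x) * poly (pderiv P) x + lam * poly P x = 0"
proof -
  have e: "\<tau> - 1/2 - (\<sigma> - 1/2) = \<tau> - \<sigma>" "\<sigma> - 1/2 + (\<tau> - 1/2) + 2 = \<sigma> + \<tau> + 1"
    "real n * (real n + (\<sigma> - 1/2) + (\<tau> - 1/2) + 1) = lam"
    by (auto simp: lam_def algebra_simps)
  show ?thesis using ode unfolding jacobi_ode_iff e by blast
qed

lemma P_factorization: "P = smult (lead_coeff P) (\<Prod>x\<in>X. [:-x, 1:])"
proof -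
  have "(\<Prod>x\<in>X. [:-x, 1:]) dvd P" by (rule prod_linear_dvd[OF finite_X]) (auto simp: X_def)
  then obtain Q where Q: "P = (\<Prod>x\<in>X. [:-x, 1:]) * Q" by blast
  then have nz: "Q \<noteq> 0" "(\<Prod>x\<in>X. [:-x, 1:]) \<noteq> 0" using P_nonzero by auto
  have "degree P = n + degree Q" using nz Q by (metis degree_mult_eq degree_prod_linear card_X)
  then have "degree Q = 0" using degree_P by simp
  then obtain c where c: "Q = [:c:]" using degree_eq_zeroE by blast
  have "lead_coeff (\<Prod>x\<in>X. [:-x, 1:]) = (1::real)" by (simp add: lead_coeff_prod)
  then have "lead_coeff ((\<Prod>x\<in>X. [:-x, 1:]) * Q) = c"
    by (simp add: c lead_coeff_mult del: mult_pCons_right)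
  with Q have "lead_coeff P = c" by (rule ssubst[OF arg_cong[of _ _ lead_coeff]])
  moreover have "(\<Prod>x\<in>X. [:-x, 1:]) * Q = smult c (\<Prod>x\<in>X. [:-x, 1:])" by (simp add: c)
  ultimately show ?thesis using Q by metis
qed

lemma poly_P: "poly P t = lead_coeff P * (\<Prod>x\<in>X. t - x)"
  by (rule trans[OF arg_cong[OF P_factorization, of "\<lambda>p. poly p t"]]) (simp add: poly_prod)

lemma poly_pderiv_P: "poly (pderiv P) t = lead_coeff P * (\<Sum>x\<in>X. \<Prod>y\<in>X - {x}. t - y)"
  by (rule trans[OF arg_cong[OF P_factorization, of "\<lambda>p. poly (pderiv p) t"]])
    (simp add: pderiv_smult pderiv_prod poly_sum poly_prod pderiv_pCons)

lemma poly_P_lagrange: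
  assumes "x \<in> X"
  shows "poly P t = (t - x) * poly (pderiv P) x * poly (lagrange_poly X x) t"
proof -
  have "(\<Sum>z\<in>X. \<Prod>y\<in>X - {z}. x - y) = (\<Sum>z\<in>X. if z = x then \<Prod>y\<in>X - {x}. x - y else 0)"
    using assms by (intro sum.cong refl) (auto intro!: prod_zero)
  then have d: "poly (pderiv P) x = lead_coeff P * (\<Prod>y\<in>X - {x}. x - y)"
    using assms by (simp add: poly_pderiv_P)
  have nz: "(\<Prod>y\<in>X - {x}. x - y) \<noteq> 0" by simp
  have "poly P t = lead_coeff P * ((t - x) * (\<Prod>y\<in>X - {x}. t - y))"
    unfolding poly_P using assms by (simp add: prod.remove)
  then show ?thesis using nz by (simp add: d poly_lagrange_poly prod_dividef)
qed

lemma pderiv_P_nonzero: "x \<in> X \<Longrightarrow> poly (pderiv P) x \<noteq> 0"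
  using jacobi_ode_simple_zero[OF ode P_nonzero] zero_bounds zero_of_P by blast

lemma lagrange_eq:
  assumes "x \<in> X" "t \<noteq> x"
  shows "poly (lagrange_poly X x) t = poly P t / ((t - x) * poly (pderiv P) x)"
  using poly_P_lagrange[OF assms(1), of t] assms pderiv_P_nonzero[OF assms(1)] by (simp add: field_simps)

lemma poly_P_1_nonzero: "poly P 1 \<noteq> 0"
  unfolding poly_P using P_nonzero zero_bounds by force

text \<open>The sum is the logarithmic derivative of \<open>P\<close> at \<open>1\<close>, and there the second order term of the
  equation drops out.\<close>

lemma sum_inverse_one_minus_zeros: "(\<Sum>x\<in>X. 1 / (1 - x)) = lam / (2 * \<sigma> + 1)"
proof -
  have "poly (pderiv P) 1 = poly P 1 * (\<Sum>x\<in>X. 1 / (1 - x))"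
    unfolding poly_pderiv_P poly_P mult.assoc sum_distrib_left
  proof (intro arg_cong[where f = "\<lambda>z. lead_coeff P * z"] sum.cong refl)
    fix x assume x: "x \<in> X"
    then have "1 - x \<noteq> 0" using zero_bounds[of x] by simp
    then show "(\<Prod>y\<in>X - {x}. 1 - y) = (\<Prod>x\<in>X. 1 - x) * (1 / (1 - x))"
      using x by (simp add: prod.remove)
  qed
  moreover have "lam * poly P 1 = (2 * \<sigma> + 1) * poly (pderiv P) 1"
    using ode_at[of 1] by (simp add: algebra_simps)
  ultimately have "poly P 1 * (lam - (2 * \<sigma> + 1) * (\<Sum>x\<in>X. 1 / (1 - x))) = 0"
    by (simp add: algebra_simps)
  then show ?thesis
    using poly_P_1_nonzero \<sigma>_nonneg by (simp add: nonzero_eq_divide_eq mult.commute)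
qed

lemma one_minus_zero_ge:
  assumes "x \<in> X"
  shows "1 - x \<ge> 1 / lam"
proof -
  have "1 / (1 - x) \<le> (\<Sum>x\<in>X. 1 / (1 - x))"
  proof (rule member_le_sum[OF assms _ finite_X, where f = "\<lambda>x. 1 / (1 - x)"])
    fix y assume "y \<in> X - {x}"
    then have "1 - y > 0" using zero_bounds[of y] by simp
    then show "0 \<le> 1 / (1 - y)" by simp
  qed
  also have "\<dots> \<le> lam / 1"
    unfolding sum_inverse_one_minus_zeros using \<sigma>_nonneg lam_pos by (intro divide_left_mono) auto
  finally have "1 / (1 - x) \<le> lam" by simp
  moreover have "1 - x > 0" using zero_bounds[OF assms] by simp
  ultimately show ?thesis using lam_pos by (simp add: field_simps)
qed

text \<open>The quotient \<open>P t / P 1\<close> is the product of \<open>1 - (1 - t) / (1 - x)\<close> over the zeros \<open>x\<close>. By the previous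
  sum the subtracted terms add up to at most \<open>1/2\<close>, so the Weierstrass product inequality applies.\<close>

lemma abs_P_near_1:
  assumes "1 - 1 / (2 * lam) \<le> t" "t \<le> 1"
  shows "\<bar>poly P 1\<bar> \<le> 2 * \<bar>poly P t\<bar>" "\<bar>poly P t\<bar> \<le> \<bar>poly P 1\<bar>"
proof -
  have half: "1 / (2 * lam) \<le> 1 / lam" using lam_pos by (intro divide_left_mono) auto
  have f: "(1 - t) / (1 - x) \<in> {0..1}" if "x \<in> X" for x
    using one_minus_zero_ge[OF that] assms half zero_bounds[OF that] by auto
  have "poly P t = poly P 1 * (\<Prod>x\<in>X. 1 - (1 - t) / (1 - x))"
  proof -
    have "(\<Prod>x\<in>X. t - x) = (\<Prod>x\<in>X. (1 - x) * (1 - (1 - t) / (1 - x)))"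
    proof (intro prod.cong refl)
      fix x assume "x \<in> X"
      then have "1 - x \<noteq> 0" using zero_bounds[of x] by simp
      then show "t - x = (1 - x) * (1 - (1 - t) / (1 - x))" by (simp add: field_simps)
    qed
    then show ?thesis unfolding poly_P by (simp add: prod.distrib)
  qed
  then have eq: "\<bar>poly P t\<bar> = \<bar>poly P 1\<bar> * \<bar>\<Prod>x\<in>X. 1 - (1 - t) / (1 - x)\<bar>" by (simp add: abs_mult)
  have "(\<Sum>x\<in>X. (1 - t) / (1 - x)) = (1 - t) * (\<Sum>x\<in>X. 1 / (1 - x))"
    by (simp add: sum_distrib_left)
  also have "\<dots> \<le> 1 / (2 * lam) * lam"
    unfolding sum_inverse_one_minus_zeros
    using assms lam_pos \<sigma>_nonneg by (intro mult_mono) (auto simp: field_simps)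
  also have "\<dots> = 1 / 2" using lam_pos by simp
  finally have "1 / 2 \<le> (\<Prod>x\<in>X. 1 - (1 - t) / (1 - x))"
    using Weierstrass_prod_ineq[of X "\<lambda>x. (1 - t) / (1 - x)"] f by force
  then have ge: "1 / 2 \<le> \<bar>\<Prod>x\<in>X. 1 - (1 - t) / (1 - x)\<bar>" by linarith
  have "(\<Prod>x\<in>X. 1 - (1 - t) / (1 - x)) \<le> 1" "(\<Prod>x\<in>X. 1 - (1 - t) / (1 - x)) \<ge> 0"
    using f by (auto intro!: prod_le_1 prod_nonneg)
  then have le: "\<bar>\<Prod>x\<in>X. 1 - (1 - t) / (1 - x)\<bar> \<le> 1" by simp
  show "\<bar>poly P 1\<bar> \<le> 2 * \<bar>poly P t\<bar>" unfolding eq using mult_left_mono[OF ge, of "\<bar>poly P 1\<bar>"] by simp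
  show "\<bar>poly P t\<bar> \<le> \<bar>poly P 1\<bar>" unfolding eq using mult_left_mono[OF le, of "\<bar>poly P 1\<bar>"] by simp
qed

lemma reflected_zeros:
  "{x. -1 < x \<and> x < 1 \<and> poly (pcompose P [:0, -1:]) x = 0} = uminus ` X"
proof (rule set_eqI)
  fix x
  have "x \<in> uminus ` X \<longleftrightarrow> - x \<in> X" by (metis image_iff minus_minus)
  then show "x \<in> {x. -1 < x \<and> x < 1 \<and> poly (pcompose P [:0, -1:]) x = 0} \<longleftrightarrow> x \<in> uminus ` X"
    by (auto simp: X_def poly_pcompose)
qed

lemma reflected: "jacobi_zeros \<tau> \<sigma> n (pcompose P [:0, -1:])"
proof
  let ?Q = "pcompose P [:0, -1:]"
  have d1: "pderiv ?Q = - pcompose (pderiv P) [:0, -1:]"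
    by (simp add: pderiv_pcompose pderiv_pCons)
  have d2: "pderiv (pderiv ?Q) = pcompose (pderiv (pderiv P)) [:0, -1:]"
    by (simp add: d1 pderiv_pcompose pderiv_pCons pderiv_minus)
  show "jacobi_ode (\<tau> - 1 / 2) (\<sigma> - 1 / 2) n ?Q"
    unfolding jacobi_ode_iff
  proof
    fix x
    have e: "\<sigma> - 1/2 - (\<tau> - 1/2) = \<sigma> - \<tau>" "\<tau> - 1/2 + (\<sigma> - 1/2) + 2 = \<sigma> + \<tau> + 1"
    "real n * (real n + (\<tau> - 1/2) + (\<sigma> - 1/2) + 1) = lam"
      by (auto simp: lam_def algebra_simps)
    show "(1 - x\<^sup>2) * poly (pderiv (pderiv ?Q)) x + (\<sigma> - 1/2 - (\<tau> - 1/2) - (\<tau> - 1/2 + (\<sigma> - 1/2) + 2) * x) * poly (pderiv ?Q) x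
       + real n * (real n + (\<tau> - 1/2) + (\<sigma> - 1/2) + 1) * poly ?Q x = 0"
      unfolding e d2 unfolding d1 using ode_at[of "-x"] by (simp add: poly_pcompose algebra_simps)
  qed
  show "card {x. -1 < x \<and> x < 1 \<and> poly ?Q x = 0} = n"
    by (simp add: reflected_zeros card_image card_X)
qed (use \<sigma>_nonneg \<tau>_nonneg n_pos degree_P in \<open>auto simp: degree_pcompose\<close>)

lemma reflected_X: "jacobi_zeros.X (pcompose P [:0, -1:]) = uminus ` X"
  using reflected_zeros by (simp add: jacobi_zeros.X_def[OF reflected])

lemma reflected_lam: "jacobi_zeros.lam \<tau> \<sigma> n = lam"
  by (simp add: jacobi_zeros.lam_def[OF reflected] lam_def add_ac)

lemma one_plus_zero_ge:
  assumes "x \<in> X"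
  shows "1 + x \<ge> 1 / lam"
  using jacobi_zeros.one_minus_zero_ge[OF reflected, of "- x"] assms
  by (simp add: reflected_X reflected_lam)

end

section \<open>Liouville transform and its energy\<close>

lemma sin_cos_half_pos:
  assumes "0 < \<theta>" "\<theta> < pi"
  shows "sin (\<theta> / 2) > 0" "cos (\<theta> / 2) > 0"
  using assms by (auto intro!: sin_gt_zero cos_gt_zero)

lemma sin_eq_half: "sin (\<theta>::real) = 2 * sin (\<theta> / 2) * cos (\<theta> / 2)"
  using sin_double[of "\<theta> / 2"] by simp

lemma cos_eq_half: "cos (\<theta>::real) = (cos (\<theta> / 2))\<^sup>2 - (sin (\<theta> / 2))\<^sup>2"
  using cos_double[of "\<theta> / 2"] by simp

lemma DERIV_tan_half:
  assumes "cos (\<theta> / 2) \<noteq> (0::real)"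
  shows "((\<lambda>\<theta>. sin (\<theta> / 2) / cos (\<theta> / 2)) has_real_derivative 1 / (2 * (cos (\<theta> / 2))\<^sup>2)) (at \<theta>)"
proof -
  let ?s = "sin (\<theta> / 2)" and ?c = "cos (\<theta> / 2)"
  have e: "(?c / 2) * ?c - ?s * (- (?s / 2)) = 1 / 2"
    using sin_cos_squared_add[of "\<theta>/2"] by (simp add: power2_eq_square)
  have "((\<lambda>\<theta>. sin (\<theta> / 2) / cos (\<theta> / 2)) has_real_derivative
      ((?c / 2) * ?c - ?s * (- (?s / 2))) / (?c * ?c)) (at \<theta>)"
    using assms by (auto intro!: derivative_eq_intros)
  then show ?thesis unfolding e by (simp add: power2_eq_square)
qed

lemma DERIV_cot_half:
  assumes "sin (\<theta> / 2) \<noteq> (0::real)"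
  shows "((\<lambda>\<theta>. cos (\<theta> / 2) / sin (\<theta> / 2)) has_real_derivative - 1 / (2 * (sin (\<theta> / 2))\<^sup>2)) (at \<theta>)"
proof -
  let ?s = "sin (\<theta> / 2)" and ?c = "cos (\<theta> / 2)"
  have e: "- (?s / 2) * ?s - ?c * (?c / 2) = - 1 / 2"
    using sin_cos_squared_add[of "\<theta>/2"] by (simp add: power2_eq_square)
  have "((\<lambda>\<theta>. cos (\<theta> / 2) / sin (\<theta> / 2)) has_real_derivative
      (- (?s / 2) * ?s - ?c * (?c / 2)) / (?s * ?s)) (at \<theta>)"
    using assms by (auto intro!: derivative_eq_intros)
  then show ?thesis unfolding e by (simp add: power2_eq_square)
qed

lemma DERIV_poly_cos: "((\<lambda>\<theta>. poly Q (cos \<theta>)) has_real_derivative - sin \<theta> * poly (pderiv Q) (cos \<theta>)) (at \<theta>)"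
  by (rule DERIV_cong[OF DERIV_chain2[OF poly_DERIV DERIV_cos]]) simp

text \<open>Both \<open>e \<cdot> exp g\<close> and \<open>e \<cdot> exp (- g)\<close> are monotone.\<close>

lemma gronwall_two_sided:
  fixes e g e' g' :: "real \<Rightarrow> real"
  assumes ab: "a \<le> b"
    and e: "\<And>x. a \<le> x \<Longrightarrow> x \<le> b \<Longrightarrow> (e has_real_derivative e' x) (at x)"
    and g: "\<And>x. a \<le> x \<Longrightarrow> x \<le> b \<Longrightarrow> (g has_real_derivative g' x) (at x)"
    and bound: "\<And>x. a \<le> x \<Longrightarrow> x \<le> b \<Longrightarrow> \<bar>e' x\<bar> \<le> g' x * e x"
  shows "e a \<le> e b * exp (g b - g a)" "e b \<le> e a * exp (g b - g a)"
proof -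
  have "e a * exp (g a) \<le> e b * exp (g b)"
  proof (rule DERIV_nonneg_imp_nondecreasing[OF ab, where f = "\<lambda>x. e x * exp (g x)"])
    fix x assume x: "a \<le> x" "x \<le> b"
    have "((\<lambda>x. e x * exp (g x)) has_real_derivative exp (g x) * (e' x + g' x * e x)) (at x)"
      by (rule DERIV_cong[OF DERIV_mult[OF e[OF x] DERIV_fun_exp[OF g[OF x]]]]) (simp add: algebra_simps)
    moreover have "0 \<le> exp (g x) * (e' x + g' x * e x)"
      using bound[OF x] by (intro mult_nonneg_nonneg) auto
    ultimately show "\<exists>d. ((\<lambda>x. e x * exp (g x)) has_real_derivative d) (at x) \<and> 0 \<le> d" by blast
  qed
  then show "e a \<le> e b * exp (g b - g a)" by (simp add: exp_diff field_simps)
  have "e b * exp (- g b) \<le> e a * exp (- g a)"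
  proof (rule DERIV_nonpos_imp_nonincreasing[OF ab, where f = "\<lambda>x. e x * exp (- g x)"])
    fix x assume x: "a \<le> x" "x \<le> b"
    have "((\<lambda>x. e x * exp (- g x)) has_real_derivative exp (- g x) * (e' x - g' x * e x)) (at x)"
      by (rule DERIV_cong[OF DERIV_mult[OF e[OF x] DERIV_fun_exp[OF DERIV_minus[OF g[OF x]]]]]) (simp add: algebra_simps)
    moreover have "exp (- g x) * (e' x - g' x * e x) \<le> 0"
      using bound[OF x] by (intro mult_nonneg_nonpos) auto
    ultimately show "\<exists>d. ((\<lambda>x. e x * exp (- g x)) has_real_derivative d) (at x) \<and> d \<le> 0" by blast
  qed
  then show "e b \<le> e a * exp (g b - g a)" by (simp add: exp_diff exp_minus field_simps)
qed

context jacobi_zeros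
begin

text \<open>The Liouville factor: \<open>rho\<close> removes the first order term of the equation in the angle, which is
  \<open>y'' + drift y' + lam y = 0\<close> with \<open>drift = 2 rho' / rho\<close>. Below, \<open>drift'\<close> is the derivative of \<open>drift\<close>,
  \<open>V\<close> is the derivative of \<open>U\<close>, and \<open>potential\<close> is the perturbation in \<open>U'' = (potential - lam) U\<close>.\<close>

definition rho where "rho \<theta> = sin (\<theta> / 2) powr \<sigma> * cos (\<theta> / 2) powr \<tau>"
definition drift where
  "drift \<theta> = \<sigma> * (cos (\<theta> / 2) / sin (\<theta> / 2)) - \<tau> * (sin (\<theta> / 2) / cos (\<theta> / 2))"
definition drift' where
  "drift' \<theta> = - \<sigma> / (2 * (sin (\<theta> / 2))\<^sup>2) - \<tau> / (2 * (cos (\<theta> / 2))\<^sup>2)"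
definition U where "U \<theta> = rho \<theta> * poly P (cos \<theta>)"
definition V where
  "V \<theta> = rho \<theta> * (drift \<theta> / 2 * poly P (cos \<theta>) - sin \<theta> * poly (pderiv P) (cos \<theta>))"
definition potential where "potential \<theta> = drift' \<theta> / 2 + (drift \<theta>)\<^sup>2 / 4"
definition energy where "energy \<theta> = (V \<theta>)\<^sup>2 + lam * (U \<theta>)\<^sup>2"

text \<open>\<open>M\<close> measures the potential, and \<open>D\<close> is the factor by which the square root of the energy can vary
  on the bulk, the set of angles at distance at least \<open>1 / L\<close> from \<open>0\<close> and \<open>\<pi>\<close>. Nearer to the ends
  the potential is in general too singular for such a factor.\<close>

definition M where "M = \<sigma> + \<tau> + \<sigma>\<^sup>2 + \<tau>\<^sup>2"
definition D where "D = exp (4 * M)"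
definition bulk where "bulk = {1 / L .. pi - 1 / L}"

lemma M_nonneg: "M \<ge> 0"
  unfolding M_def using \<sigma>_nonneg \<tau>_nonneg by simp

lemma D_ge_1: "D \<ge> 1" using M_nonneg by (simp add: D_def)

lemma rho_pos:
  assumes "0 < \<theta>" "\<theta> < pi"
  shows "rho \<theta> > 0"
  using sin_cos_half_pos[OF assms] by (simp add: rho_def)

lemma DERIV_rho:
  assumes "0 < \<theta>" "\<theta> < pi"
  shows "(rho has_real_derivative rho \<theta> * (drift \<theta> / 2)) (at \<theta>)"
proof -
  let ?s = "sin (\<theta> / 2)" and ?c = "cos (\<theta> / 2)"
  note pos = sin_cos_half_pos[OF assms]
  have s: "((\<lambda>\<theta>. sin (\<theta> / 2) powr \<sigma>) has_real_derivative ?s powr \<sigma> * (\<sigma> * (?c / ?s) / 2)) (at \<theta>)"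
    using pos by (auto intro!: derivative_eq_intros simp: powr_diff)
  have c: "((\<lambda>\<theta>. cos (\<theta> / 2) powr \<tau>) has_real_derivative ?c powr \<tau> * (- \<tau> * (?s / ?c) / 2)) (at \<theta>)"
    using pos by (auto intro!: derivative_eq_intros simp: powr_diff)
  show ?thesis
    unfolding rho_def[abs_def]
    by (rule DERIV_cong[OF DERIV_mult[OF s c]]) (simp add: drift_def algebra_simps add_divide_distrib diff_divide_distrib)
qed

lemma DERIV_drift:
  assumes "0 < \<theta>" "\<theta> < pi"
  shows "(drift has_real_derivative drift' \<theta>) (at \<theta>)"
proof -
  let ?s = "sin (\<theta> / 2)" and ?c = "cos (\<theta> / 2)"
  note pos = sin_cos_half_pos[OF assms]
  show ?thesis
    unfolding drift_def[abs_def]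
    by (rule DERIV_cong[OF DERIV_diff[OF DERIV_cmult[OF DERIV_cot_half] DERIV_cmult[OF DERIV_tan_half]]])
      (use pos in \<open>simp_all add: drift'_def\<close>)
qed

lemma DERIV_U:
  assumes "0 < \<theta>" "\<theta> < pi"
  shows "(U has_real_derivative V \<theta>) (at \<theta>)"
  unfolding U_def[abs_def]
  by (rule DERIV_cong[OF DERIV_mult[OF DERIV_rho[OF assms] DERIV_poly_cos]]) (simp add: V_def algebra_simps)

text \<open>This is the differential equation in Liouville normal form.\<close>

lemma DERIV_V:
  assumes "0 < \<theta>" "\<theta> < pi"
  shows "(V has_real_derivative (potential \<theta> - lam) * U \<theta>) (at \<theta>)"
proof -
  let ?y = "poly P (cos \<theta>)" and ?p1 = "poly (pderiv P) (cos \<theta>)" and ?p2 = "poly (pderiv (pderiv P)) (cos \<theta>)"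
  let ?s = "sin (\<theta> / 2)" and ?c = "cos (\<theta> / 2)"
  note pos = sin_cos_half_pos[OF assms]
  have inner: "((\<lambda>\<theta>. drift \<theta> / 2 * poly P (cos \<theta>) - sin \<theta> * poly (pderiv P) (cos \<theta>))
     has_real_derivative (drift' \<theta> / 2 * ?y + (- sin \<theta> * ?p1) * (drift \<theta> / 2)
       - (cos \<theta> * ?p1 + (- sin \<theta> * ?p2) * sin \<theta>))) (at \<theta>)"
    by (intro DERIV_diff DERIV_mult DERIV_cdivide DERIV_drift[OF assms] DERIV_poly_cos DERIV_sin)
  have "(sin \<theta>)\<^sup>2 * ?p2 + (\<tau> - \<sigma> - (\<sigma> + \<tau> + 1) * cos \<theta>) * ?p1 + lam * ?y = 0"
    using ode_at[of "cos \<theta>"] by (simp add: sin_squared_eq)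
  then have p2: "sin \<theta> * ?p2 * sin \<theta> = - ((\<tau> - \<sigma> - (\<sigma> + \<tau> + 1) * cos \<theta>) * ?p1 + lam * ?y)"
    unfolding power2_eq_square by (simp only: mult_ac)
  have "drift \<theta> * sin \<theta> = 2 * \<sigma> * ?c\<^sup>2 - 2 * \<tau> * ?s\<^sup>2"
    unfolding drift_def sin_eq_half[of \<theta>] using pos by (simp add: power2_eq_square field_simps)
  also have "\<dots> = \<sigma> * (1 + cos \<theta>) - \<tau> * (1 - cos \<theta>)"
    unfolding cos_eq_half[of \<theta>] using sin_cos_squared_add[of "\<theta>/2"] by algebra
  finally have dr: "drift \<theta> * sin \<theta> = \<sigma> * (1 + cos \<theta>) - \<tau> * (1 - cos \<theta>)" .
  have eq: "drift' \<theta> / 2 * ?y + (- sin \<theta> * ?p1) * (drift \<theta> / 2) - (cos \<theta> * ?p1 + (- sin \<theta> * ?p2) * sin \<theta>)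
     = drift' \<theta> / 2 * ?y + drift \<theta> / 2 * (sin \<theta> * ?p1) - lam * ?y"
    using p2 arg_cong[OF dr, of "\<lambda>z. z * ?p1"] by (simp add: algebra_simps)
  show ?thesis
    unfolding V_def[abs_def]
    by (rule DERIV_cong[OF DERIV_mult[OF DERIV_rho[OF assms] inner]], unfold eq)
      (simp add: potential_def U_def power2_eq_square algebra_simps)
qed

text \<open>The contributions of \<open>lam\<close> cancel, which is why the energy varies slowly.\<close>

lemma DERIV_energy:
  assumes "0 < \<theta>" "\<theta> < pi"
  shows "(energy has_real_derivative 2 * potential \<theta> * U \<theta> * V \<theta>) (at \<theta>)"
  unfolding energy_def[abs_def] power2_eq_square
  by (rule DERIV_cong[OF DERIV_add[OF DERIV_mult[OF DERIV_V[OF assms] DERIV_V[OF assms]]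
        DERIV_cmult[OF DERIV_mult[OF DERIV_U[OF assms] DERIV_U[OF assms]]]]]) (simp add: algebra_simps)

lemma energy_nonneg: "energy \<theta> \<ge> 0"
  unfolding energy_def using lam_pos by simp

lemma potential_bound:
  assumes "0 < \<theta>" "\<theta> < pi"
  shows "\<bar>potential \<theta>\<bar> \<le> M / 2 * (1 / (sin (\<theta> / 2))\<^sup>2 + 1 / (cos (\<theta> / 2))\<^sup>2)"
proof -
  let ?s = "sin (\<theta> / 2)" and ?c = "cos (\<theta> / 2)"
  note pos = sin_cos_half_pos[OF assms]
  define a where "a = 1 / ?s\<^sup>2"
  define b where "b = 1 / ?c\<^sup>2"
  have ab: "a \<ge> 0" "b \<ge> 0" by (simp_all add: a_def b_def)
  have "(drift \<theta>)\<^sup>2 \<le> 2 * (\<sigma> * (?c / ?s))\<^sup>2 + 2 * (\<tau> * (?s / ?c))\<^sup>2"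
  proof -
    have "(x - y)\<^sup>2 \<le> 2 * x\<^sup>2 + 2 * y\<^sup>2" for x y :: real
      using zero_le_power2[of "x + y"] by (simp add: power2_eq_square algebra_simps)
    then show ?thesis unfolding drift_def .
  qed
  also have "\<dots> = 2 * \<sigma>\<^sup>2 * (?c\<^sup>2 * a) + 2 * \<tau>\<^sup>2 * (?s\<^sup>2 * b)"
    by (simp add: a_def b_def power_mult_distrib power_divide)
  also have "\<dots> \<le> 2 * \<sigma>\<^sup>2 * (1 * a) + 2 * \<tau>\<^sup>2 * (1 * b)"
    using ab by (intro add_mono mult_left_mono mult_right_mono) (auto simp: abs_square_le_1)
  finally have d: "(drift \<theta>)\<^sup>2 \<le> 2 * \<sigma>\<^sup>2 * a + 2 * \<tau>\<^sup>2 * b" by simp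
  have d': "drift' \<theta> = - (\<sigma> * a + \<tau> * b) / 2"
    by (simp add: drift'_def a_def b_def field_simps)
  have "\<bar>potential \<theta>\<bar> \<le> (\<sigma> * a + \<tau> * b) / 4 + (drift \<theta>)\<^sup>2 / 4"
  proof -
    have le: "\<bar>- x / 2 / 2 + y / 4\<bar> \<le> x / 4 + y / 4" if "x \<ge> 0" "y \<ge> 0" for x y :: real
      using that by (simp add: abs_le_iff)
    have "0 \<le> \<sigma> * a + \<tau> * b" using \<sigma>_nonneg \<tau>_nonneg ab by simp
    then show ?thesis unfolding potential_def d' by (rule le) simp
  qed
  also have "\<dots> \<le> (\<sigma> * a + \<tau> * b) / 4 + (2 * \<sigma>\<^sup>2 * a + 2 * \<tau>\<^sup>2 * b) / 4"
    using d by simp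
  also have "\<dots> \<le> M / 2 * (a + b)"
  proof -
    have "0 \<le> \<sigma> * a + \<tau> * b + 2 * (\<tau> * a + \<sigma> * b + \<sigma>\<^sup>2 * b + \<tau>\<^sup>2 * a)" using \<sigma>_nonneg \<tau>_nonneg ab by simp
    then show ?thesis by (simp add: M_def field_simps)
  qed
  finally show ?thesis by (simp add: a_def b_def)
qed

text \<open>An antiderivative of the bound for the logarithmic derivative of the energy.\<close>

definition growth where "growth \<theta> = M / L * (sin (\<theta> / 2) / cos (\<theta> / 2) - cos (\<theta> / 2) / sin (\<theta> / 2))"

lemma DERIV_growth:
  assumes "0 < \<theta>" "\<theta> < pi"
  shows "(growth has_real_derivative M / (2 * L) * (1 / (sin (\<theta> / 2))\<^sup>2 + 1 / (cos (\<theta> / 2))\<^sup>2)) (at \<theta>)"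
proof -
  let ?s = "sin (\<theta> / 2)" and ?c = "cos (\<theta> / 2)"
  note pos = sin_cos_half_pos[OF assms]
  show ?thesis
    unfolding growth_def[abs_def]
    by (rule DERIV_cong[OF DERIV_cmult[OF DERIV_diff[OF DERIV_tan_half DERIV_cot_half]]])
      (use pos in \<open>simp_all add: field_simps\<close>)
qed

lemma energy_growth_bound:
  assumes "0 < \<theta>" "\<theta> < pi"
  shows "\<bar>2 * potential \<theta> * U \<theta> * V \<theta>\<bar> \<le> M / (2 * L) * (1 / (sin (\<theta> / 2))\<^sup>2 + 1 / (cos (\<theta> / 2))\<^sup>2) * energy \<theta>"
proof -
  have "2 * \<bar>U \<theta>\<bar> * \<bar>V \<theta>\<bar> * L \<le> energy \<theta>"
  proof -
    have "0 \<le> (\<bar>V \<theta>\<bar> - L * \<bar>U \<theta>\<bar>)\<^sup>2" by simp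
    then show ?thesis unfolding energy_def L_sq[symmetric] by (simp add: power2_eq_square algebra_simps)
  qed
  then have uv: "2 * \<bar>U \<theta>\<bar> * \<bar>V \<theta>\<bar> \<le> energy \<theta> / L" using L_pos by (simp add: field_simps)
  have "\<bar>2 * potential \<theta> * U \<theta> * V \<theta>\<bar> = \<bar>potential \<theta>\<bar> * (2 * \<bar>U \<theta>\<bar> * \<bar>V \<theta>\<bar>)"
    by (simp add: abs_mult)
  also have "\<dots> \<le> (M / 2 * (1 / (sin (\<theta> / 2))\<^sup>2 + 1 / (cos (\<theta> / 2))\<^sup>2)) * (energy \<theta> / L)"
    using potential_bound[OF assms] uv M_nonneg by (intro mult_mono) auto
  finally show ?thesis by (simp add: field_simps)
qed

lemma bulk_bounds:
  assumes "\<theta> \<in> bulk"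
  shows "0 < \<theta>" "\<theta> < pi"
proof -
  have "1 / L > 0" using L_pos by simp
  then show "0 < \<theta>" "\<theta> < pi" using assms unfolding bulk_def atLeastAtMost_iff by linarith+
qed

lemma growth_bound:
  assumes "\<theta> \<in> bulk"
  shows "\<bar>growth \<theta>\<bar> \<le> 4 * M"
proof -
  let ?s = "sin (\<theta> / 2)" and ?c = "cos (\<theta> / 2)"
  note b = bulk_bounds[OF assms]
  note pos = sin_cos_half_pos[OF b]
  have th: "1 / L \<le> \<theta>" "1 / L \<le> pi - \<theta>" using assms by (auto simp: bulk_def)
  have s: "?s \<ge> 1 / (4 * L)" using half_le_sin[of "\<theta> / 2"] b th by simp
  have c: "?c \<ge> 1 / (4 * L)"
  proof -
    have "?c = sin ((pi - \<theta>) / 2)" by (simp add: diff_divide_distrib sin_diff)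
    then show ?thesis using half_le_sin[of "(pi - \<theta>) / 2"] b th by simp
  qed
  have "?c / ?s \<le> 1 / (1 / (4 * L))" using s pos L_pos by (intro frac_le) auto
  moreover have "?s / ?c \<le> 1 / (1 / (4 * L))" using c pos L_pos by (intro frac_le) auto
  moreover have "?c / ?s \<ge> 0" "?s / ?c \<ge> 0" using pos by auto
  ultimately have "\<bar>?s / ?c - ?c / ?s\<bar> \<le> 4 * L" by (simp add: abs_le_iff)
  then have "\<bar>growth \<theta>\<bar> \<le> M / L * (4 * L)"
    unfolding growth_def abs_mult using M_nonneg L_pos by (intro mult_mono) auto
  then show ?thesis using L_pos by simp
qed

text \<open>On the bulk the growth exponent stays below \<open>4 M\<close>: its singularities at the ends have size about \<open>L\<close>
  there, which its factor \<open>1 / L\<close> compensates.\<close>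

lemma energy_comparable:
  assumes "\<theta> \<in> bulk" "\<phi> \<in> bulk"
  shows "energy \<theta> \<le> D\<^sup>2 * energy \<phi>"
proof -
  let ?g = "\<lambda>x. M / (2 * L) * (1 / (sin (x / 2))\<^sup>2 + 1 / (cos (x / 2))\<^sup>2)"
  have inb: "0 < x \<and> x < pi" if "\<theta> \<le> x \<and> x \<le> \<phi> \<or> \<phi> \<le> x \<and> x \<le> \<theta>" for x
    using bulk_bounds[OF assms(1)] bulk_bounds[OF assms(2)] that by auto
  have "energy \<theta> \<le> energy \<phi> * exp \<bar>growth \<phi> - growth \<theta>\<bar>"
  proof (cases "\<theta> \<le> \<phi>")
    case True
    have "energy \<theta> \<le> energy \<phi> * exp (growth \<phi> - growth \<theta>)"
      using True DERIV_energy DERIV_growth energy_growth_bound inb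
      by (intro gronwall_two_sided(1)[where g' = ?g and e' = "\<lambda>x. 2 * potential x * U x * V x"]) blast+
    also have "\<dots> \<le> energy \<phi> * exp \<bar>growth \<phi> - growth \<theta>\<bar>"
      by (intro mult_left_mono energy_nonneg) auto
    finally show ?thesis .
  next
    case False
    then have le: "\<phi> \<le> \<theta>" by simp
    have "energy \<theta> \<le> energy \<phi> * exp (growth \<theta> - growth \<phi>)"
      using le DERIV_energy DERIV_growth energy_growth_bound inb
      by (intro gronwall_two_sided(2)[where g' = ?g and e' = "\<lambda>x. 2 * potential x * U x * V x"]) blast+
    also have "\<dots> \<le> energy \<phi> * exp \<bar>growth \<phi> - growth \<theta>\<bar>"
      by (intro mult_left_mono energy_nonneg) auto
    finally show ?thesis .
  qed
  also have "\<dots> \<le> energy \<phi> * exp (4 * M + 4 * M)"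
  proof (intro mult_left_mono energy_nonneg)
    show "exp \<bar>growth \<phi> - growth \<theta>\<bar> \<le> exp (4 * M + 4 * M)"
      using growth_bound[OF assms(1)] growth_bound[OF assms(2)] by (simp add: abs_le_iff)
  qed
  also have "exp (4 * M + 4 * M) = D\<^sup>2" by (simp add: D_def exp_add[symmetric] power2_eq_square)
  finally show ?thesis by (simp add: mult.commute)
qed

end

section \<open>Bounds for the Lagrange basis\<close>

lemma one_minus_cos_le: "1 - cos \<theta> \<le> \<theta>\<^sup>2 / (2::real)"
proof -
  have "1 - cos \<theta> = 2 * (sin (\<theta> / 2))\<^sup>2"
    using cos_double_sin[of "\<theta> / 2"] by simp
  also have "(sin (\<theta> / 2))\<^sup>2 \<le> (\<theta> / 2)\<^sup>2"
    using abs_sin_x_le_abs_x[of "\<theta> / 2"] by (subst abs_le_square_iff[symmetric])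
  finally show ?thesis by (simp add: power2_eq_square)
qed

text \<open>The exponents \<open>i\<close> and \<open>k\<close> are \<open>0\<close> or \<open>1\<close> and select the parity component: interpolating a function
  that carries a factor \<open>d\<close> or \<open>s\<close> leads to the ratio of \<open>sqrt (1 - t)\<close> or of \<open>sqrt (1 + t)\<close> between the
  point of evaluation \<open>t\<close> and the node \<open>x\<close>.\<close>

definition weight_ratio :: "nat \<Rightarrow> nat \<Rightarrow> real \<Rightarrow> real \<Rightarrow> real" where
  "weight_ratio i k t x = sqrt ((1 - t) / (1 - x)) ^ i * sqrt ((1 + t) / (1 + x)) ^ k"

definition weighted_lebesgue :: "real set \<Rightarrow> nat \<Rightarrow> nat \<Rightarrow> real \<Rightarrow> real" where
  "weighted_lebesgue X i k t = (\<Sum>x\<in>X. \<bar>poly (lagrange_poly X x) t\<bar> * weight_ratio i k t x)"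

lemma weighted_lebesgue_nonneg:
  assumes "\<And>x. x \<in> X \<Longrightarrow> -1 < x \<and> x < 1" "-1 \<le> t" "t \<le> 1"
  shows "weighted_lebesgue X i k t \<ge> 0"
  unfolding weighted_lebesgue_def
proof (intro sum_nonneg mult_nonneg_nonneg)
  fix x assume "x \<in> X"
  then have "1 - x > 0" "1 + x > 0" "1 - t \<ge> 0" "1 + t \<ge> 0" using assms(1)[of x] assms(2,3) by linarith+
  then show "weight_ratio i k t x \<ge> 0" by (simp add: weight_ratio_def)
qed auto

lemma weighted_lebesgue_reflect: "weighted_lebesgue (uminus ` X) k i (- t) = weighted_lebesgue X i k t"
  unfolding weighted_lebesgue_def
  by (subst sum.reindex) (auto simp: inj_on_def lagrange_poly_reflect weight_ratio_def mult.commute)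

text \<open>Here \<open>s, c\<close> and \<open>s', c'\<close> are the sine and cosine of half the angle of the point and of the node. The
  first factor is what remains of \<open>sin \<omega> / (cos \<theta> - cos \<omega>)\<close> when \<open>sin ((\<theta> - \<omega>) / 2)\<close> is split off. It is
  small enough to absorb each of the four weights.\<close>

lemma half_angle_kernel_le:
  fixes s c s' c' :: real
  assumes pos: "s > 0" "c > 0" "s' > 0" "c' > 0" and one: "s \<le> 1" "c \<le> 1" "c' \<le> 1"
    and half: "c \<ge> 1 / 2" and sum: "s' + c' \<ge> 1" and ik: "i \<le> 1" "k \<le> (1::nat)"
  shows "s' * c' / (s * c' + c * s') * (s / s') ^ i * (c / c') ^ k \<le> 2"
proof -
  let ?d = "s * c' + c * s'"
  have d: "?d > 0" using pos by (simp add: add_pos_pos)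
  have "i = 0 \<or> i = 1" "k = 0 \<or> k = 1" using ik by auto
  then consider "i = 0" "k = 0" | "i = 1" "k = 0" | "i = 0" "k = 1" | "i = 1" "k = 1" by blast
  then show ?thesis
  proof cases
    case 1
    have "s' * c' \<le> s' * (2 * c)" using pos one half by (intro mult_left_mono) auto
    also have "\<dots> = 2 * (c * s')" by simp
    also have "\<dots> \<le> 2 * ?d" using pos by simp
    finally show ?thesis using 1 d by (simp add: field_simps)
  next
    case 2
    then have "s' * c' / ?d * (s / s') ^ i * (c / c') ^ k = s * c' / ?d" using pos by simp
    also have "\<dots> \<le> 1" using d pos by (simp add: field_simps)
    finally show ?thesis by simp
  next
    case 3
    then have "s' * c' / ?d * (s / s') ^ i * (c / c') ^ k = c * s' / ?d" using pos by simp
    also have "\<dots> \<le> 1" using d pos by (simp add: field_simps)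
    finally show ?thesis by simp
  next
    case 4
    then have e: "s' * c' / ?d * (s / s') ^ i * (c / c') ^ k = s * c / ?d" using pos by simp
    have "s * c * 1 \<le> s * c * (s' + c')" using sum pos by (intro mult_left_mono) auto
    also have "\<dots> = s * c' * c + c * s' * s" by (simp add: algebra_simps)
    also have "\<dots> \<le> s * c' * 1 + c * s' * 1" using pos one by (intro add_mono mult_left_mono) auto
    finally have "s * c / ?d \<le> 1" using d by simp
    then show ?thesis unfolding e by simp
  qed
qed

context jacobi_zeros
begin

text \<open>Both \<open>1 - x\<close> and \<open>1 + x\<close> are at least \<open>1 / L\<^sup>2\<close>, while \<open>1 - cos v \<le> v\<^sup>2 / 2\<close>.\<close>

lemma arccos_zero_bulk:
  assumes "x \<in> X"
  shows "arccos x \<in> bulk"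
proof -
  have x: "-1 < x" "x < 1" using zero_bounds[OF assms] by auto
  let ?w = "arccos x"
  have w: "cos ?w = x" "0 \<le> ?w" "?w \<le> pi" using x by (auto simp: cos_arccos arccos_lbound arccos_ubound)
  have key: "1 / L \<le> v" if "v \<ge> 0" "1 - cos v \<ge> 1 / lam" for v
  proof (rule ccontr)
    assume "\<not> 1 / L \<le> v"
    then have "v\<^sup>2 \<le> (1 / L)\<^sup>2" using that by (intro power_mono) auto
    also have "\<dots> = 1 / lam" by (simp add: power_divide L_sq)
    finally have v: "v\<^sup>2 \<le> 1 / lam" .
    define q where "q = 1 / lam"
    have "q > 0" using lam_pos by (simp add: q_def)
    then show False using that v one_minus_cos_le[of v] unfolding q_def[symmetric] by linarith
  qed
  have "1 / L \<le> ?w" using key[of ?w] w one_minus_zero_ge[OF assms] by simp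
  moreover have "1 / L \<le> pi - ?w" using key[of "pi - ?w"] w one_plus_zero_ge[OF assms] by simp
  ultimately show ?thesis by (simp add: bulk_def)
qed

lemma cos_arccos_zero: "x \<in> X \<Longrightarrow> cos (arccos x) = x"
  using zero_bounds[of x] by (simp add: cos_arccos)

lemma U_zero:
  assumes "x \<in> X"
  shows "U (arccos x) = 0"
  by (simp add: U_def cos_arccos_zero assms zero_of_P)

lemma V_zero:
  assumes "x \<in> X"
  shows "V (arccos x) = - (rho (arccos x) * sin (arccos x) * poly (pderiv P) x)"
  by (simp add: V_def cos_arccos_zero assms zero_of_P)

lemma V_zero_pos: "x \<in> X \<Longrightarrow> \<bar>V (arccos x)\<bar> > 0"
  using bulk_bounds[OF arccos_zero_bulk, of x] rho_pos[of "arccos x"] sin_gt_zero[of "arccos x"]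
  by (simp add: V_zero pderiv_P_nonzero)

lemma energy_zero: "x \<in> X \<Longrightarrow> energy (arccos x) = (V (arccos x))\<^sup>2"
  by (simp add: energy_def U_zero)

text \<open>At a zero the energy is just \<open>V\<^sup>2\<close>, so \<open>V\<close> at any zero controls \<open>U\<close> and \<open>V\<close> on the whole bulk.\<close>

lemma amplitude_bound:
  assumes "\<theta> \<in> bulk" "x \<in> X"
  shows "L * \<bar>U \<theta>\<bar> \<le> D * \<bar>V (arccos x)\<bar>" "\<bar>V \<theta>\<bar> \<le> D * \<bar>V (arccos x)\<bar>"
proof -
  have e: "energy \<theta> \<le> (D * \<bar>V (arccos x)\<bar>)\<^sup>2"
    using energy_comparable[OF assms(1) arccos_zero_bulk[OF assms(2)]]
    by (simp add: energy_zero[OF assms(2)] power_mult_distrib)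
  have D: "D * \<bar>V (arccos x)\<bar> \<ge> 0" using D_ge_1 by simp
  have "(L * \<bar>U \<theta>\<bar>)\<^sup>2 \<le> energy \<theta>" by (simp add: energy_def power_mult_distrib L_sq)
  then show "L * \<bar>U \<theta>\<bar> \<le> D * \<bar>V (arccos x)\<bar>" using e D by (meson order.trans power2_le_imp_le)
  have "\<bar>V \<theta>\<bar>\<^sup>2 \<le> energy \<theta>" using lam_pos by (simp add: energy_def)
  then show "\<bar>V \<theta>\<bar> \<le> D * \<bar>V (arccos x)\<bar>" using e D by (meson order.trans power2_le_imp_le)
qed

lemma abs_U_le_dist:
  assumes "\<theta> \<in> bulk" "x \<in> X"
  shows "\<bar>U \<theta>\<bar> \<le> \<bar>\<theta> - arccos x\<bar> * (D * \<bar>V (arccos x)\<bar>)"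
proof -
  let ?w = "arccos x"
  note w = arccos_zero_bulk[OF assms(2)]
  have "norm (U \<theta> - U ?w) \<le> D * \<bar>V ?w\<bar> * norm (\<theta> - ?w)"
  proof (rule field_differentiable_bound[where S = bulk and f' = V])
    show "convex bulk" by (simp add: bulk_def)
    fix z assume z: "z \<in> bulk"
    show "(U has_field_derivative V z) (at z within bulk)"
      using DERIV_U[OF bulk_bounds[OF z]] by (rule has_field_derivative_at_within)
    show "norm (V z) \<le> D * \<bar>V ?w\<bar>" using amplitude_bound(2)[OF z assms(2)] by simp
  qed (use assms w in auto)
  then show ?thesis by (simp add: U_zero assms mult_ac)
qed

text \<open>Combines the bound for the size of \<open>U\<close>, good far from the zero, with the mean value bound, good
  near it.\<close>

lemma abs_U_le:
  assumes "\<theta> \<in> bulk" "x \<in> X"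
  shows "\<bar>U \<theta>\<bar> * (1 + L * \<bar>\<theta> - arccos x\<bar>) \<le> 2 * D * \<bar>V (arccos x)\<bar> * \<bar>\<theta> - arccos x\<bar>"
proof -
  let ?d = "\<bar>\<theta> - arccos x\<bar>"
  have "\<bar>U \<theta>\<bar> * L * ?d \<le> D * \<bar>V (arccos x)\<bar> * ?d"
    using amplitude_bound(1)[OF assms] by (intro mult_right_mono) (auto simp: mult.commute)
  then show ?thesis using abs_U_le_dist[OF assms] by (simp add: algebra_simps)
qed

text \<open>Between two zeros \<open>V\<close> vanishes somewhere. There \<open>U\<close> must carry the whole energy, which it cannot
  reach within a distance of smaller order than \<open>1 / L\<close> from a zero.\<close>

lemma zero_separation_ordered:
  assumes "x \<in> X" "y \<in> X" "arccos x < arccos y"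
  shows "arccos y - arccos x \<ge> 1 / (L * D\<^sup>2)"
proof -
  let ?a = "arccos x" and ?b = "arccos y"
  have inb: "z \<in> bulk" if "?a \<le> z" "z \<le> ?b" for z
    using arccos_zero_bulk[OF assms(1)] arccos_zero_bulk[OF assms(2)] that by (auto simp: bulk_def)
  have der: "(U has_real_derivative V z) (at z)" if "?a \<le> z" "z \<le> ?b" for z
    using DERIV_U bulk_bounds[OF inb[OF that]] by blast
  have "\<exists>z>?a. z < ?b \<and> U ?b - U ?a = (?b - ?a) * V z"
    using assms(3) der by (intro MVT2) auto
  then obtain z where z: "?a < z" "z < ?b" "V z = 0"
    using assms by (auto simp: U_zero)
  have zb: "z \<in> bulk" using inb z by auto
  have "(V ?a)\<^sup>2 \<le> D\<^sup>2 * energy z"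
    using energy_comparable[OF arccos_zero_bulk[OF assms(1)] zb] by (simp add: energy_zero[OF assms(1)])
  also have "\<dots> = (D * (L * \<bar>U z\<bar>))\<^sup>2" using z by (simp add: energy_def power_mult_distrib L_sq)
  finally have "\<bar>V ?a\<bar> \<le> D * (L * \<bar>U z\<bar>)" using D_ge_1 L_pos by (simp add: abs_le_square_iff[symmetric])
  also have "\<dots> \<le> D * (L * (\<bar>z - ?a\<bar> * (D * \<bar>V ?a\<bar>)))"
    using abs_U_le_dist[OF zb assms(1)] D_ge_1 L_pos by (intro mult_left_mono) auto
  finally have "\<bar>V ?a\<bar> * 1 \<le> \<bar>V ?a\<bar> * (L * D\<^sup>2 * (z - ?a))"
    using z by (simp add: power2_eq_square mult_ac)
  then have "1 \<le> L * D\<^sup>2 * (z - ?a)" using V_zero_pos[OF assms(1)] by (simp only: mult_le_cancel_left_pos)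
  moreover have "L * D\<^sup>2 > 0" using L_pos D_ge_1 by simp
  ultimately have "1 / (L * D\<^sup>2) \<le> z - ?a" by (simp add: pos_divide_le_eq mult.commute)
  then show ?thesis using z by linarith
qed

lemma zero_separation:
  assumes "x \<in> X" "y \<in> X" "x \<noteq> y"
  shows "\<bar>arccos x - arccos y\<bar> \<ge> 1 / (L * D\<^sup>2)"
proof -
  have "arccos x \<noteq> arccos y" using assms cos_arccos_zero by metis
  then show ?thesis
    using zero_separation_ordered[of x y] zero_separation_ordered[of y x] assms by linarith
qed

definition term_const where "term_const = 16 * D * 2 powr \<sigma> * 2 powr \<tau>"

lemma term_const_ge_1: "term_const \<ge> 1"
proof -
  have "(2::real) powr \<sigma> \<ge> 1" "(2::real) powr \<tau> \<ge> 1" using \<sigma>_nonneg \<tau>_nonneg by (auto intro: ge_one_powr_ge_zero)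
  then have "1 * 1 * 1 * 1 \<le> term_const" unfolding term_const_def using D_ge_1 by (intro mult_mono) auto
  then show ?thesis by simp
qed

text \<open>Up to constants, the basis polynomial is \<open>U \<theta> / V \<omega>\<close> times \<open>rho \<omega> / rho \<theta>\<close> times
  \<open>sin \<omega> / (cos \<theta> - cos \<omega>)\<close>, where \<open>\<omega> = arccos x\<close>. The first quotient with \<open>sin ((\<theta> - \<omega>) / 2)\<close> gives
  \<open>1 / (1 + L \<bar>\<theta> - \<omega>\<bar>)\<close>, the second is at most a multiple of \<open>1 + L \<bar>\<theta> - \<omega>\<bar>\<close> to the power \<open>\<sigma>\<close>,
  and the rest with the weight is bounded. Only the left half of the range of angles is treated, where \<open>cos (\<theta> / 2)\<close> is
  bounded below; reflection supplies the other half.\<close>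

lemma lebesgue_term_bound:
  assumes th: "\<theta> \<in> bulk" "\<theta> \<le> pi / 2" and x: "x \<in> X" and ik: "i \<le> 1" "k \<le> 1"
  shows "\<bar>poly (lagrange_poly X x) (cos \<theta>)\<bar> * weight_ratio i k (cos \<theta>) x
    \<le> term_const * (1 + L * \<bar>\<theta> - arccos x\<bar>) powr (\<sigma> - 1)"
proof (cases "\<theta> = arccos x")
  case True
  then have c: "cos \<theta> = x" using cos_arccos_zero[OF x] by simp
  have "weight_ratio i k x x = 1" using zero_bounds[OF x] by (simp add: weight_ratio_def)
  then have "\<bar>poly (lagrange_poly X x) (cos \<theta>)\<bar> * weight_ratio i k (cos \<theta>) x = 1"
    unfolding c using x by (simp add: lagrange_poly_node)
  moreover have "L * \<bar>\<theta> - arccos x\<bar> = 0" using True by simp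
  ultimately show ?thesis using term_const_ge_1 by (simp only: add_0_right powr_one_eq_one mult_1_right)
next
  case False
  define w where "w = arccos x"
  define d where "d = \<bar>\<theta> - w\<bar>"
  have wb: "w \<in> bulk" unfolding w_def by (rule arccos_zero_bulk[OF x])
  note b = bulk_bounds[OF th(1)] and b' = bulk_bounds[OF wb]
  have cw: "cos w = x" unfolding w_def by (rule cos_arccos_zero[OF x])
  have d: "0 < d" "d \<le> pi" using False b b' by (auto simp: d_def w_def)
  define s c s' c' where "s = sin (\<theta> / 2)" and "c = cos (\<theta> / 2)" and "s' = sin (w / 2)" and "c' = cos (w / 2)"
  have pos: "s > 0" "c > 0" "s' > 0" "c' > 0"
    using sin_cos_half_pos[OF b] sin_cos_half_pos[OF b'] by (auto simp: s_def c_def s'_def c'_def)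
  have sq: "s\<^sup>2 + c\<^sup>2 = 1" "s'\<^sup>2 + c'\<^sup>2 = 1" by (auto simp: s_def c_def s'_def c'_def)
  have one: "s \<le> 1" "c \<le> 1" "c' \<le> 1" "s' \<le> 1" by (auto simp: s_def c_def s'_def c'_def)
  \<comment> \<open>This is where the restriction to the left half of the angles enters.\<close>
  have c2: "c \<ge> 1 / 2"
  proof -
    have "cos (pi / 3) \<le> c" unfolding c_def using b th by (intro cos_monotone_0_pi_le) auto
    then show ?thesis by (simp add: cos_60)
  qed
  have sum: "s' + c' \<ge> 1"
  proof -
    have "s'\<^sup>2 \<le> s'" "c'\<^sup>2 \<le> c'" using pos one by (auto simp: power2_eq_square mult_left_le)
    then show ?thesis using sq(2) by linarith
  qed
  define T where "T = 1 + L * d"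
  have T: "T > 0" "T \<ge> 1" using L_pos d by (auto simp: T_def intro: add_pos_pos)
  have wr: "weight_ratio i k (cos \<theta>) x = (s / s') ^ i * (c / c') ^ k"
  proof -
    have "1 - cos \<theta> = 2 * s\<^sup>2" "1 + cos \<theta> = 2 * c\<^sup>2" "1 - x = 2 * s'\<^sup>2" "1 + x = 2 * c'\<^sup>2"
      using sq cos_eq_half[of \<theta>] cos_eq_half[of w] cw unfolding s_def c_def s'_def c'_def by linarith+
    then show ?thesis using pos by (simp add: weight_ratio_def real_sqrt_divide)
  qed
  have diff: "\<bar>cos \<theta> - x\<bar> = 2 * (s * c' + c * s') * sin (d / 2)"
  proof -
    have "cos \<theta> - x = 2 * sin ((\<theta> + w) / 2) * sin ((w - \<theta>) / 2)"
      unfolding cw[symmetric] by (rule cos_diff_cos)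
    moreover have "sin ((\<theta> + w) / 2) = s * c' + c * s'"
      by (simp add: add_divide_distrib sin_add s_def c_def s'_def c'_def)
    moreover have "\<bar>sin ((w - \<theta>) / 2)\<bar> = sin (d / 2)"
    proof (cases "w \<ge> \<theta>")
      case True
      then have e: "(w - \<theta>) / 2 = d / 2" by (simp add: d_def)
      have "sin (d / 2) \<ge> 0" using d by (intro sin_ge_zero) auto
      then show ?thesis unfolding e by simp
    next
      case False
      then have e: "(w - \<theta>) / 2 = - (d / 2)" by (simp add: d_def field_simps)
      have "sin (d / 2) \<ge> 0" using d by (intro sin_ge_zero) auto
      then show ?thesis unfolding e by simp
    qed
    ultimately show ?thesis using pos by (simp add: abs_mult add_pos_pos)
  qed
  have sd: "sin (d / 2) \<ge> d / 4" using half_le_sin[of "d / 2"] d by simp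
  have K: "s * c' + c * s' > 0" using pos by (simp add: add_pos_pos)
  have rt: "rho \<theta> = s powr \<sigma> * c powr \<tau>" and rw: "rho w = s' powr \<sigma> * c' powr \<tau>"
    by (auto simp: rho_def s_def c_def s'_def c'_def)
  have rpos: "rho \<theta> > 0" "rho w > 0" using rho_pos b b' by auto
  have V: "\<bar>V w\<bar> = rho w * (2 * s' * c') * \<bar>poly (pderiv P) x\<bar>"
    using V_zero[OF x] rpos pos sin_eq_half[of w] unfolding w_def[symmetric] s'_def c'_def by (simp add: abs_mult)
  have "\<bar>poly P (cos \<theta>)\<bar> * rho \<theta> * T \<le> 2 * D * \<bar>V w\<bar> * d"
    using abs_U_le[OF th(1) x] rpos unfolding w_def[symmetric] d_def[symmetric] T_def[symmetric]
    by (simp add: U_def abs_mult mult_ac)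
  then have P: "\<bar>poly P (cos \<theta>)\<bar> \<le> 2 * D * \<bar>V w\<bar> * d / (rho \<theta> * T)"
    using rpos T by (simp add: field_simps)
  have P'pos: "\<bar>poly (pderiv P) x\<bar> > 0" using pderiv_P_nonzero[OF x] by simp
  have "\<bar>poly (lagrange_poly X x) (cos \<theta>)\<bar> = \<bar>poly P (cos \<theta>)\<bar> / (\<bar>cos \<theta> - x\<bar> * \<bar>poly (pderiv P) x\<bar>)"
  proof -
    have "cos \<theta> \<noteq> x" using diff K sd d by (metis abs_zero diff_self mult_eq_0_iff not_less order_less_irrefl zero_less_divide_iff zero_less_numeral zero_neq_numeral)
    then show ?thesis by (simp add: lagrange_eq[OF x] abs_mult)
  qed
  also have "\<dots> \<le> (2 * D * \<bar>V w\<bar> * d / (rho \<theta> * T)) / ((2 * (s * c' + c * s') * (d / 4)) * \<bar>poly (pderiv P) x\<bar>)"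
    unfolding diff using P P'pos K sd d by (intro frac_le mult_right_mono mult_left_mono mult_pos_pos) auto
  also have "\<dots> = 8 * D * (rho w / rho \<theta>) / T * (s' * c' / (s * c' + c * s'))"
  proof -
    have "2 * D * (rw * (2 * s' * c') * p) * d / (r * T) / (2 * K * (d / 4) * p) = 8 * D * (rw / r) / T * (s' * c' / K)"
      if "p \<noteq> 0" "r \<noteq> 0" "K \<noteq> 0" for p r rw K
      using that d T by (simp add: field_simps)
    then show ?thesis unfolding V using P'pos rpos K by (metis less_irrefl)
  qed
  finally have l: "\<bar>poly (lagrange_poly X x) (cos \<theta>)\<bar> \<le> 8 * D * (rho w / rho \<theta>) / T * (s' * c' / (s * c' + c * s'))" .
  \<comment> \<open>The quotient of the sines is at most \<open>2 T\<close> since \<open>w \<le> \<theta> + d\<close> and \<open>L \<theta> \<ge> 1\<close>.\<close>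
  have rr: "rho w / rho \<theta> \<le> (2 * T) powr \<sigma> * 2 powr \<tau>"
  proof -
    have "rho w / rho \<theta> = (s' / s) powr \<sigma> * (c' / c) powr \<tau>"
      unfolding rt rw using pos by (simp add: powr_divide)
    also have "\<dots> \<le> (2 * T) powr \<sigma> * 2 powr \<tau>"
    proof (intro mult_mono powr_mono2 \<sigma>_nonneg \<tau>_nonneg)
      have "s' \<le> w / 2" unfolding s'_def using b' by (intro sin_x_le_x) auto
      moreover have "s \<ge> \<theta> / 4" unfolding s_def using half_le_sin[of "\<theta> / 2"] b by simp
      ultimately have "s' / s \<le> (w / 2) / (\<theta> / 4)" using b b' pos by (intro frac_le) auto
      also have "\<dots> = 2 * (w / \<theta>)" by simp
      also have "w / \<theta> \<le> T"
      proof -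
        have "1 \<le> L * \<theta>" using th(1) L_pos by (simp add: bulk_def field_simps)
        then have "d * 1 \<le> d * (L * \<theta>)" using d by (intro mult_left_mono) auto
        moreover have "w \<le> \<theta> + d" by (simp add: d_def)
        ultimately have "w \<le> T * \<theta>" by (simp add: T_def algebra_simps)
        then show ?thesis using b by (simp add: field_simps)
      qed
      finally show "s' / s \<le> 2 * T" by simp
      show "c' / c \<le> 2" using one c2 pos by (simp add: field_simps)
    qed (use pos in auto)
    finally show ?thesis .
  qed
  have ker: "s' * c' / (s * c' + c * s') * (s / s') ^ i * (c / c') ^ k \<le> 2"
    using pos one c2 sum ik by (intro half_angle_kernel_le) auto
  have "\<bar>poly (lagrange_poly X x) (cos \<theta>)\<bar> * weight_ratio i k (cos \<theta>) x
      \<le> (8 * D * (rho w / rho \<theta>) / T * (s' * c' / (s * c' + c * s'))) * ((s / s') ^ i * (c / c') ^ k)"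
    unfolding wr using l pos by (intro mult_right_mono) auto
  also have "\<dots> = (8 * D * (rho w / rho \<theta>) / T) * (s' * c' / (s * c' + c * s') * (s / s') ^ i * (c / c') ^ k)"
    by (simp only: mult_ac)
  also have "\<dots> \<le> (8 * D * ((2 * T) powr \<sigma> * 2 powr \<tau>) / T) * 2"
  proof (rule mult_mono[OF _ ker])
    show "8 * D * (rho w / rho \<theta>) / T \<le> 8 * D * ((2 * T) powr \<sigma> * 2 powr \<tau>) / T"
      using rr D_ge_1 T by (intro divide_right_mono mult_left_mono) auto
    show "0 \<le> 8 * D * ((2 * T) powr \<sigma> * 2 powr \<tau>) / T" using D_ge_1 T by simp
    show "0 \<le> s' * c' / (s * c' + c * s') * (s / s') ^ i * (c / c') ^ k"
      using pos K by (intro mult_nonneg_nonneg) auto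
  qed
  also have "\<dots> = term_const * T powr (\<sigma> - 1)"
    using T by (simp add: term_const_def powr_mult powr_diff)
  finally show ?thesis unfolding T_def d_def w_def .
qed

end

section \<open>Weighted univariate Lebesgue functions\<close>

text \<open>By separation, different points fall into different cells of length \<open>\<eta>\<close>, and \<open>g\<close> is largest at the
  left end of a cell.\<close>

lemma sum_separated_le_one_sided:
  fixes d :: "'a \<Rightarrow> real" and g :: "real \<Rightarrow> real"
  assumes fin: "finite Z" and \<eta>: "\<eta> > 0"
    and sep: "\<And>z z'. z \<in> Z \<Longrightarrow> z' \<in> Z \<Longrightarrow> z \<noteq> z' \<Longrightarrow> \<bar>d z - d z'\<bar> \<ge> \<eta>"
    and range: "\<And>z. z \<in> Z \<Longrightarrow> 0 \<le> d z \<and> d z \<le> R"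
    and anti: "\<And>x y. 0 \<le> x \<Longrightarrow> x \<le> y \<Longrightarrow> g y \<le> g x" and nonneg: "\<And>x. 0 \<le> x \<Longrightarrow> 0 \<le> g x"
  shows "(\<Sum>z\<in>Z. g (d z)) \<le> (\<Sum>k\<le>nat \<lfloor>R / \<eta>\<rfloor>. g (real k * \<eta>))"
proof -
  define k where "k z = nat \<lfloor>d z / \<eta>\<rfloor>" for z
  have k: "real (k z) \<le> d z / \<eta>" "d z / \<eta> < real (k z) + 1" if "z \<in> Z" for z
  proof -
    have "0 \<le> d z / \<eta>" using range[OF that] \<eta> by simp
    then have "real (k z) = of_int \<lfloor>d z / \<eta>\<rfloor>" by (simp add: k_def)
    then show "real (k z) \<le> d z / \<eta>" "d z / \<eta> < real (k z) + 1" by linarith+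
  qed
  have inj: "inj_on k Z"
  proof (rule inj_onI, rule ccontr)
    fix z z' assume z: "z \<in> Z" "z' \<in> Z" "k z = k z'" "z \<noteq> z'"
    have "\<bar>d z / \<eta> - d z' / \<eta>\<bar> < 1" using k[OF z(1)] k[OF z(2)] z(3) by linarith
    moreover have "\<bar>d z / \<eta> - d z' / \<eta>\<bar> = \<bar>d z - d z'\<bar> / \<eta>" using \<eta> by (simp add: diff_divide_distrib[symmetric])
    ultimately have "\<bar>d z - d z'\<bar> < \<eta>" using \<eta> by (simp add: field_simps)
    then show False using sep[OF z(1,2,4)] by simp
  qed
  have "(\<Sum>z\<in>Z. g (d z)) \<le> (\<Sum>z\<in>Z. g (real (k z) * \<eta>))"
  proof (intro sum_mono anti)
    fix z assume "z \<in> Z"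
    then show "real (k z) * \<eta> \<le> d z" using k[of z] \<eta> by (simp add: field_simps)
  qed (use \<eta> in auto)
  also have "\<dots> = (\<Sum>m\<in>k ` Z. g (real m * \<eta>))" using inj by (simp add: sum.reindex)
  also have "\<dots> \<le> (\<Sum>m\<le>nat \<lfloor>R / \<eta>\<rfloor>. g (real m * \<eta>))"
  proof (intro sum_mono2 nonneg)
    show "k ` Z \<subseteq> {..nat \<lfloor>R / \<eta>\<rfloor>}"
      unfolding k_def using range \<eta> by (auto intro!: nat_mono floor_mono divide_right_mono)
  qed (use \<eta> in auto)
  finally show ?thesis .
qed

lemma sum_separated_le:
  fixes f :: "'a \<Rightarrow> real" and g :: "real \<Rightarrow> real"
  assumes fin: "finite Z" and \<eta>: "\<eta> > 0"
    and sep: "\<And>z z'. z \<in> Z \<Longrightarrow> z' \<in> Z \<Longrightarrow> z \<noteq> z' \<Longrightarrow> \<bar>f z - f z'\<bar> \<ge> \<eta>"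
    and range: "\<And>z. z \<in> Z \<Longrightarrow> \<bar>c - f z\<bar> \<le> R"
    and anti: "\<And>x y. 0 \<le> x \<Longrightarrow> x \<le> y \<Longrightarrow> g y \<le> g x" and nonneg: "\<And>x. 0 \<le> x \<Longrightarrow> 0 \<le> g x"
  shows "(\<Sum>z\<in>Z. g \<bar>c - f z\<bar>) \<le> 2 * (\<Sum>k\<le>nat \<lfloor>R / \<eta>\<rfloor>. g (real k * \<eta>))"
proof -
  define A where "A = {z \<in> Z. f z \<ge> c}"
  define B where "B = {z \<in> Z. f z < c}"
  have "(\<Sum>z\<in>A. g \<bar>c - f z\<bar>) \<le> (\<Sum>k\<le>nat \<lfloor>R / \<eta>\<rfloor>. g (real k * \<eta>))"
  proof (rule sum_separated_le_one_sided)
    fix z z' assume "z \<in> A" "z' \<in> A" "z \<noteq> z'"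
    then show "\<bar>\<bar>c - f z\<bar> - \<bar>c - f z'\<bar>\<bar> \<ge> \<eta>" using sep[of z z'] by (auto simp: A_def)
  next
    fix z assume "z \<in> A"
    then show "0 \<le> \<bar>c - f z\<bar> \<and> \<bar>c - f z\<bar> \<le> R" using range[of z] by (simp add: A_def)
  qed (use fin \<eta> anti nonneg in \<open>auto simp: A_def\<close>)
  moreover have "(\<Sum>z\<in>B. g \<bar>c - f z\<bar>) \<le> (\<Sum>k\<le>nat \<lfloor>R / \<eta>\<rfloor>. g (real k * \<eta>))"
  proof (rule sum_separated_le_one_sided)
    fix z z' assume "z \<in> B" "z' \<in> B" "z \<noteq> z'"
    then show "\<bar>\<bar>c - f z\<bar> - \<bar>c - f z'\<bar>\<bar> \<ge> \<eta>" using sep[of z z'] by (auto simp: B_def)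
  next
    fix z assume "z \<in> B"
    then show "0 \<le> \<bar>c - f z\<bar> \<and> \<bar>c - f z\<bar> \<le> R" using range[of z] by (simp add: B_def)
  qed (use fin \<eta> anti nonneg in \<open>auto simp: B_def\<close>)
  moreover have "(\<Sum>z\<in>Z. g \<bar>c - f z\<bar>) = (\<Sum>z\<in>A. g \<bar>c - f z\<bar>) + (\<Sum>z\<in>B. g \<bar>c - f z\<bar>)"
  proof -
    have "Z = A \<union> B" "A \<inter> B = {}" "finite A" "finite B" using fin by (auto simp: A_def B_def)
    then show ?thesis by (simp add: sum.union_disjoint)
  qed
  ultimately show ?thesis by simp
qed

text \<open>By the mean value theorem each term is at most an increment of the right-hand side.\<close>

lemma sum_powr_le:
  assumes "0 < \<kappa>" "\<kappa> \<le> 1"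
  shows "(\<Sum>k\<le>K. (1 + real k) powr (\<kappa> - 1)) \<le> (1 + real K) powr \<kappa> / \<kappa>"
proof (induction K)
  case 0
  then show ?case using assms by (simp add: field_simps)
next
  case (Suc K)
  let ?m = "1 + real K"
  have "\<exists>z>?m. z < ?m + 1 \<and> (?m + 1) powr \<kappa> - ?m powr \<kappa> = (?m + 1 - ?m) * (\<kappa> * z powr (\<kappa> - 1))"
    by (intro MVT2) (auto intro!: derivative_eq_intros)
  then obtain z where z: "?m < z" "z < ?m + 1" "(?m + 1) powr \<kappa> - ?m powr \<kappa> = \<kappa> * z powr (\<kappa> - 1)"
    by auto
  have "(?m + 1) powr (\<kappa> - 1) \<le> z powr (\<kappa> - 1)" using z assms by (intro powr_mono2') auto
  then have "\<kappa> * (?m + 1) powr (\<kappa> - 1) \<le> (?m + 1) powr \<kappa> - ?m powr \<kappa>"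
    unfolding z(3) using assms by (intro mult_left_mono) auto
  then have "(?m + 1) powr (\<kappa> - 1) \<le> (?m + 1) powr \<kappa> / \<kappa> - ?m powr \<kappa> / \<kappa>"
    using assms by (simp add: field_simps)
  then show ?case using Suc.IH by (simp add: add_ac)
qed

lemma sum_inverse_le_ln: "(\<Sum>k\<le>K. 1 / (1 + real k)) \<le> 1 + ln (1 + real K)"
proof (induction K)
  case (Suc K)
  let ?m = "2 + real K"
  have "ln (1 - 1 / ?m) \<le> - (1 / ?m)" using ln_add_one_self_le_self2[of "- (1 / ?m)"] by simp
  moreover have "1 - 1 / ?m = (1 + real K) / ?m" by (simp add: field_simps)
  moreover have "ln ((1 + real K) / ?m) = ln (1 + real K) - ln ?m" by (rule ln_divide_pos) auto
  ultimately have "1 / ?m \<le> ln ?m - ln (1 + real K)" by simp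
  then show ?case using Suc.IH by (simp add: add_ac)
qed simp

definition lebesgue_rate :: "real \<Rightarrow> nat \<Rightarrow> real" where
  "lebesgue_rate \<gamma> n = (if \<gamma> > 0 then real n powr \<gamma> else ln (real n))"

lemma lebesgue_rate_nonneg: "n \<ge> 1 \<Longrightarrow> lebesgue_rate \<gamma> n \<ge> 0"
  by (auto simp: lebesgue_rate_def)

context jacobi_zeros
begin

text \<open>The number of cells of length \<open>1 / (L D\<^sup>2)\<close> that cover the range of angles is at most
  \<open>6 D\<^sup>2 (1 + \<sigma> + \<tau>) n\<close>, which explains the shape of the constant.\<close>

definition sum_const where
  "sum_const \<gamma> = 2 * D\<^sup>2 * (if \<gamma> > 0 then (6 * D\<^sup>2 * (1 + \<sigma> + \<tau>)) powr \<gamma> / min \<gamma> 1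
                  else 3 + 2 * ln (6 * D\<^sup>2 * (1 + \<sigma> + \<tau>)))"

text \<open>The sum over separated points needs a decreasing summand, so only the power \<open>\<kappa> - 1\<close> with
  \<open>\<kappa> = min \<gamma> 1\<close> is summed; the remaining power \<open>\<gamma> - \<kappa>\<close> is estimated by its largest value, of order \<open>n\<close>
  to the power \<open>\<gamma> - \<kappa>\<close>.\<close>

lemma sum_over_zeros_le:
  assumes th: "\<theta> \<in> bulk" and \<gamma>: "\<gamma> \<ge> 0" and n: "n \<ge> 2"
  shows "(\<Sum>x\<in>X. (1 + L * \<bar>\<theta> - arccos x\<bar>) powr (\<gamma> - 1)) \<le> sum_const \<gamma> * lebesgue_rate \<gamma> n"
proof -
  define \<kappa> where "\<kappa> = min \<gamma> 1"
  define q where "q = 1 + \<sigma> + \<tau>"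
  have \<kappa>: "0 \<le> \<kappa>" "\<kappa> \<le> 1" "\<kappa> \<le> \<gamma>" using \<gamma> by (auto simp: \<kappa>_def)
  have q: "q \<ge> 1" using \<sigma>_nonneg \<tau>_nonneg by (simp add: q_def)
  have D2: "D\<^sup>2 \<ge> 1" using D_ge_1 by simp
  \<comment> \<open>The separation of the zeros.\<close>
  define \<eta> where "\<eta> = 1 / (L * D\<^sup>2)"
  have LD: "L * D\<^sup>2 \<ge> 1" using mult_mono[of 1 L 1 "D\<^sup>2"] L_ge_1 D2 by simp
  then have \<eta>: "\<eta> > 0" by (simp add: \<eta>_def)
  define K where "K = nat \<lfloor>pi / \<eta>\<rfloor>"
  have K: "1 + real K \<le> 6 * D\<^sup>2 * q * real n"
  proof -
    have "real K \<le> pi / \<eta>" using \<eta> by (simp add: K_def of_nat_floor)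
    also have "\<dots> = pi * (L * D\<^sup>2)" by (simp add: \<eta>_def)
    also have "\<dots> \<le> 4 * (L * D\<^sup>2)" using LD pi_less_4 by (intro mult_right_mono) auto
    finally have "1 + real K \<le> 6 * (L * D\<^sup>2)" using LD by simp
    also have "\<dots> \<le> 6 * ((q * real n) * D\<^sup>2)"
      using L_le by (intro mult_left_mono mult_right_mono) (auto simp: q_def)
    finally show ?thesis by (simp add: mult_ac)
  qed
  have dist: "\<bar>\<theta> - arccos x\<bar> \<le> pi" if "x \<in> X" for x
    using bulk_bounds[OF th] bulk_bounds[OF arccos_zero_bulk[OF that]] by linarith
  let ?g = "\<lambda>r. (1 + L * r) powr (\<kappa> - 1)"
  have pos: "1 + L * r > 0" if "r \<ge> 0" for r using L_pos that by (simp add: add_pos_nonneg)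
  have "(\<Sum>x\<in>X. ?g \<bar>\<theta> - arccos x\<bar>) \<le> 2 * (\<Sum>k\<le>K. ?g (real k * \<eta>))"
    unfolding K_def
  proof (rule sum_separated_le)
    fix x y assume "x \<in> X" "y \<in> X" "x \<noteq> y"
    then show "\<bar>arccos x - arccos y\<bar> \<ge> \<eta>" unfolding \<eta>_def by (rule zero_separation)
  next
    fix x y :: real assume "0 \<le> x" "x \<le> y"
    then show "?g y \<le> ?g x" using \<kappa> pos L_pos by (intro powr_mono2') auto
  qed (use \<eta> dist in auto)
  also have "(\<Sum>k\<le>K. ?g (real k * \<eta>)) \<le> (\<Sum>k\<le>K. D\<^sup>2 * (1 + real k) powr (\<kappa> - 1))"
  proof (rule sum_mono)
    fix k
    have e: "1 + L * (real k * \<eta>) = 1 + real k / D\<^sup>2" using L_pos by (simp add: \<eta>_def)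
    have "1 / D\<^sup>2 \<le> 1" using D2 by (subst divide_le_eq_1_pos) auto
    then have "(1 + real k) / D\<^sup>2 \<le> 1 + real k / D\<^sup>2" by (simp add: add_divide_distrib)
    then have "?g (real k * \<eta>) \<le> ((1 + real k) / D\<^sup>2) powr (\<kappa> - 1)"
      unfolding e using \<kappa> D2 D_ge_1 by (intro powr_mono2') auto
    also have "\<dots> = (D\<^sup>2) powr (1 - \<kappa>) * (1 + real k) powr (\<kappa> - 1)"
      using powr_minus[of "D\<^sup>2" "1 - \<kappa>"] by (simp add: powr_divide field_simps)
    also have "(D\<^sup>2) powr (1 - \<kappa>) \<le> (D\<^sup>2) powr 1" using D2 \<kappa> by (intro powr_mono) auto
    finally show "?g (real k * \<eta>) \<le> D\<^sup>2 * (1 + real k) powr (\<kappa> - 1)"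
      using D2 by (simp add: mult_right_mono)
  qed
  also have "\<dots> = D\<^sup>2 * (\<Sum>k\<le>K. (1 + real k) powr (\<kappa> - 1))" by (simp add: sum_distrib_left)
  finally have main: "(\<Sum>x\<in>X. ?g \<bar>\<theta> - arccos x\<bar>) \<le> 2 * D\<^sup>2 * (\<Sum>k\<le>K. (1 + real k) powr (\<kappa> - 1))"
    by simp
  show ?thesis
  proof (cases "\<gamma> > 0")
    case True
    then have kpos: "\<kappa> > 0" by (simp add: \<kappa>_def)
    define B where "B = 6 * D\<^sup>2 * q * real n"
    have B: "B \<ge> 1" using K by (simp add: B_def)
    have "(\<Sum>x\<in>X. (1 + L * \<bar>\<theta> - arccos x\<bar>) powr (\<gamma> - 1)) \<le> (\<Sum>x\<in>X. B powr (\<gamma> - \<kappa>) * ?g \<bar>\<theta> - arccos x\<bar>)"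
    proof (rule sum_mono)
      fix x assume x: "x \<in> X"
      let ?r = "1 + L * \<bar>\<theta> - arccos x\<bar>"
      have "L * \<bar>\<theta> - arccos x\<bar> \<le> L * 4" using dist[OF x] pi_less_4 L_pos by (intro mult_left_mono) auto
      then have "?r \<le> 6 * L" using L_ge_1 by linarith
      also have "\<dots> \<le> 6 * (q * real n)" using L_le by (simp add: q_def)
      also have "\<dots> \<le> D\<^sup>2 * (6 * (q * real n))" using mult_right_mono[OF D2, of "6 * (q * real n)"] q by simp
      finally have "?r \<le> B" by (simp add: B_def mult_ac)
      then have "?r powr (\<gamma> - \<kappa>) \<le> B powr (\<gamma> - \<kappa>)" using \<kappa> pos[of "\<bar>\<theta> - arccos x\<bar>"] by (intro powr_mono2) auto
      moreover have "?r powr (\<gamma> - 1) = ?r powr (\<gamma> - \<kappa>) * ?g \<bar>\<theta> - arccos x\<bar>"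
        by (simp add: powr_add[symmetric])
      ultimately show "?r powr (\<gamma> - 1) \<le> B powr (\<gamma> - \<kappa>) * ?g \<bar>\<theta> - arccos x\<bar>"
        by (simp add: mult_right_mono)
    qed
    also have "\<dots> = B powr (\<gamma> - \<kappa>) * (\<Sum>x\<in>X. ?g \<bar>\<theta> - arccos x\<bar>)" by (simp add: sum_distrib_left)
    also have "\<dots> \<le> B powr (\<gamma> - \<kappa>) * (2 * D\<^sup>2 * (B powr \<kappa> / \<kappa>))"
    proof (intro mult_left_mono order.trans[OF main])
      have "(\<Sum>k\<le>K. (1 + real k) powr (\<kappa> - 1)) \<le> (1 + real K) powr \<kappa> / \<kappa>"
        using kpos \<kappa> by (intro sum_powr_le)
      also have "\<dots> \<le> B powr \<kappa> / \<kappa>" using kpos K by (intro divide_right_mono powr_mono2) (auto simp: B_def)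
      finally show "(\<Sum>k\<le>K. (1 + real k) powr (\<kappa> - 1)) \<le> B powr \<kappa> / \<kappa>" .
    qed auto
    also have "\<dots> = 2 * D\<^sup>2 * (B powr \<gamma> / \<kappa>)" by (simp add: powr_diff field_simps)
    also have "B powr \<gamma> = (6 * D\<^sup>2 * q) powr \<gamma> * real n powr \<gamma>"
      unfolding B_def using q D2 by (intro powr_mult)
    finally show ?thesis using True by (simp add: sum_const_def lebesgue_rate_def q_def \<kappa>_def)
  next
    case False
    then have g0: "\<gamma> = 0" "\<kappa> = 0" using \<gamma> by (auto simp: \<kappa>_def)
    let ?B = "6 * D\<^sup>2 * q"
    have B: "?B \<ge> 1" using mult_mono[of 1 "6 * D\<^sup>2" 1 q] D2 q by simp
    \<comment> \<open>Needed to absorb the additive constants; this is the reason for \<open>n \<ge> 2\<close>.\<close>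
    have ln2: "ln (real n) \<ge> 1 / 2"
    proof -
      have "ln (real n) \<ge> ln 2" using n by simp
      then show ?thesis using ln2_ge_two_thirds by linarith
    qed
    have "(\<Sum>k\<le>K. (1 + real k) powr (\<kappa> - 1)) = (\<Sum>k\<le>K. 1 / (1 + real k))"
      by (intro sum.cong refl) (simp add: g0 powr_minus divide_inverse)
    also have "\<dots> \<le> 1 + ln (1 + real K)" by (rule sum_inverse_le_ln)
    also have "\<dots> \<le> 1 + ln (?B * real n)" using K by (intro add_left_mono ln_mono) auto
    also have "\<dots> = 1 + ln ?B + ln (real n)" using B n by (subst ln_mult) auto
    also have "\<dots> \<le> (3 + 2 * ln ?B) * ln (real n)"
    proof -
      have "(2 + 2 * ln ?B) * (1 / 2) \<le> (2 + 2 * ln ?B) * ln (real n)"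
        using ln2 B by (intro mult_left_mono) auto
      then show ?thesis by (simp add: algebra_simps)
    qed
    finally have "2 * D\<^sup>2 * (\<Sum>k\<le>K. (1 + real k) powr (\<kappa> - 1)) \<le> 2 * D\<^sup>2 * ((3 + 2 * ln ?B) * ln (real n))"
      by (intro mult_left_mono) auto
    then show ?thesis using main g0 by (simp add: sum_const_def lebesgue_rate_def q_def)
  qed
qed

lemma weighted_lebesgue_bulk:
  assumes th: "\<theta> \<in> bulk" "\<theta> \<le> pi / 2" and ik: "i \<le> 1" "k \<le> 1" and \<gamma>: "\<sigma> \<le> \<gamma>" and n: "n \<ge> 2"
  shows "weighted_lebesgue X i k (cos \<theta>) \<le> term_const * sum_const \<gamma> * lebesgue_rate \<gamma> n"
proof -
  have "weighted_lebesgue X i k (cos \<theta>) \<le> (\<Sum>x\<in>X. term_const * (1 + L * \<bar>\<theta> - arccos x\<bar>) powr (\<gamma> - 1))"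
    unfolding weighted_lebesgue_def
  proof (rule sum_mono)
    fix x assume x: "x \<in> X"
    have "1 + L * \<bar>\<theta> - arccos x\<bar> \<ge> 1" using L_pos by simp
    then have "(1 + L * \<bar>\<theta> - arccos x\<bar>) powr (\<sigma> - 1) \<le> (1 + L * \<bar>\<theta> - arccos x\<bar>) powr (\<gamma> - 1)"
      using \<gamma> by (intro powr_mono) auto
    then have "term_const * (1 + L * \<bar>\<theta> - arccos x\<bar>) powr (\<sigma> - 1) \<le> term_const * (1 + L * \<bar>\<theta> - arccos x\<bar>) powr (\<gamma> - 1)"
      using term_const_ge_1 by (intro mult_left_mono) auto
    with lebesgue_term_bound[OF th x ik] show "\<bar>poly (lagrange_poly X x) (cos \<theta>)\<bar> * weight_ratio i k (cos \<theta>) x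
       \<le> term_const * (1 + L * \<bar>\<theta> - arccos x\<bar>) powr (\<gamma> - 1)" by (rule order.trans)
  qed
  also have "\<dots> = term_const * (\<Sum>x\<in>X. (1 + L * \<bar>\<theta> - arccos x\<bar>) powr (\<gamma> - 1))" by (simp add: sum_distrib_left)
  also have "\<dots> \<le> term_const * (sum_const \<gamma> * lebesgue_rate \<gamma> n)"
    using sum_over_zeros_le[OF th(1) _ n] \<gamma> \<sigma>_nonneg term_const_ge_1 by (intro mult_left_mono) auto
  finally show ?thesis by (simp add: mult_ac)
qed

text \<open>Closer to \<open>1\<close> than the bulk reaches, \<open>P\<close> is comparable to its value at the edge of the bulk, and the
  distances to the zeros only increase.\<close>

lemma weighted_lebesgue_near_1:
  assumes t: "cos (1 / L) \<le> t" "t \<le> 1" and ik: "i \<le> 1" "k \<le> 1"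
  shows "weighted_lebesgue X i k t \<le> 4 * weighted_lebesgue X i k (cos (1 / L))"
  unfolding weighted_lebesgue_def sum_distrib_left
proof (rule sum_mono)
  fix x assume x: "x \<in> X"
  define t0 where "t0 = cos (1 / L)"
  have t0: "1 - t0 \<le> 1 / (2 * lam)"
    using one_minus_cos_le[of "1 / L"] by (simp add: t0_def power_divide L_sq mult.commute)
  have lam2: "1 / (2 * lam) < 1 / lam" using lam_pos by (simp add: field_simps)
  have x0: "x < t0" using one_minus_zero_ge[OF x] t0 lam2 by linarith
  have xt: "x < t" using x0 t by (simp add: t0_def)
  have P': "\<bar>poly (pderiv P) x\<bar> > 0" using pderiv_P_nonzero[OF x] by simp
  have "t0 \<le> 1" "t0 \<ge> 0"
  proof -
    show "t0 \<le> 1" by (simp add: t0_def)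
    have "1 / L \<le> 1" using L_ge_1 by simp
    then have "1 / L \<le> pi / 2" using pi_ge_two by linarith
    moreover have "0 \<le> 1 / L" using L_pos by simp
    ultimately show "t0 \<ge> 0" unfolding t0_def using pi_gt_zero by (intro cos_ge_zero) linarith+
  qed
  have tt: "1 - 1 / (2 * lam) \<le> t" using t t0 by (simp add: t0_def)
  have "\<bar>poly P t\<bar> \<le> 2 * \<bar>poly P t0\<bar>"
    using abs_P_near_1(2)[OF tt t(2)] abs_P_near_1(1)[of t0] t0 \<open>t0 \<le> 1\<close> by linarith
  then have "\<bar>poly P t\<bar> / ((t - x) * \<bar>poly (pderiv P) x\<bar>) \<le> (2 * \<bar>poly P t0\<bar>) / ((t0 - x) * \<bar>poly (pderiv P) x\<bar>)"
    using t x0 P' by (intro frac_le mult_right_mono) (auto simp: t0_def)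
  then have l: "\<bar>poly (lagrange_poly X x) t\<bar> \<le> 2 * \<bar>poly (lagrange_poly X x) t0\<bar>"
    using x0 xt by (simp add: lagrange_eq[OF x] abs_mult)
  note xb = zero_bounds[OF x]
  have w: "weight_ratio i k t x \<le> 2 * weight_ratio i k t0 x"
  proof -
    have a: "sqrt ((1 - t) / (1 - x)) ^ i \<le> sqrt ((1 - t0) / (1 - x)) ^ i"
      using t xb by (intro power_mono real_sqrt_le_mono divide_right_mono) (auto simp: t0_def)
    have b: "sqrt ((1 + t) / (1 + x)) ^ k \<le> 2 * sqrt ((1 + t0) / (1 + x)) ^ k"
    proof -
      have "sqrt ((1 + t) / (1 + x)) \<le> sqrt (4 * ((1 + t0) / (1 + x)))"
        using t xb \<open>t0 \<ge> 0\<close> by (simp add: divide_right_mono)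
      also have "\<dots> = 2 * sqrt ((1 + t0) / (1 + x))" by (simp only: real_sqrt_mult real_sqrt_four)
      finally show ?thesis using ik by (cases k) auto
    qed
    have "t \<ge> 0" using t(1) \<open>t0 \<ge> 0\<close> by (simp add: t0_def)
    then have "0 \<le> sqrt ((1 + t) / (1 + x)) ^ k" using xb by simp
    moreover have "0 \<le> sqrt ((1 - t0) / (1 - x)) ^ i" using xb \<open>t0 \<le> 1\<close> by simp
    ultimately show ?thesis unfolding weight_ratio_def
      using mult_mono[OF a b] by (simp add: mult_ac)
  qed
  have "weight_ratio i k t x \<ge> 0" using t xb \<open>t0 \<ge> 0\<close> by (auto simp: weight_ratio_def t0_def)
  then have "\<bar>poly (lagrange_poly X x) t\<bar> * weight_ratio i k t x \<le> (2 * \<bar>poly (lagrange_poly X x) t0\<bar>) * (2 * weight_ratio i k t0 x)"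
    using l w by (intro mult_mono) auto
  then show "\<bar>poly (lagrange_poly X x) t\<bar> * weight_ratio i k t x \<le> 4 * (\<bar>poly (lagrange_poly X x) (cos (1 / L))\<bar> * weight_ratio i k (cos (1 / L)) x)"
    by (simp add: t0_def)
qed

lemma weighted_lebesgue_right_half:
  assumes t: "0 \<le> t" "t \<le> 1" and ik: "i \<le> 1" "k \<le> 1" and \<gamma>: "\<sigma> \<le> \<gamma>" and n: "n \<ge> 2"
  shows "weighted_lebesgue X i k t \<le> 4 * (term_const * sum_const \<gamma>) * lebesgue_rate \<gamma> n"
proof -
  have "1 / L \<le> 1" using L_ge_1 by simp
  then have L1: "1 / L \<le> pi / 2" using pi_ge_two by linarith
  have b: "\<theta> \<in> bulk" if "1 / L \<le> \<theta>" "\<theta> \<le> pi / 2" for \<theta>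
    unfolding bulk_def atLeastAtMost_iff using that L1 by (intro conjI) linarith+
  have nn: "weighted_lebesgue X i k (cos \<theta>) \<ge> 0" for \<theta>
    using zero_bounds by (intro weighted_lebesgue_nonneg) auto
  show ?thesis
  proof (cases "t \<le> cos (1 / L)")
    case True
    define \<theta> where "\<theta> = arccos t"
    have th: "cos \<theta> = t" using t by (simp add: \<theta>_def)
    have "arccos t \<ge> arccos (cos (1 / L))" using True t by (intro arccos_le_arccos) auto
    also have "arccos (cos (1 / L)) = 1 / L" 
    proof (rule arccos_cos)
      show "0 \<le> 1 / L" using L_pos by simp
      show "1 / L \<le> pi" using L1 pi_gt_zero by linarith
    qed
    finally have "1 / L \<le> \<theta>" by (simp add: \<theta>_def)
    moreover have "\<theta> \<le> pi / 2" unfolding \<theta>_def using t by (intro arccos_le_pi2) auto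
    ultimately have "weighted_lebesgue X i k (cos \<theta>) \<le> term_const * sum_const \<gamma> * lebesgue_rate \<gamma> n"
      using weighted_lebesgue_bulk b ik \<gamma> n by blast
    then show ?thesis using nn[of \<theta>] unfolding th by linarith
  next
    case False
    then have "weighted_lebesgue X i k t \<le> 4 * weighted_lebesgue X i k (cos (1 / L))"
      using t ik by (intro weighted_lebesgue_near_1) auto
    also have "\<dots> \<le> 4 * (term_const * sum_const \<gamma> * lebesgue_rate \<gamma> n)"
      using weighted_lebesgue_bulk[OF b[OF order.refl L1] L1 ik \<gamma> n] by simp
    finally show ?thesis by simp
  qed
qed

end

text \<open>The constant is chosen before \<open>n\<close>, the polynomial and the point. Which half of the interval \<open>t\<close> lies
  in decides whether the exponent \<open>\<sigma>\<close> or \<open>\<tau>\<close> matters, hence the maximum.\<close>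

lemma weighted_lebesgue_bound:
  assumes "\<sigma> \<ge> 0" "\<tau> \<ge> 0"
  shows "\<exists>C\<ge>0. \<forall>n P i k t. n \<ge> 2 \<longrightarrow> jacobi_zeros \<sigma> \<tau> n P \<longrightarrow> i \<le> 1 \<longrightarrow> k \<le> 1 \<longrightarrow> -1 \<le> t \<longrightarrow> t \<le> 1 \<longrightarrow>
     weighted_lebesgue (jacobi_zeros.X P) i k t \<le> C * lebesgue_rate (max \<sigma> \<tau>) n"
proof -
  define c where "c \<sigma> \<tau> = 4 * (jacobi_zeros.term_const \<sigma> \<tau> * jacobi_zeros.sum_const \<sigma> \<tau> (max \<sigma> \<tau>))" for \<sigma> \<tau> :: real
  define C where "C = \<bar>c \<sigma> \<tau>\<bar> + \<bar>c \<tau> \<sigma>\<bar>"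
  have "weighted_lebesgue (jacobi_zeros.X P) i k t \<le> C * lebesgue_rate (max \<sigma> \<tau>) n"
    if n: "n \<ge> 2" and P: "jacobi_zeros \<sigma> \<tau> n P" and ik: "i \<le> 1" "k \<le> 1" and t: "-1 \<le> t" "t \<le> 1" for n P i k t
  proof -
    interpret jacobi_zeros \<sigma> \<tau> n P by (rule P)
    have r: "lebesgue_rate (max \<sigma> \<tau>) n \<ge> 0" using n by (intro lebesgue_rate_nonneg) auto
    show ?thesis
    proof (cases "t \<ge> 0")
      case True
      have "weighted_lebesgue X i k t \<le> c \<sigma> \<tau> * lebesgue_rate (max \<sigma> \<tau>) n"
        unfolding c_def using weighted_lebesgue_right_half[OF True t(2) ik _ n] by simp
      also have "\<dots> \<le> C * lebesgue_rate (max \<sigma> \<tau>) n" using r by (intro mult_right_mono) (auto simp: C_def)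
      finally show ?thesis .
    next
      case False
      interpret refl: jacobi_zeros \<tau> \<sigma> n "pcompose P [:0, -1:]" by (rule reflected)
      have "weighted_lebesgue X i k t = weighted_lebesgue refl.X k i (- t)"
        unfolding reflected_X by (rule weighted_lebesgue_reflect[symmetric])
      also have "\<dots> \<le> c \<tau> \<sigma> * lebesgue_rate (max \<tau> \<sigma>) n"
        unfolding c_def using refl.weighted_lebesgue_right_half[of "- t" k i "max \<tau> \<sigma>"] False t ik n by simp
      also have "\<dots> \<le> C * lebesgue_rate (max \<sigma> \<tau>) n"
        unfolding max.commute[of \<tau>] using r by (intro mult_right_mono) (auto simp: C_def)
      finally show ?thesis .
    qed
  qed
  then show ?thesis by (intro exI[of _ C]) (auto simp: C_def)
qed

section \<open>Bivariate polynomials and symmetric functions\<close>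

lemma bipoly_spaceI:
  "f = (\<lambda>(x, y). \<Sum>i\<le>d. \<Sum>j\<le>d - i. c i j * x ^ i * y ^ j) \<Longrightarrow> f \<in> bipoly_space d"
  unfolding bipoly_space_def by blast

lemma bipoly_zero: "(\<lambda>z. 0) \<in> bipoly_space d"
  by (rule bipoly_spaceI[where c = "\<lambda>i j. 0"]) auto

lemma bipoly_add:
  assumes "f \<in> bipoly_space d" "g \<in> bipoly_space d"
  shows "(\<lambda>z. f z + g z) \<in> bipoly_space d"
proof -
  obtain c c' where f: "f = (\<lambda>(x, y). \<Sum>i\<le>d. \<Sum>j\<le>d - i. c i j * x ^ i * y ^ j)"
    and g: "g = (\<lambda>(x, y). \<Sum>i\<le>d. \<Sum>j\<le>d - i. c' i j * x ^ i * y ^ j)"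
    using assms unfolding bipoly_space_def by blast
  show ?thesis
    unfolding f g
    by (rule bipoly_spaceI[where c = "\<lambda>i j. c i j + c' i j"])
      (auto simp: fun_eq_iff sum.distrib[symmetric] algebra_simps intro!: sum.cong)
qed

lemma bipoly_cmult:
  assumes "f \<in> bipoly_space d"
  shows "(\<lambda>z. a * f z) \<in> bipoly_space d"
proof -
  obtain c where f: "f = (\<lambda>(x, y). \<Sum>i\<le>d. \<Sum>j\<le>d - i. c i j * x ^ i * y ^ j)"
    using assms unfolding bipoly_space_def by blast
  show ?thesis
    unfolding f
    by (rule bipoly_spaceI[where c = "\<lambda>i j. a * c i j"])
      (auto simp: fun_eq_iff sum_distrib_left mult.assoc)
qed

lemma bipoly_sum:
  assumes "\<And>i. i \<in> I \<Longrightarrow> f i \<in> bipoly_space d"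
  shows "(\<lambda>z. \<Sum>i\<in>I. f i z) \<in> bipoly_space d"
  using assms by (induction I rule: infinite_finite_induct) (auto intro: bipoly_zero bipoly_add)

lemma bipoly_monomial:
  assumes "i + j \<le> d"
  shows "(\<lambda>z. fst z ^ i * snd z ^ j) \<in> bipoly_space d"
proof (rule bipoly_spaceI[where c = "\<lambda>i' j'. if i' = i \<and> j' = j then 1 else 0"], rule ext)
  fix z :: "real \<times> real"
  obtain x y where z: "z = (x, y)" by (cases z)
  have "(\<Sum>i'\<le>d. \<Sum>j'\<le>d - i'. (if i' = i \<and> j' = j then 1 else 0) * x ^ i' * y ^ j')
     = (\<Sum>i'\<le>d. \<Sum>j'\<le>d - i'. if j' = j then (if i' = i then x ^ i * y ^ j else 0) else 0)"
    by (intro sum.cong refl) auto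
  also have "\<dots> = (\<Sum>i'\<le>d. if i' = i then (if j \<le> d - i' then x ^ i * y ^ j else 0) else 0)"
    by (intro sum.cong refl) (simp add: sum.delta)
  also have "\<dots> = x ^ i * y ^ j" using assms by (simp add: sum.delta)
  finally show "fst z ^ i * snd z ^ j = (case z of (x, y) \<Rightarrow> \<Sum>i'\<le>d. \<Sum>j'\<le>d - i'. (if i' = i \<and> j' = j then 1 else 0) * x ^ i' * y ^ j')"
    by (simp add: z)
qed

text \<open>Reduces properties that respect linear combinations to monomials.\<close>

lemma bipoly_induct [consumes 1, case_names monomial cmult add]:
  assumes "f \<in> bipoly_space d"
    and mono: "\<And>i j. i + j \<le> d \<Longrightarrow> Q (\<lambda>z. fst z ^ i * snd z ^ j)"
    and cmult: "\<And>a f. f \<in> bipoly_space d \<Longrightarrow> Q f \<Longrightarrow> Q (\<lambda>z. a * f z)"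
    and add: "\<And>f g. f \<in> bipoly_space d \<Longrightarrow> g \<in> bipoly_space d \<Longrightarrow> Q f \<Longrightarrow> Q g \<Longrightarrow> Q (\<lambda>z. f z + g z)"
  shows "Q f"
proof -
  obtain c where f: "f = (\<lambda>(x, y). \<Sum>i\<le>d. \<Sum>j\<le>d - i. c i j * x ^ i * y ^ j)"
    using assms(1) unfolding bipoly_space_def by blast
  have zero: "Q (\<lambda>z. 0)" using cmult[OF bipoly_monomial mono, of 0 0 0] by simp
  have sum: "(\<lambda>z. \<Sum>i\<in>I. g i z) \<in> bipoly_space d \<and> Q (\<lambda>z. \<Sum>i\<in>I. g i z)"
    if "finite I" "\<And>i. i \<in> I \<Longrightarrow> g i \<in> bipoly_space d \<and> Q (g i)" for I :: "nat set" and g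
    using that by (induction I rule: finite_induct) (auto intro: bipoly_zero zero bipoly_add add)
  have "Q (\<lambda>z. \<Sum>i\<le>d. \<Sum>j\<le>d - i. c i j * (fst z ^ i * snd z ^ j))"
    by (intro sum[THEN conjunct2] sum conjI bipoly_cmult bipoly_monomial cmult mono) auto
  moreover have "f = (\<lambda>z. \<Sum>i\<le>d. \<Sum>j\<le>d - i. c i j * (fst z ^ i * snd z ^ j))"
    by (auto simp: f fun_eq_iff mult.assoc)
  ultimately show ?thesis by simp
qed

lemma bipoly_mono:
  assumes "f \<in> bipoly_space d" "d \<le> e"
  shows "f \<in> bipoly_space e"
  using assms(1)
proof (induction rule: bipoly_induct)
  case (monomial i j)
  then show ?case using assms(2) by (intro bipoly_monomial) auto
qed (auto intro: bipoly_cmult bipoly_add)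

lemma bipoly_mult:
  assumes "f \<in> bipoly_space d" "g \<in> bipoly_space e"
  shows "(\<lambda>z. f z * g z) \<in> bipoly_space (d + e)"
  using assms(1)
proof (induction rule: bipoly_induct)
  case (monomial i j)
  show ?case using assms(2)
  proof (induction rule: bipoly_induct)
    case (monomial i' j')
    have "(\<lambda>z::real \<times> real. fst z ^ i * snd z ^ j * (fst z ^ i' * snd z ^ j')) = (\<lambda>z. fst z ^ (i + i') * snd z ^ (j + j'))"
      by (simp add: fun_eq_iff power_add)
    then show ?case using bipoly_monomial[of "i + i'" "j + j'" "d + e"] \<open>i + j \<le> d\<close> monomial by simp
  next
    case (cmult a f)
    then show ?case using bipoly_cmult[of _ "d + e" a] by (fastforce simp: mult_ac)
  next
    case (add f g)
    then show ?case using bipoly_add[of _ "d + e"] by (fastforce simp: distrib_left)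
  qed
next
  case (cmult a f)
  then show ?case using bipoly_cmult[of _ "d + e" a] by (fastforce simp: mult_ac)
next
  case (add f g)
  then show ?case using bipoly_add[of _ "d + e"] by (fastforce simp: distrib_right)
qed

lemma bipoly_const: "(\<lambda>z. a) \<in> bipoly_space d"
  using bipoly_cmult[OF bipoly_monomial[of 0 0 d], of a] by simp

lemma bipoly_fst: "(\<lambda>z. fst z) \<in> bipoly_space 1"
  using bipoly_monomial[of 1 0 1] by simp

lemma bipoly_snd: "(\<lambda>z. snd z) \<in> bipoly_space 1"
  using bipoly_monomial[of 0 1 1] by simp

lemma bipoly_diff:
  assumes "f \<in> bipoly_space d" "g \<in> bipoly_space d"
  shows "(\<lambda>z. f z - g z) \<in> bipoly_space d"
  using bipoly_add[OF assms(1) bipoly_cmult[OF assms(2), of "-1"]] by simp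

lemma bipoly_power:
  assumes "f \<in> bipoly_space d"
  shows "(\<lambda>z. f z ^ i) \<in> bipoly_space (i * d)"
proof (induction i)
  case 0
  then show ?case by (simp add: bipoly_const)
next
  case (Suc i)
  then show ?case using bipoly_mult[OF assms Suc] by simp
qed

lemma bipoly_compose:
  assumes "f \<in> bipoly_space d" and a: "a \<in> bipoly_space e" and b: "b \<in> bipoly_space e"
  shows "(\<lambda>z. f (a z, b z)) \<in> bipoly_space (d * e)"
  using assms(1)
proof (induction rule: bipoly_induct)
  case (monomial i j)
  have "(\<lambda>z. a z ^ i * b z ^ j) \<in> bipoly_space (i * e + j * e)"
    by (intro bipoly_mult bipoly_power a b)
  moreover have "i * e + j * e \<le> d * e" using monomial by (metis add_mult_distrib mult_le_mono1)
  ultimately show ?case by (auto intro: bipoly_mono)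
qed (auto intro: bipoly_cmult bipoly_add)

text \<open>Restrictions to lines turn questions about bivariate polynomials into counting zeros of univariate
  ones.\<close>

lemma bipoly_line:
  assumes "f \<in> bipoly_space d"
  shows "\<exists>r. degree r \<le> d \<and> (\<forall>t. f (a + b * t, c + e * t) = poly r t)"
  using assms
proof (induction rule: bipoly_induct)
  case (monomial i j)
  have "degree ([:a, b:] ^ i * [:c, e:] ^ j) \<le> degree ([:a, b:] ^ i) + degree ([:c, e:] ^ j)"
    by (rule degree_mult_le)
  also have "\<dots> \<le> degree [:a, b:] * i + degree [:c, e:] * j"
    by (intro add_mono degree_power_le)
  also have "\<dots> \<le> 1 * i + 1 * j" by (intro add_mono mult_right_mono) auto
  also have "\<dots> \<le> d" using monomial by simp
  finally show ?case
    by (intro exI[of _ "[:a, b:] ^ i * [:c, e:] ^ j"]) (simp add: mult.commute)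
next
  case (cmult k f)
  then obtain r where "degree r \<le> d" "\<forall>t. f (a + b * t, c + e * t) = poly r t" by blast
  then show ?case by (intro exI[of _ "smult k r"]) (auto intro: order.trans[OF degree_smult_le])
next
  case (add f g)
  then obtain r r' where "degree r \<le> d" "\<forall>t. f (a + b * t, c + e * t) = poly r t"
    "degree r' \<le> d" "\<forall>t. g (a + b * t, c + e * t) = poly r' t" by blast
  then show ?case by (intro exI[of _ "r + r'"]) (auto intro: degree_add_le)
qed

lemma poly_eq_on_interval:
  fixes p q :: "real poly"
  assumes "a < b" "\<And>t. a < t \<Longrightarrow> t < b \<Longrightarrow> poly p t = poly q t"
  shows "p = q"
proof (rule ccontr)
  assume "p \<noteq> q"
  then have "finite {t. poly (p - q) t = 0}" by (intro poly_roots_finite) simp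
  moreover have "{a<..<b} \<subseteq> {t. poly (p - q) t = 0}" using assms(2) by auto
  ultimately show False using assms(1) infinite_Ioo finite_subset by blast
qed

lemma poly_zero_card_roots:
  fixes r :: "'a::idom poly"
  assumes "finite X" "degree r < card X" "\<And>x. x \<in> X \<Longrightarrow> poly r x = 0"
  shows "r = 0"
proof (rule ccontr)
  assume "r \<noteq> 0"
  then have "card X \<le> card {x. poly r x = 0}"
    using assms(3) poly_roots_finite by (intro card_mono) auto
  also have "\<dots> \<le> degree r" using \<open>r \<noteq> 0\<close> by (rule card_poly_roots_bound)
  finally show False using assms(2) by simp
qed

lemma bipoly_eq_on_square:
  assumes f: "f \<in> bipoly_space d" and g: "g \<in> bipoly_space d" and eq: "\<And>z. z \<in> square \<Longrightarrow> f z = g z"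
  shows "f = g"
proof -
  define h where "h = (\<lambda>z. f z - g z)"
  have h: "h \<in> bipoly_space d" unfolding h_def by (rule bipoly_diff[OF f g])
  have 1: "h (x, y) = 0" if y: "-1 \<le> y" "y \<le> 1" for x y
  proof -
    obtain r where r: "\<forall>t. h (0 + 1 * t, y + 0 * t) = poly r t" using bipoly_line[OF h] by metis
    have "poly r t = poly 0 t" if "-1 < t" "t < 1" for t
      using r[rule_format, of t] eq[of "(t, y)"] y that by (simp add: square_def h_def)
    then have "r = 0" by (intro poly_eq_on_interval[of "-1" 1]) auto
    then show ?thesis using r by simp
  qed
  have "h (x, y) = 0" for x y
  proof -
    obtain r where r: "\<forall>t. h (x + 0 * t, 0 + 1 * t) = poly r t" using bipoly_line[OF h] by metis
    have "poly r t = poly 0 t" if "-1 < t" "t < 1" for t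
      using r[rule_format, of t] 1[of t x] that by simp
    then have "r = 0" by (intro poly_eq_on_interval[of "-1" 1]) auto
    then show ?thesis using r by simp
  qed
  then show ?thesis by (auto simp: fun_eq_iff h_def)
qed

text \<open>The squares of \<open>s\<close> and \<open>d\<close> in terms of \<open>u\<close> and \<open>v\<close>. Since \<open>u + v\<close> and \<open>u v\<close> are affine functions of
  the two components, symmetric polynomials in \<open>u, v\<close> of degree \<open>m\<close> in each variable are polynomials of
  total degree \<open>m\<close> in these components.\<close>

definition uv_image :: "real \<Rightarrow> real \<Rightarrow> real \<times> real" where
  "uv_image u v = ((1 + u) * (1 + v), (1 - u) * (1 - v))"

lemma uv_image_commute: "uv_image u v = uv_image v u"
  by (simp add: uv_image_def mult.commute)

text \<open>Newton's recursion for power sums raises the total degree by one in each step.\<close>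

lemma power_sum_bipoly: "\<exists>A\<in>bipoly_space r. \<forall>u v. A (uv_image u v) = u ^ r + v ^ r"
proof (induction r rule: less_induct)
  case (less r)
  show ?case
  proof (cases "r \<ge> 2")
    case False
    then have "r = 0 \<or> r = 1" by auto
    then show ?thesis
    proof
      assume "r = 0"
      then show ?thesis by (intro bexI[of _ "\<lambda>z. 2"] bipoly_const) auto
    next
      assume "r = 1"
      have "(\<lambda>z. 1 / 2 * (fst z - snd z)) \<in> bipoly_space 1"
        by (intro bipoly_cmult bipoly_diff bipoly_fst bipoly_snd)
      then show ?thesis using \<open>r = 1\<close>
        by (intro bexI[of _ "\<lambda>z. 1 / 2 * (fst z - snd z)"]) (auto simp: uv_image_def algebra_simps)
    qed
  next
    case True
    then obtain m where r: "r = Suc (Suc m)" by (metis add_2_eq_Suc le_Suc_ex)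
    obtain A where A: "A \<in> bipoly_space (Suc m)" "\<And>u v. A (uv_image u v) = u ^ Suc m + v ^ Suc m"
      using less[of "Suc m"] r by auto
    obtain B where B: "B \<in> bipoly_space m" "\<And>u v. B (uv_image u v) = u ^ m + v ^ m"
      using less[of m] r by auto
    define e1 where "e1 z = 1 / 2 * (fst z - snd z)" for z :: "real \<times> real"
    define e2 where "e2 z = 1 / 2 * (fst z + snd z) - 1" for z :: "real \<times> real"
    have e1: "e1 \<in> bipoly_space 1" unfolding e1_def[abs_def] by (intro bipoly_cmult bipoly_diff bipoly_fst bipoly_snd)
    have e2: "e2 \<in> bipoly_space 1" unfolding e2_def[abs_def]
      by (intro bipoly_cmult bipoly_diff bipoly_add bipoly_fst bipoly_snd bipoly_const)
    have e: "e1 (uv_image u v) = u + v" "e2 (uv_image u v) = u * v" for u v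
      by (auto simp: e1_def e2_def uv_image_def algebra_simps)
    have "(\<lambda>z. e1 z * A z - e2 z * B z) \<in> bipoly_space r"
      unfolding r by (intro bipoly_diff bipoly_mono[OF bipoly_mult[OF e1 A(1)]] bipoly_mono[OF bipoly_mult[OF e2 B(1)]]) auto
    then show ?thesis
      by (intro bexI[of _ "\<lambda>z. e1 z * A z - e2 z * B z"]) (auto simp: e A B r algebra_simps)
  qed
qed

lemma symmetric_monomial_bipoly:
  assumes "i \<le> m" "j \<le> m"
  shows "\<exists>A\<in>bipoly_space m. \<forall>u v. A (uv_image u v) = u ^ i * v ^ j + u ^ j * v ^ i"
proof -
  have main: "\<exists>A\<in>bipoly_space m. \<forall>u v. A (uv_image u v) = u ^ i * v ^ j + u ^ j * v ^ i"
    if ij: "i \<le> j" "j \<le> m" for i j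
  proof -
    obtain A where A: "A \<in> bipoly_space (j - i)" "\<And>u v. A (uv_image u v) = u ^ (j - i) + v ^ (j - i)"
      using power_sum_bipoly[of "j - i"] by blast
    define e2 where "e2 z = 1 / 2 * (fst z + snd z) - 1" for z :: "real \<times> real"
    have e2: "e2 \<in> bipoly_space 1" unfolding e2_def[abs_def]
      by (intro bipoly_cmult bipoly_diff bipoly_add bipoly_fst bipoly_snd bipoly_const)
    have e: "e2 (uv_image u v) = u * v" for u v
      by (auto simp: e2_def uv_image_def algebra_simps)
    have "(\<lambda>z. e2 z ^ i * A z) \<in> bipoly_space m"
      using ij by (intro bipoly_mono[OF bipoly_mult[OF bipoly_power[OF e2] A(1)]]) auto
    moreover have "e2 (uv_image u v) ^ i * A (uv_image u v) = u ^ i * v ^ j + u ^ j * v ^ i" for u v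
    proof -
      have "u ^ j = u ^ i * u ^ (j - i)" "v ^ j = v ^ i * v ^ (j - i)" using ij by (simp_all add: power_add[symmetric])
      then show ?thesis by (simp add: e A power_mult_distrib algebra_simps)
    qed
    ultimately show ?thesis by (intro bexI[of _ "\<lambda>z. e2 z ^ i * A z"]) auto
  qed
  show ?thesis
  proof (cases "i \<le> j")
    case True
    then show ?thesis using main assms by blast
  next
    case False
    then obtain A where "A \<in> bipoly_space m" "\<forall>u v. A (uv_image u v) = u ^ j * v ^ i + u ^ i * v ^ j"
      using main[of j i] assms by auto
    then show ?thesis by (intro bexI[of _ A]) (auto simp: add.commute)
  qed
qed

lemma symmetrized_product_bipoly:
  assumes "degree f \<le> m" "degree g \<le> m"
  shows "\<exists>A\<in>bipoly_space m. \<forall>u v. A (uv_image u v) = poly f u * poly g v + poly g u * poly f v"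
proof -
  have "\<exists>A. \<forall>i j. i \<le> m \<longrightarrow> j \<le> m \<longrightarrow> A i j \<in> bipoly_space m \<and> (\<forall>u v. A i j (uv_image u v) = u ^ i * v ^ j + u ^ j * v ^ i)"
    using symmetric_monomial_bipoly by (intro choice allI) (metis (no_types, lifting))
  then obtain A where A: "\<And>i j. i \<le> m \<Longrightarrow> j \<le> m \<Longrightarrow> A i j \<in> bipoly_space m"
    "\<And>i j u v. i \<le> m \<Longrightarrow> j \<le> m \<Longrightarrow> A i j (uv_image u v) = u ^ i * v ^ j + u ^ j * v ^ i"
    by blast
  define B where "B z = (\<Sum>i\<le>m. \<Sum>j\<le>m. coeff f i * coeff g j * A i j z)" for z
  have "B \<in> bipoly_space m"
    unfolding B_def[abs_def] by (intro bipoly_sum bipoly_cmult A) auto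
  moreover have "B (uv_image u v) = poly f u * poly g v + poly g u * poly f v" for u v
  proof -
    have pp: "poly p x = (\<Sum>i\<le>m. coeff p i * x ^ i)" if "degree p \<le> m" for p :: "real poly" and x
      unfolding poly_altdef using that by (intro sum.mono_neutral_left) (auto simp: coeff_eq_0)
    note pf = pp[OF assms(1)] and pg = pp[OF assms(2)]
    have "B (uv_image u v) = (\<Sum>i\<le>m. \<Sum>j\<le>m. (coeff f i * u ^ i) * (coeff g j * v ^ j) + (coeff f i * v ^ i) * (coeff g j * u ^ j))"
      unfolding B_def by (intro sum.cong refl) (simp add: A algebra_simps)
    also have "\<dots> = poly f u * poly g v + poly f v * poly g u"
      unfolding pf pg sum_product by (simp add: sum.distrib)
    finally show ?thesis by (simp add: mult.commute)
  qed
  ultimately show ?thesis by blast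
qed

text \<open>The same pair of squares as a function of the point \<open>(x, y)\<close>; the inverse of \<open>(x, y) \<mapsto> (s, d)\<close> follows.\<close>

definition sq_image :: "real \<times> real \<Rightarrow> real \<times> real" where
  "sq_image z = ((fst z + snd z)\<^sup>2, (fst z - snd z)\<^sup>2)"

definition sd_point :: "real \<Rightarrow> real \<Rightarrow> real \<times> real" where
  "sd_point s d = ((s + d) / 2, (s - d) / 2)"

text \<open>The component that is odd in both \<open>s\<close> and \<open>d\<close>; the factor is \<open>s d = x\<^sup>2 - y\<^sup>2\<close>.\<close>

definition antisym :: "(real \<times> real \<Rightarrow> real) \<Rightarrow> real \<times> real \<Rightarrow> real" where
  "antisym A z = ((fst z)\<^sup>2 - (snd z)\<^sup>2) * A (sq_image z)"

definition parity_form where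
  "parity_form A B C E z = A (sq_image z) + (fst z + snd z) * B (sq_image z)
     + (fst z - snd z) * C (sq_image z) + antisym E z"

lemma
  assumes "s\<^sup>2 = S" "d\<^sup>2 = D"
  shows antisym_sd_point: "antisym E (sd_point s d) = s * d * E (S, D)"
    and parity_form_sd_point: "parity_form A B C E (sd_point s d) = A (S, D) + s * B (S, D) + d * C (S, D) + s * d * E (S, D)"
proof -
  have sd: "fst (sd_point s d) + snd (sd_point s d) = s" "fst (sd_point s d) - snd (sd_point s d) = d"
    by (simp_all add: sd_point_def field_simps)
  then have sq: "sq_image (sd_point s d) = (S, D)" using assms by (simp add: sq_image_def)
  have "(fst (sd_point s d))\<^sup>2 - (snd (sd_point s d))\<^sup>2 = s * d"
    by (simp add: sd_point_def power2_eq_square field_simps)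
  then show anti: "antisym E (sd_point s d) = s * d * E (S, D)" by (simp add: antisym_def sq)
  show "parity_form A B C E (sd_point s d) = A (S, D) + s * B (S, D) + d * C (S, D) + s * d * E (S, D)"
    by (simp add: parity_form_def sd sq anti)
qed

lemma bipoly_sq_image:
  assumes "A \<in> bipoly_space m"
  shows "(\<lambda>z. A (sq_image z)) \<in> bipoly_space (m * 2)"
proof -
  have "(\<lambda>z. (fst z + snd z)\<^sup>2) \<in> bipoly_space 2" "(\<lambda>z. (fst z - snd z)\<^sup>2) \<in> bipoly_space 2"
    using bipoly_power[OF bipoly_add[OF bipoly_fst bipoly_snd], of 2]
      bipoly_power[OF bipoly_diff[OF bipoly_fst bipoly_snd], of 2] by simp_all
  then show ?thesis unfolding sq_image_def by (rule bipoly_compose[OF assms])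
qed

text \<open>Monomials in \<open>s\<close> and \<open>d\<close> are sorted by the parities of the exponents. For \<open>n = k + 2\<close> the degree bound
  is \<open>2 n - 1\<close>. An odd-odd monomial then has degree at most \<open>2 n - 2\<close>, so \<open>E\<close> has one degree less than
  the other components.\<close>

lemma bipoly_parity_decomposition:
  assumes "f \<in> bipoly_space (2 * k + 3)"
  shows "\<exists>A B C E. A \<in> bipoly_space (k + 1) \<and> B \<in> bipoly_space (k + 1) \<and> C \<in> bipoly_space (k + 1) \<and> E \<in> bipoly_space k \<and>
    f = parity_form A B C E"
proof -
  define h where "h = (\<lambda>z. f (1 / 2 * (fst z + snd z), 1 / 2 * (fst z - snd z)))"
  have "h \<in> bipoly_space ((2 * k + 3) * 1)"
    unfolding h_def by (intro bipoly_compose[OF assms] bipoly_cmult bipoly_add bipoly_diff bipoly_fst bipoly_snd)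
  then have "h \<in> bipoly_space (2 * k + 3)" by simp
  then have "\<exists>A B C E. A \<in> bipoly_space (k + 1) \<and> B \<in> bipoly_space (k + 1) \<and> C \<in> bipoly_space (k + 1) \<and> E \<in> bipoly_space k \<and>
    (\<forall>s d. h (s, d) = A (s\<^sup>2, d\<^sup>2) + s * B (s\<^sup>2, d\<^sup>2) + d * C (s\<^sup>2, d\<^sup>2) + s * d * E (s\<^sup>2, d\<^sup>2))"
  proof (induction rule: bipoly_induct)
    case (monomial i j)
    define a b where "a = i div 2" and "b = j div 2"
    let ?m = "\<lambda>z::real \<times> real. fst z ^ a * snd z ^ b"
    have mm: "?m \<in> bipoly_space d" if "a + b \<le> d" for d using that by (rule bipoly_monomial)
    have pw: "s ^ (2 * a) = (s\<^sup>2) ^ a" "d ^ (2 * b) = (d\<^sup>2) ^ b" for s d :: real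
      by (simp_all add: power_mult)
    note zero = bipoly_zero
    consider "i = 2 * a" "j = 2 * b" | "i = Suc (2 * a)" "j = 2 * b" | "i = 2 * a" "j = Suc (2 * b)"
      | "i = Suc (2 * a)" "j = Suc (2 * b)"
      unfolding a_def b_def by (metis even_two_times_div_two odd_two_times_div_two_succ Suc_eq_plus1)
    then show ?case
    proof cases
      case 1
      then have "a + b \<le> k + 1" using monomial by linarith
      then show ?thesis using 1 mm zero
        by (intro exI[of _ ?m] exI[of _ "\<lambda>z. 0"]) (auto simp: pw)
    next
      case 2
      then have "a + b \<le> k + 1" using monomial by linarith
      then show ?thesis using 2 mm zero
        by (intro exI[of _ "\<lambda>z. 0"] exI[of _ ?m] conjI allI; (rule zero mm | simp add: pw))
    next
      case 3
      then have ab: "a + b \<le> k + 1" using monomial by linarith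
      show ?thesis
        by (rule exI[of _ "\<lambda>z. 0"], rule exI[of _ "\<lambda>z. 0"], rule exI[of _ ?m], rule exI[of _ "\<lambda>z. 0"])
          (use 3 ab mm zero in \<open>auto simp: pw\<close>)
    next
      case 4
      then have ab: "a + b \<le> k" using monomial by linarith
      show ?thesis
        by (rule exI[of _ "\<lambda>z. 0"], rule exI[of _ "\<lambda>z. 0"], rule exI[of _ "\<lambda>z. 0"], rule exI[of _ ?m])
          (use 4 ab mm zero in \<open>auto simp: pw\<close>)
    qed
  next
    case (cmult c f)
    then obtain A B C E where *: "A \<in> bipoly_space (k + 1)" "B \<in> bipoly_space (k + 1)" "C \<in> bipoly_space (k + 1)" "E \<in> bipoly_space k"
      "\<And>s d. f (s, d) = A (s\<^sup>2, d\<^sup>2) + s * B (s\<^sup>2, d\<^sup>2) + d * C (s\<^sup>2, d\<^sup>2) + s * d * E (s\<^sup>2, d\<^sup>2)" by blast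
    show ?case
      by (rule exI[of _ "\<lambda>z. c * A z"], rule exI[of _ "\<lambda>z. c * B z"], rule exI[of _ "\<lambda>z. c * C z"], rule exI[of _ "\<lambda>z. c * E z"])
        (intro conjI allI bipoly_cmult *, simp add: *(5) algebra_simps)
  next
    case (add f g)
    obtain A B C E where *: "A \<in> bipoly_space (k + 1)" "B \<in> bipoly_space (k + 1)" "C \<in> bipoly_space (k + 1)" "E \<in> bipoly_space k"
      "\<And>s d. f (s, d) = A (s\<^sup>2, d\<^sup>2) + s * B (s\<^sup>2, d\<^sup>2) + d * C (s\<^sup>2, d\<^sup>2) + s * d * E (s\<^sup>2, d\<^sup>2)" using add.IH(1) by blast
    obtain A' B' C' E' where **: "A' \<in> bipoly_space (k + 1)" "B' \<in> bipoly_space (k + 1)" "C' \<in> bipoly_space (k + 1)" "E' \<in> bipoly_space k"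
      "\<And>s d. g (s, d) = A' (s\<^sup>2, d\<^sup>2) + s * B' (s\<^sup>2, d\<^sup>2) + d * C' (s\<^sup>2, d\<^sup>2) + s * d * E' (s\<^sup>2, d\<^sup>2)" using add.IH(2) by blast
    show ?case
      by (rule exI[of _ "\<lambda>z. A z + A' z"], rule exI[of _ "\<lambda>z. B z + B' z"], rule exI[of _ "\<lambda>z. C z + C' z"], rule exI[of _ "\<lambda>z. E z + E' z"])
        (intro conjI allI bipoly_add * **, simp add: *(5) **(5) algebra_simps)
  qed
  then obtain A B C E where *: "A \<in> bipoly_space (k + 1)" "B \<in> bipoly_space (k + 1)" "C \<in> bipoly_space (k + 1)" "E \<in> bipoly_space k"
      "\<And>s d. h (s, d) = A (s\<^sup>2, d\<^sup>2) + s * B (s\<^sup>2, d\<^sup>2) + d * C (s\<^sup>2, d\<^sup>2) + s * d * E (s\<^sup>2, d\<^sup>2)" by blast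
  have "f = parity_form A B C E"
  proof
    fix z
    have "f z = h (fst z + snd z, fst z - snd z)" by (simp add: h_def)
    moreover have "(fst z)\<^sup>2 - (snd z)\<^sup>2 = (fst z + snd z) * (fst z - snd z)" by (simp add: power2_eq_square algebra_simps)
    ultimately show "f z = parity_form A B C E z" by (simp add: *(5) parity_form_def antisym_def sq_image_def)
  qed
  then show ?thesis using *(1-4) by blast
qed

section \<open>Structure of the interpolation space\<close>

lemma sq_image_cos: "sq_image (cos \<theta>, cos \<phi>) = uv_image (cos (\<theta> - \<phi>)) (cos (\<theta> + \<phi>))"
proof -
  have s: "(sin \<theta>)\<^sup>2 * (sin \<phi>)\<^sup>2 = (1 - (cos \<theta>)\<^sup>2) * (1 - (cos \<phi>)\<^sup>2)" by (simp add: sin_squared_eq)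
  show ?thesis
    unfolding sq_image_def uv_image_def cos_diff cos_add
    using s by (simp add: power2_eq_square algebra_simps)
qed

lemma square_cosE:
  assumes "z \<in> square"
  obtains \<theta> \<phi> where "z = (cos \<theta>, cos \<phi>)"
  using assms that[of "arccos (fst z)" "arccos (snd z)"] by (auto simp: square_def)

definition sym_jacobi :: "real \<Rightarrow> real \<Rightarrow> nat \<Rightarrow> nat \<Rightarrow> real \<Rightarrow> real \<Rightarrow> real" where
  "sym_jacobi a b i j u v = poly (jacobi a b i) u * poly (jacobi a b j) v + poly (jacobi a b j) u * poly (jacobi a b i) v"

lemma antisym_in_bipoly:
  assumes "A \<in> bipoly_space m"
  shows "antisym A \<in> bipoly_space (2 * m + 2)"
proof -
  have "(\<lambda>z. (fst z)\<^sup>2 - (snd z)\<^sup>2) \<in> bipoly_space 2"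
    using bipoly_diff[OF bipoly_power[OF bipoly_fst, of 2] bipoly_power[OF bipoly_snd, of 2]] by simp
  from bipoly_mult[OF this bipoly_sq_image[OF assms]] show ?thesis
    unfolding antisym_def[abs_def] by (simp add: mult.commute add.commute)
qed

text \<open>On the square every pair of squares comes from real \<open>u, v\<close>, and a polynomial is determined by its
  values on the square.\<close>

lemma antisym_eqI:
  assumes "A \<in> bipoly_space m" "B \<in> bipoly_space m" "\<And>u v. A (uv_image u v) = B (uv_image u v)"
  shows "antisym A = antisym B"
proof (rule bipoly_eq_on_square[OF antisym_in_bipoly[OF assms(1)] antisym_in_bipoly[OF assms(2)]])
  fix z assume "z \<in> square"
  then obtain \<theta> \<phi> where z: "z = (cos \<theta>, cos \<phi>)" by (rule square_cosE)
  show "antisym A z = antisym B z" unfolding antisym_def z sq_image_cos assms(3) ..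
qed

lemma interp_spaceI:
  assumes "P \<in> bipoly_space (2 * n - 1)" "f = (\<lambda>z. P z + (\<Sum>k<n. c k * Q2 \<alpha> \<beta> n k z))"
  shows "f \<in> interp_space \<alpha> \<beta> n"
  using assms unfolding interp_space_def by blast

lemma interp_space_add:
  assumes "f \<in> interp_space \<alpha> \<beta> n" "g \<in> interp_space \<alpha> \<beta> n"
  shows "(\<lambda>z. f z + g z) \<in> interp_space \<alpha> \<beta> n"
proof -
  obtain P c where f: "P \<in> bipoly_space (2 * n - 1)" "f = (\<lambda>z. P z + (\<Sum>k<n. c k * Q2 \<alpha> \<beta> n k z))"
    using assms(1) unfolding interp_space_def by blast
  obtain P' c' where g: "P' \<in> bipoly_space (2 * n - 1)" "g = (\<lambda>z. P' z + (\<Sum>k<n. c' k * Q2 \<alpha> \<beta> n k z))"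
    using assms(2) unfolding interp_space_def by blast
  have "(\<lambda>z. f z + g z) = (\<lambda>z. (P z + P' z) + (\<Sum>k<n. (c k + c' k) * Q2 \<alpha> \<beta> n k z))"
    by (simp add: f g fun_eq_iff distrib_right sum.distrib)
  then show ?thesis by (rule interp_spaceI[OF bipoly_add[OF f(1) g(1)]])
qed

lemma interp_space_cmult:
  assumes "f \<in> interp_space \<alpha> \<beta> n"
  shows "(\<lambda>z. a * f z) \<in> interp_space \<alpha> \<beta> n"
proof -
  obtain P c where f: "P \<in> bipoly_space (2 * n - 1)" "f = (\<lambda>z. P z + (\<Sum>k<n. c k * Q2 \<alpha> \<beta> n k z))"
    using assms(1) unfolding interp_space_def by blast
  have "(\<lambda>z. a * f z) = (\<lambda>z. a * P z + (\<Sum>k<n. (a * c k) * Q2 \<alpha> \<beta> n k z))"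
    by (simp add: f fun_eq_iff distrib_left sum_distrib_left mult.assoc)
  then show ?thesis by (rule interp_spaceI[OF bipoly_cmult[OF f(1)]])
qed

lemma bipoly_in_interp_space:
  assumes "P \<in> bipoly_space (2 * n - 1)"
  shows "P \<in> interp_space \<alpha> \<beta> n"
  by (rule interp_spaceI[OF assms, of _ "\<lambda>k. 0"]) simp

lemma interp_space_sum:
  assumes "\<And>i. i \<in> I \<Longrightarrow> f i \<in> interp_space \<alpha> \<beta> n"
  shows "(\<lambda>z. \<Sum>i\<in>I. f i z) \<in> interp_space \<alpha> \<beta> n"
  using assms by (induction I rule: infinite_finite_induct) (auto intro: bipoly_in_interp_space bipoly_zero interp_space_add)

lemma Q2_in_interp_space:
  assumes "l < n"
  shows "Q2 \<alpha> \<beta> n l \<in> interp_space \<alpha> \<beta> n"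
proof -
  have "Q2 \<alpha> \<beta> n l = (\<lambda>z. 0 + (\<Sum>k<n. (if k = l then 1 else 0) * Q2 \<alpha> \<beta> n k z))"
    using assms by (simp add: fun_eq_iff if_distrib[of "\<lambda>x. x * _"] cong: if_cong)
  then show ?thesis by (rule interp_spaceI[OF bipoly_zero])
qed

context
  fixes \<alpha> \<beta> :: real and k :: nat
  assumes ab: "\<alpha> > -1" "\<beta> > -1"
begin

lemma shifted_parameters: "\<alpha> + 1 > -1" "\<beta> + 1 > -1" using ab by auto

lemma sym_jacobi_bipoly:
  assumes "i \<le> m" "j \<le> m"
  shows "\<exists>A\<in>bipoly_space m. \<forall>u v. A (uv_image u v) = sym_jacobi (\<alpha> + 1) (\<beta> + 1) i j u v"
  unfolding sym_jacobi_def using assms degree_jacobi[OF shifted_parameters]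
  by (intro symmetrized_product_bipoly) auto

text \<open>Otherwise, by comparing odd-odd parts, \<open>A\<close> would agree with a polynomial of total degree \<open>k\<close>. On the
  line where \<open>v\<close> is fixed and not a zero of the \<open>l\<close>-th Jacobi polynomial, however, \<open>A\<close> has degree
  exactly \<open>k + 1\<close> in \<open>u\<close>. This is what makes the polynomials of degree \<open>2 n\<close> meet their defining
  condition, so that the choice operator picks one with the required form.\<close>

lemma antisym_notin_bipoly:
  assumes A: "A \<in> bipoly_space (k + 1)" and l: "l \<le> k + 1"
    and sym: "\<And>u v. A (uv_image u v) = sym_jacobi (\<alpha> + 1) (\<beta> + 1) (k + 1) l u v"
  shows "antisym A \<notin> bipoly_space (2 * k + 3)"
proof
  let ?p = "jacobi (\<alpha> + 1) (\<beta> + 1)"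
  assume "antisym A \<in> bipoly_space (2 * k + 3)"
  from bipoly_parity_decomposition[OF this] obtain A0 B C E where E: "E \<in> bipoly_space k"
    and dec: "antisym A = parity_form A0 B C E"
    by blast
  have AE: "A (S, D) = E (S, D)" if "S > 0" "D > 0" for S D
  proof -
    define s d where "s = sqrt S" and "d = sqrt D"
    have sd: "s\<^sup>2 = S" "d\<^sup>2 = D" "s * d \<noteq> 0" using that by (auto simp: s_def d_def)
    have val: "s' * d' * A (S, D) = A0 (S, D) + s' * B (S, D) + d' * C (S, D) + s' * d' * E (S, D)"
      if "s'\<^sup>2 = S" "d'\<^sup>2 = D" for s' d'
      using fun_cong[OF dec, of "sd_point s' d'"] unfolding antisym_sd_point[OF that] parity_form_sd_point[OF that] .
    \<comment> \<open>The alternating sum over the four signs isolates the odd-odd part.\<close>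
    have "4 * (s * d) * A (S, D) = 4 * (s * d) * E (S, D)"
    proof -
      have v: "s * d * A (S, D) = A0 (S, D) + s * B (S, D) + d * C (S, D) + s * d * E (S, D)"
        "- s * d * A (S, D) = A0 (S, D) + - s * B (S, D) + d * C (S, D) + - s * d * E (S, D)"
        "s * - d * A (S, D) = A0 (S, D) + s * B (S, D) + - d * C (S, D) + s * - d * E (S, D)"
        "- s * - d * A (S, D) = A0 (S, D) + - s * B (S, D) + - d * C (S, D) + - s * - d * E (S, D)"
        by (rule val; use sd in simp)+
      show ?thesis using v by algebra
    qed
    then show ?thesis using sd by simp
  qed
  have "\<exists>v. -1 < v \<and> v < 1 \<and> poly (?p l) v \<noteq> 0"
  proof (rule ccontr)
    assume "\<not> ?thesis"
    then have "?p l = 0" by (intro poly_eq_on_interval[of "-1" 1]) auto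
    then show False using jacobi_nonzero[OF shifted_parameters] by blast
  qed
  then obtain v where v: "-1 < v" "v < 1" "poly (?p l) v \<noteq> 0" by blast
  obtain r where r: "degree r \<le> k" "\<And>t. E ((1 + v) + (1 + v) * t, (1 - v) + (- (1 - v)) * t) = poly r t"
    using bipoly_line[OF E] by metis
  define q where "q = smult (poly (?p l) v) (?p (k + 1)) + smult (poly (?p (k + 1)) v) (?p l)"
  have "q = r"
  proof (rule poly_eq_on_interval[of "-1" 1])
    fix t :: real assume t: "-1 < t" "t < 1"
    have "poly q t = A (uv_image t v)" by (simp add: q_def sym sym_jacobi_def mult_ac)
    also have "\<dots> = E (uv_image t v)" unfolding uv_image_def using t v by (intro AE) auto
    also have "uv_image t v = ((1 + v) + (1 + v) * t, (1 - v) + (- (1 - v)) * t)"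
      by (simp add: uv_image_def algebra_simps)
    finally show "poly q t = poly r t" unfolding r(2) .
  qed simp
  then have "coeff q (k + 1) = 0" using r(1) by (intro coeff_eq_0) auto
  moreover have lc: "coeff (?p (k + 1)) (k + 1) \<noteq> 0"
    using jacobi_nonzero[OF shifted_parameters, of "k + 1"] degree_jacobi[OF shifted_parameters, of "k + 1"] by (metis leading_coeff_0_iff)
  moreover have "coeff q (k + 1) = (if l = k + 1 then 2 * poly (?p l) v * coeff (?p (k + 1)) (k + 1)
      else poly (?p l) v * coeff (?p (k + 1)) (k + 1))"
  proof (cases "l = k + 1")
    case False
    then have "coeff (?p l) (k + 1) = 0" using l degree_jacobi[OF shifted_parameters, of l] by (intro coeff_eq_0) auto
    then show ?thesis using False by (simp add: q_def)
  next
    case True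
    then have "coeff q (k + 1) = poly (?p l) v * coeff (?p (k + 1)) (k + 1) + poly (?p l) v * coeff (?p (k + 1)) (k + 1)"
      unfolding q_def coeff_add coeff_smult by (simp only:)
    then show ?thesis using True by (simp only: simp_thms if_True mult_2 distrib_right)
  qed
  ultimately show False using v(3) by (auto split: if_splits)
qed

lemma Q2_condition_antisym:
  assumes A: "A \<in> bipoly_space (k + 1)" and l: "l \<le> k + 1"
    and sym: "\<And>u v. A (uv_image u v) = sym_jacobi (\<alpha> + 1) (\<beta> + 1) (k + 1) l u v"
  shows "Q2_condition \<alpha> \<beta> (k + 2) l (antisym A)"
  unfolding Q2_condition_def
proof (intro conjI)
  show "antisym A \<in> bipoly_space (2 * (k + 2))" using antisym_in_bipoly[OF A] by simp
  show "antisym A \<notin> bipoly_space (2 * (k + 2) - 1)"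
    using antisym_notin_bipoly[OF A l sym] by (simp add: numeral_3_eq_3)
  show "\<exists>C. C \<noteq> 0 \<and> (\<forall>\<theta> \<phi>. antisym A (cos \<theta>, cos \<phi>) =
        C * (((cos \<theta>)\<^sup>2 - (cos \<phi>)\<^sup>2) *
          (poly (jacobi (\<alpha> + 1) (\<beta> + 1) (k + 2 - 1)) (cos (\<theta> - \<phi>)) *
             poly (jacobi (\<alpha> + 1) (\<beta> + 1) l) (cos (\<theta> + \<phi>)) +
           poly (jacobi (\<alpha> + 1) (\<beta> + 1) l) (cos (\<theta> - \<phi>)) *
             poly (jacobi (\<alpha> + 1) (\<beta> + 1) (k + 2 - 1)) (cos (\<theta> + \<phi>)))))"
    by (intro exI[of _ 1]) (simp add: antisym_def sq_image_cos sym sym_jacobi_def)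
qed

lemma Q2_antisym:
  assumes l: "l \<le> k + 1"
  shows "\<exists>A\<in>bipoly_space (k + 1). \<exists>C. C \<noteq> 0 \<and> (\<forall>u v. A (uv_image u v) = sym_jacobi (\<alpha> + 1) (\<beta> + 1) (k + 1) l u v)
     \<and> Q2 \<alpha> \<beta> (k + 2) l = (\<lambda>z. C * antisym A z)"
proof -
  obtain A where A: "A \<in> bipoly_space (k + 1)"
    "\<And>u v. A (uv_image u v) = sym_jacobi (\<alpha> + 1) (\<beta> + 1) (k + 1) l u v"
    using sym_jacobi_bipoly[of "k + 1" "k + 1" l] l by auto
  let ?q = "Q2 \<alpha> \<beta> (k + 2) l"
  have "Q2_condition \<alpha> \<beta> (k + 2) l ?q"
    unfolding Q2_def by (rule someI[where P = "Q2_condition \<alpha> \<beta> (k + 2) l", OF Q2_condition_antisym[OF A(1) l A(2)]])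
  then obtain C where q: "?q \<in> bipoly_space (2 * (k + 2))" and C: "C \<noteq> 0"
    and eq: "\<And>\<theta> \<phi>. ?q (cos \<theta>, cos \<phi>) = C * (((cos \<theta>)\<^sup>2 - (cos \<phi>)\<^sup>2) *
          (poly (jacobi (\<alpha> + 1) (\<beta> + 1) (k + 2 - 1)) (cos (\<theta> - \<phi>)) *
             poly (jacobi (\<alpha> + 1) (\<beta> + 1) l) (cos (\<theta> + \<phi>)) +
           poly (jacobi (\<alpha> + 1) (\<beta> + 1) l) (cos (\<theta> - \<phi>)) *
             poly (jacobi (\<alpha> + 1) (\<beta> + 1) (k + 2 - 1)) (cos (\<theta> + \<phi>))))"
    unfolding Q2_condition_def by blast
  have "?q = (\<lambda>z. C * antisym A z)"
  proof (rule bipoly_eq_on_square[OF q])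
    show "(\<lambda>z. C * antisym A z) \<in> bipoly_space (2 * (k + 2))"
      using bipoly_cmult[OF antisym_in_bipoly[OF A(1)]] by simp
    fix z assume "z \<in> square"
    then obtain \<theta> \<phi> where z: "z = (cos \<theta>, cos \<phi>)" by (rule square_cosE)
    show "?q z = C * antisym A z"
      unfolding z eq by (simp add: antisym_def sq_image_cos A sym_jacobi_def)
  qed
  then show ?thesis using A C by (intro bexI[of _ A] exI[of _ C]) auto
qed

text \<open>If one index is \<open>n - 1 = k + 1\<close>, this is a multiple of an additional polynomial of the space;
  otherwise the total degree is at most \<open>2 n - 2\<close>.\<close>

lemma antisym_sym_jacobi_in_interp_space:
  assumes "i \<le> k + 1" "j \<le> k + 1"
  shows "\<exists>G\<in>bipoly_space (k + 1). (\<forall>u v. G (uv_image u v) = sym_jacobi (\<alpha> + 1) (\<beta> + 1) i j u v)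
     \<and> antisym G \<in> interp_space \<alpha> \<beta> (k + 2)"
proof -
  have top: "\<exists>G\<in>bipoly_space (k + 1). (\<forall>u v. G (uv_image u v) = sym_jacobi (\<alpha> + 1) (\<beta> + 1) (k + 1) l u v)
     \<and> antisym G \<in> interp_space \<alpha> \<beta> (k + 2)" if l: "l \<le> k + 1" for l
  proof -
    obtain G C where G: "G \<in> bipoly_space (k + 1)" "C \<noteq> 0"
      "\<And>u v. G (uv_image u v) = sym_jacobi (\<alpha> + 1) (\<beta> + 1) (k + 1) l u v"
      "Q2 \<alpha> \<beta> (k + 2) l = (\<lambda>z. C * antisym G z)" using Q2_antisym[OF l] by blast
    have "antisym G = (\<lambda>z. 1 / C * Q2 \<alpha> \<beta> (k + 2) l z)" using G by (simp add: fun_eq_iff)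
    also have "\<dots> \<in> interp_space \<alpha> \<beta> (k + 2)"
      using l by (intro interp_space_cmult Q2_in_interp_space) auto
    finally show ?thesis using G by blast
  qed
  have comm: "sym_jacobi a b i j u v = sym_jacobi a b j i u v" for a b i j u v
    by (simp add: sym_jacobi_def)
  consider "i = k + 1" | "j = k + 1" | "i \<le> k" "j \<le> k" using assms by linarith
  then show ?thesis
  proof cases
    case 1
    then show ?thesis using top[OF assms(2)] by simp
  next
    case 2
    then show ?thesis using top[OF assms(1)] by (simp add: comm[of _ _ i])
  next
    case 3
    then obtain G where G: "G \<in> bipoly_space k" "\<And>u v. G (uv_image u v) = sym_jacobi (\<alpha> + 1) (\<beta> + 1) i j u v"
      using sym_jacobi_bipoly[of i k j] by blast
    have "antisym G \<in> bipoly_space (2 * (k + 2) - 1)"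
      by (rule bipoly_mono[OF antisym_in_bipoly[OF G(1)]]) simp
    then have "antisym G \<in> interp_space \<alpha> \<beta> (k + 2)" by (rule bipoly_in_interp_space)
    then show ?thesis using G bipoly_mono[OF G(1), of "k + 1"] by (intro bexI[of _ G]) auto
  qed
qed

text \<open>A monomial in the two squares has the form \<open>h u \<cdot> h v\<close> with \<open>h\<close> of degree at most \<open>n - 1\<close>. Expanding \<open>h\<close>
  in Jacobi polynomials reduces it to the symmetrized products of the previous lemma.\<close>

lemma antisym_in_interp_space:
  assumes "A \<in> bipoly_space (k + 1)"
  shows "antisym A \<in> interp_space \<alpha> \<beta> (k + 2)"
  using assms
proof (induction rule: bipoly_induct)
  case (cmult a f)
  have "antisym (\<lambda>z. a * f z) = (\<lambda>z. a * antisym f z)" by (simp add: antisym_def fun_eq_iff)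
  then show ?case using interp_space_cmult[OF cmult.IH] by simp
next
  case (add f g)
  have "antisym (\<lambda>z. f z + g z) = (\<lambda>z. antisym f z + antisym g z)" by (simp add: antisym_def fun_eq_iff distrib_left)
  then show ?case using interp_space_add[OF add.IH] by simp
next
  case (monomial i j)
  let ?p = "jacobi (\<alpha> + 1) (\<beta> + 1)"
  define h where "h = [:1, 1:] ^ i * [:1, - 1 :: real:] ^ j"
  have "degree h \<le> degree ([:1, 1:] ^ i :: real poly) + degree ([:1, - 1 :: real:] ^ j)"
    unfolding h_def by (rule degree_mult_le)
  also have "\<dots> \<le> degree [:1, 1::real:] * i + degree [:1, - 1 :: real:] * j"
    by (intro add_mono degree_power_le)
  finally have "degree h < k + 2" using monomial by simp
  then obtain c where c: "h = (\<Sum>m<k + 2. smult (c m) (?p m))"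
    using poly_in_span_of_graded_system[of ?p h "k + 2"] degree_jacobi[OF shifted_parameters] jacobi_nonzero[OF shifted_parameters] by blast
  have ph: "poly h u = (\<Sum>m<k + 2. c m * poly (?p m) u)" for u by (subst c) (simp add: poly_sum)
  have "\<forall>a b. \<exists>G. a < k + 2 \<longrightarrow> b < k + 2 \<longrightarrow> G \<in> bipoly_space (k + 1) \<and>
      (\<forall>u v. G (uv_image u v) = sym_jacobi (\<alpha> + 1) (\<beta> + 1) a b u v) \<and> antisym G \<in> interp_space \<alpha> \<beta> (k + 2)"
    using antisym_sym_jacobi_in_interp_space by (metis Suc_eq_plus1 add_2_eq_Suc' less_Suc_eq_le)
  then obtain G where G: "\<And>a b. a < k + 2 \<Longrightarrow> b < k + 2 \<Longrightarrow> G a b \<in> bipoly_space (k + 1)"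
    "\<And>a b u v. a < k + 2 \<Longrightarrow> b < k + 2 \<Longrightarrow> G a b (uv_image u v) = sym_jacobi (\<alpha> + 1) (\<beta> + 1) a b u v"
    "\<And>a b. a < k + 2 \<Longrightarrow> b < k + 2 \<Longrightarrow> antisym (G a b) \<in> interp_space \<alpha> \<beta> (k + 2)"
    by metis
  define H where "H z = (\<Sum>a<k + 2. \<Sum>b<k + 2. (c a * c b / 2) * G a b z)" for z
  have H: "H \<in> bipoly_space (k + 1)"
    unfolding H_def[abs_def] by (intro bipoly_sum bipoly_cmult G) auto
  have "H (uv_image u v) = fst (uv_image u v) ^ i * snd (uv_image u v) ^ j" for u v
  proof -
    have "H (uv_image u v) = (\<Sum>a<k + 2. \<Sum>b<k + 2. (c a * poly (?p a) u) * (c b * poly (?p b) v) / 2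
        + (c a * poly (?p a) v) * (c b * poly (?p b) u) / 2)"
      unfolding H_def by (intro sum.cong refl) (simp add: G sym_jacobi_def field_simps)
    also have "\<dots> = poly h u * poly h v"
    proof -
      have "(\<Sum>a<N. \<Sum>b<N. F a * K b / 2 + K a * F b / 2) = (\<Sum>a<N. F a) * (\<Sum>b<N. K b)"
        for F K :: "nat \<Rightarrow> real" and N :: nat
      proof -
        have "(\<Sum>a<N. \<Sum>b<N. F a * K b / 2 + K a * F b / 2)
            = (\<Sum>a<N. \<Sum>b<N. F a * K b) / 2 + (\<Sum>a<N. \<Sum>b<N. K a * F b) / 2"
          by (simp add: sum.distrib sum_divide_distrib)
        also have "\<dots> = (\<Sum>a<N. F a) * (\<Sum>b<N. K b) / 2 + (\<Sum>a<N. K a) * (\<Sum>b<N. F b) / 2"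
          by (simp only: sum_product)
        finally show ?thesis by (simp add: mult.commute)
      qed
      then show ?thesis unfolding ph .
    qed
    finally show ?thesis by (simp add: h_def uv_image_def power_mult_distrib)
  qed
  then have "antisym (\<lambda>z. fst z ^ i * snd z ^ j) = antisym H"
    using antisym_eqI[OF bipoly_monomial[OF monomial] H] by simp
  also have "antisym H = (\<lambda>z. \<Sum>a<k + 2. \<Sum>b<k + 2. (c a * c b / 2) * antisym (G a b) z)"
    unfolding fun_eq_iff antisym_def H_def sum_distrib_left
    by (intro allI sum.cong refl) (simp only: mult_ac)
  also have "\<dots> \<in> interp_space \<alpha> \<beta> (k + 2)"
    by (intro interp_space_sum interp_space_cmult G) auto
  finally show ?case .
qed

lemma interp_space_iff:
  "F \<in> interp_space \<alpha> \<beta> (k + 2) \<longleftrightarrow>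
    (\<exists>A B C E. A \<in> bipoly_space (k + 1) \<and> B \<in> bipoly_space (k + 1) \<and> C \<in> bipoly_space (k + 1) \<and> E \<in> bipoly_space (k + 1) \<and>
      F = parity_form A B C E)"
proof
  assume "F \<in> interp_space \<alpha> \<beta> (k + 2)"
  then obtain P c where P: "P \<in> bipoly_space (2 * (k + 2) - 1)"
    and F: "F = (\<lambda>z. P z + (\<Sum>l<k + 2. c l * Q2 \<alpha> \<beta> (k + 2) l z))"
    unfolding interp_space_def by blast
  have "2 * (k + 2) - 1 = 2 * k + 3" by simp
  with P have "P \<in> bipoly_space (2 * k + 3)" by metis
  from bipoly_parity_decomposition[OF this]
  obtain A B C E where dec: "A \<in> bipoly_space (k + 1)" "B \<in> bipoly_space (k + 1)" "C \<in> bipoly_space (k + 1)" "E \<in> bipoly_space k"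
    "P = parity_form A B C E" by blast
  have "\<forall>l. \<exists>G C. l < k + 2 \<longrightarrow> G \<in> bipoly_space (k + 1) \<and> Q2 \<alpha> \<beta> (k + 2) l = (\<lambda>z. C * antisym G z)"
    using Q2_antisym by (metis Suc_eq_plus1 add_2_eq_Suc' less_Suc_eq_le)
  then obtain G C' where G: "\<And>l. l < k + 2 \<Longrightarrow> G l \<in> bipoly_space (k + 1)"
    "\<And>l. l < k + 2 \<Longrightarrow> Q2 \<alpha> \<beta> (k + 2) l = (\<lambda>z. C' l * antisym (G l) z)" by metis
  define E' where "E' z = E z + (\<Sum>l<k + 2. (c l * C' l) * G l z)" for z
  have "E' \<in> bipoly_space (k + 1)"
    unfolding E'_def[abs_def] by (intro bipoly_add bipoly_sum bipoly_cmult G bipoly_mono[OF dec(4)]) auto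
  moreover have "F = parity_form A B C E'"
  proof
    fix z :: "real \<times> real"
    have "(\<Sum>l<k + 2. c l * Q2 \<alpha> \<beta> (k + 2) l z) = ((fst z)\<^sup>2 - (snd z)\<^sup>2) * (\<Sum>l<k + 2. (c l * C' l) * G l (sq_image z))"
      unfolding sum_distrib_left
    proof (intro sum.cong refl)
      fix l assume "l \<in> {..<k + 2}"
      then have "l < k + 2" by simp
      from G(2)[OF this] show "c l * Q2 \<alpha> \<beta> (k + 2) l z = ((fst z)\<^sup>2 - (snd z)\<^sup>2) * (c l * C' l * G l (sq_image z))"
        by (simp only: antisym_def mult_ac)
    qed
    then show "F z = parity_form A B C E' z"
      by (simp add: F dec(5) parity_form_def antisym_def E'_def distrib_left)
  qed
  ultimately show "\<exists>A B C E. A \<in> bipoly_space (k + 1) \<and> B \<in> bipoly_space (k + 1) \<and> C \<in> bipoly_space (k + 1) \<and> E \<in> bipoly_space (k + 1) \<and>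
      F = parity_form A B C E"
    using dec by blast
next
  assume "\<exists>A B C E. A \<in> bipoly_space (k + 1) \<and> B \<in> bipoly_space (k + 1) \<and> C \<in> bipoly_space (k + 1) \<and> E \<in> bipoly_space (k + 1) \<and>
      F = parity_form A B C E"
  then obtain A B C E where dec: "A \<in> bipoly_space (k + 1)" "B \<in> bipoly_space (k + 1)" "C \<in> bipoly_space (k + 1)" "E \<in> bipoly_space (k + 1)"
    and F: "F = parity_form A B C E"
    by blast
  show "F \<in> interp_space \<alpha> \<beta> (k + 2)"
    unfolding F parity_form_def[abs_def]
    by (intro interp_space_add bipoly_in_interp_space antisym_in_interp_space dec
        bipoly_mono[OF bipoly_sq_image[OF dec(1)]]
        bipoly_mono[OF bipoly_mult[OF bipoly_add[OF bipoly_fst bipoly_snd] bipoly_sq_image[OF dec(2)]]]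
        bipoly_mono[OF bipoly_mult[OF bipoly_diff[OF bipoly_fst bipoly_snd] bipoly_sq_image[OF dec(3)]]]) auto
qed

end

section \<open>The interpolant and its norm\<close>

definition sum_coord :: "real \<Rightarrow> real \<Rightarrow> real" where
  "sum_coord u v = sqrt ((1 + u) * (1 + v))"
definition diff_coord :: "real \<Rightarrow> real \<Rightarrow> real" where
  "diff_coord u v = sqrt ((1 - u) * (1 - v))"
lemma sum_coord_commute: "sum_coord u v = sum_coord v u"
  and diff_coord_commute: "diff_coord u v = diff_coord v u"
  by (simp_all add: sum_coord_def diff_coord_def mult.commute)

lemma coords_cos:
  assumes "0 < a" "a < pi" "0 < b" "b < pi"
  shows "sum_coord (cos a) (cos b) = 2 * cos (a / 2) * cos (b / 2)"
    "diff_coord (cos a) (cos b) = 2 * sin (a / 2) * sin (b / 2)"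
proof -
  have pos: "cos (a / 2) > 0" "cos (b / 2) > 0" "sin (a / 2) > 0" "sin (b / 2) > 0"
    using assms by (auto intro!: cos_gt_zero sin_gt_zero)
  have c: "1 + cos x = 2 * (cos (x / 2))\<^sup>2" "1 - cos x = 2 * (sin (x / 2))\<^sup>2" for x :: real
    using cos_double_cos[of "x / 2"] cos_double_sin[of "x / 2"] by simp_all
  have "sum_coord (cos a) (cos b) = sqrt ((2 * cos (a / 2) * cos (b / 2))\<^sup>2)"
    unfolding sum_coord_def c by (simp add: power2_eq_square mult_ac)
  then show "sum_coord (cos a) (cos b) = 2 * cos (a / 2) * cos (b / 2)" using pos by simp
  have "diff_coord (cos a) (cos b) = sqrt ((2 * sin (a / 2) * sin (b / 2))\<^sup>2)"
    unfolding diff_coord_def c by (simp add: power2_eq_square mult_ac)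
  then show "diff_coord (cos a) (cos b) = 2 * sin (a / 2) * sin (b / 2)" using pos by simp
qed

lemma node_points:
  assumes "0 < a" "a < pi" "0 < b" "b < pi"
  shows "sd_point (sum_coord (cos a) (cos b)) (diff_coord (cos a) (cos b)) = (cos ((a - b) / 2), cos ((a + b) / 2))"
  using coords_cos[OF assms] by (simp add: sd_point_def diff_divide_distrib add_divide_distrib cos_diff cos_add)

definition sign_nodes :: "real \<Rightarrow> real \<Rightarrow> (real \<times> real) set" where
  "sign_nodes u v = (\<lambda>(e, f). sd_point (e * sum_coord u v) (f * diff_coord u v)) ` ({1, -1} \<times> {1, -1})"

lemma sign_nodes_commute: "sign_nodes u v = sign_nodes v u"
  by (simp add: sign_nodes_def sum_coord_commute diff_coord_commute)

text \<open>The four points attached to a pair of angles are those with the four sign choices of \<open>s\<close> and \<open>d\<close>.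
  They do not depend on the order of the pair, so the restriction \<open>j \<le> k\<close> disappears.\<close>

lemma cubature_nodes_eq:
  fixes n :: nat
  assumes ab: "\<alpha> > -1" "\<beta> > -1"
  defines "X \<equiv> {x. -1 < x \<and> x < 1 \<and> poly (jacobi \<alpha> \<beta> n) x = 0}"
  shows "cubature_nodes \<alpha> \<beta> n = (\<Union>u\<in>X. \<Union>v\<in>X. sign_nodes u v)"
proof -
  define \<Theta> where "\<Theta> = {\<theta>. 0 < \<theta> \<and> \<theta> < pi \<and> poly (jacobi \<alpha> \<beta> n) (cos \<theta>) = 0}"
  have bij: "bij_betw cos \<Theta> X"
    unfolding bij_betw_def
  proof
    show "inj_on cos \<Theta>" by (rule inj_onI, rule cos_inj_pi) (auto simp: \<Theta>_def)
    show "cos ` \<Theta> = X"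
    proof (intro set_eqI iffI)
      fix x assume "x \<in> cos ` \<Theta>"
      then obtain \<theta> where th: "\<theta> \<in> \<Theta>" "x = cos \<theta>" by blast
      then have "cos \<theta> < cos 0" "cos pi < cos \<theta>"
        unfolding \<Theta>_def by (auto intro!: cos_monotone_0_pi simp del: cos_zero cos_pi)
      then show "x \<in> X" using th by (auto simp: X_def \<Theta>_def)
    next
      fix x assume x: "x \<in> X"
      then have "arccos x \<in> \<Theta>" unfolding X_def \<Theta>_def
        using arccos_lt_bounded[of x] by (auto simp: cos_arccos)
      then show "x \<in> cos ` \<Theta>" using x by (intro image_eqI[of _ _ "arccos x"]) (auto simp: X_def cos_arccos)
    qed
  qed
  have card: "card \<Theta> = n" using bij_betw_same_card[OF bij] card_jacobi_zeros[OF ab, of n] by (simp add: X_def)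
  have fin: "finite \<Theta>"
  proof -
    have "finite X" unfolding X_def using poly_roots_finite[OF jacobi_nonzero[OF ab]] by (rule rev_finite_subset) auto
    then show ?thesis using bij_betw_finite[OF bij] by simp
  qed
  define xs where "xs = sorted_list_of_set \<Theta>"
  have xs: "set xs = \<Theta>" "length xs = n" using fin card by (auto simp: xs_def)
  have angle: "jacobi_angle \<alpha> \<beta> n k = xs ! (k - 1)" for k
    by (simp add: jacobi_angle_def xs_def \<Theta>_def)
  have angle_mem: "jacobi_angle \<alpha> \<beta> n k \<in> \<Theta>" if "k \<in> {1..n}" for k
  proof -
    have "k - 1 < length xs" using that xs by auto
    then show ?thesis unfolding angle xs(1)[symmetric] by (rule nth_mem)
  qed
  have angle_ex: "\<exists>k\<in>{1..n}. a = jacobi_angle \<alpha> \<beta> n k" if a: "a \<in> \<Theta>" for a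
  proof -
    obtain i where i: "i < n" "xs ! i = a" using a xs by (metis in_set_conv_nth)
    then show ?thesis by (intro bexI[of _ "Suc i"]) (auto simp: angle)
  qed
  let ?N = "\<lambda>j k. {( node_s \<alpha> \<beta> n j k,  node_t \<alpha> \<beta> n j k),
         ( node_t \<alpha> \<beta> n j k,  node_s \<alpha> \<beta> n j k),
         (-node_s \<alpha> \<beta> n j k, -node_t \<alpha> \<beta> n j k),
         (-node_t \<alpha> \<beta> n j k, -node_s \<alpha> \<beta> n j k)}"
  have N: "?N j k = sign_nodes (cos (jacobi_angle \<alpha> \<beta> n j)) (cos (jacobi_angle \<alpha> \<beta> n k))"
    if "j \<in> {1..n}" "k \<in> {1..n}" for j k
  proof -
    let ?a = "jacobi_angle \<alpha> \<beta> n j" and ?b = "jacobi_angle \<alpha> \<beta> n k"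
    have ab: "0 < ?a" "?a < pi" "0 < ?b" "?b < pi" using angle_mem that by (auto simp: \<Theta>_def)
    have p: "node_s \<alpha> \<beta> n j k = (sum_coord (cos ?a) (cos ?b) + diff_coord (cos ?a) (cos ?b)) / 2"
      "node_t \<alpha> \<beta> n j k = (sum_coord (cos ?a) (cos ?b) - diff_coord (cos ?a) (cos ?b)) / 2"
      using node_points[OF ab] by (auto simp: sd_point_def node_s_def node_t_def)
    have "?N j k = {sd_point (1 * sum_coord (cos ?a) (cos ?b)) (1 * diff_coord (cos ?a) (cos ?b)),
       sd_point (1 * sum_coord (cos ?a) (cos ?b)) (-1 * diff_coord (cos ?a) (cos ?b)),
       sd_point (-1 * sum_coord (cos ?a) (cos ?b)) (-1 * diff_coord (cos ?a) (cos ?b)),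
       sd_point (-1 * sum_coord (cos ?a) (cos ?b)) (1 * diff_coord (cos ?a) (cos ?b))}"
    proof -
      have "sd_point (1 * s) (1 * d) = ((s + d) / 2, (s - d) / 2)" "sd_point (1 * s) (-1 * d) = ((s - d) / 2, (s + d) / 2)"
        "sd_point (-1 * s) (-1 * d) = (- ((s + d) / 2), - ((s - d) / 2))" "sd_point (-1 * s) (1 * d) = (- ((s - d) / 2), - ((s + d) / 2))" for s d
        by (simp_all add: sd_point_def minus_divide_left)
      then show ?thesis unfolding p by (simp only:)
    qed
    also have "\<dots> = sign_nodes (cos ?a) (cos ?b)" unfolding sign_nodes_def by auto
    finally show ?thesis .
  qed
  show ?thesis
  proof (intro set_eqI iffI)
    fix z assume "z \<in> cubature_nodes \<alpha> \<beta> n"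
    then obtain j k where jk: "k \<in> {1..n}" "j \<in> {1..k}" "z \<in> ?N j k" unfolding cubature_nodes_def by blast
    then have j: "j \<in> {1..n}" by auto
    have "z \<in> sign_nodes (cos (jacobi_angle \<alpha> \<beta> n j)) (cos (jacobi_angle \<alpha> \<beta> n k))"
      using jk(3) unfolding N[OF j jk(1)] .
    moreover have "cos (jacobi_angle \<alpha> \<beta> n i) \<in> X" if "i \<in> {1..n}" for i
      using bij angle_mem[OF that] by (auto simp: bij_betw_def)
    ultimately show "z \<in> (\<Union>u\<in>X. \<Union>v\<in>X. sign_nodes u v)" using j jk(1) by blast
  next
    fix z assume "z \<in> (\<Union>u\<in>X. \<Union>v\<in>X. sign_nodes u v)"
    then obtain u v where uv: "u \<in> X" "v \<in> X" "z \<in> sign_nodes u v" by blast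
    have ex: "\<exists>k\<in>{1..n}. w = cos (jacobi_angle \<alpha> \<beta> n k)" if "w \<in> X" for w
      using that bij angle_ex unfolding bij_betw_def by blast
    obtain i where i: "i \<in> {1..n}" "u = cos (jacobi_angle \<alpha> \<beta> n i)" using ex[OF uv(1)] by blast
    obtain j where j: "j \<in> {1..n}" "v = cos (jacobi_angle \<alpha> \<beta> n j)" using ex[OF uv(2)] by blast
    have "\<exists>k\<in>{1..n}. \<exists>j\<in>{1..k}. z \<in> ?N j k"
    proof (cases "i \<le> j")
      case True
      then have "z \<in> ?N i j" "i \<in> {1..j}" using uv(3) i j N[OF i(1) j(1)] by auto
      then show ?thesis using j(1) by blast
    next
      case False
      then have "z \<in> ?N j i" "j \<in> {1..i}" using uv(3) i j N[OF j(1) i(1)] by (auto simp: sign_nodes_commute)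
      then show ?thesis using i(1) by blast
    qed
    then show "z \<in> cubature_nodes \<alpha> \<beta> n" unfolding cubature_nodes_def by blast
  qed
qed

text \<open>By the inequality of the means, the sum of \<open>\<bar>s\<bar>\<close> and \<open>\<bar>d\<bar>\<close> is at most \<open>2\<close>.\<close>

lemma sd_point_square:
  assumes "-1 < u" "u < 1" "-1 < v" "v < 1" "\<bar>e\<bar> \<le> 1" "\<bar>f\<bar> \<le> 1"
  shows "sd_point (e * sum_coord u v) (f * diff_coord u v) \<in> square"
proof -
  have "sum_coord u v \<le> ((1 + u) + (1 + v)) / 2" "diff_coord u v \<le> ((1 - u) + (1 - v)) / 2"
    unfolding sum_coord_def diff_coord_def by (rule arith_geo_mean_sqrt; use assms in simp)+
  moreover have "sum_coord u v \<ge> 0" "diff_coord u v \<ge> 0"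
    unfolding sum_coord_def diff_coord_def using assms by auto
  moreover have "\<bar>e * sum_coord u v\<bar> \<le> 1 * \<bar>sum_coord u v\<bar>" "\<bar>f * diff_coord u v\<bar> \<le> 1 * \<bar>diff_coord u v\<bar>"
    unfolding abs_mult using assms by (intro mult_right_mono; simp)+
  ultimately show ?thesis
    unfolding sd_point_def square_def by (auto simp: abs_le_iff field_simps)
qed

lemma bipoly_zero_on_grid:
  assumes A: "A \<in> bipoly_space m" and X: "finite X" "m < card X"
    and z: "\<And>u v. u \<in> X \<Longrightarrow> v \<in> X \<Longrightarrow> A (uv_image u v) = 0"
  shows "A (uv_image u v) = 0"
proof -
  have step: "A (uv_image u v) = 0" if v: "\<And>w. w \<in> X \<Longrightarrow> A (uv_image w v) = 0" for u v
  proof -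
    obtain r where r: "degree r \<le> m" "\<And>t. A ((1 + v) + (1 + v) * t, (1 - v) + (- (1 - v)) * t) = poly r t"
      using bipoly_line[OF A] by metis
    have eq: "A (uv_image t v) = poly r t" for t
      unfolding r(2)[symmetric] by (simp add: uv_image_def algebra_simps)
    have "r = 0" using X r(1) v by (intro poly_zero_card_roots[of X]) (auto simp: eq)
    then show ?thesis by (simp add: eq)
  qed
  have "A (uv_image w u) = 0" if "w \<in> X" for u w
    using step[of w u] z that by (subst uv_image_commute) (auto intro: step)
  then show ?thesis by (rule step)
qed

definition lagrange_sum :: "real set \<Rightarrow> (real \<Rightarrow> real \<Rightarrow> real) \<Rightarrow> real \<Rightarrow> real \<Rightarrow> real" where
  "lagrange_sum X c a b = (\<Sum>u\<in>X. \<Sum>v\<in>X. c u v * poly (lagrange_poly X u) a * poly (lagrange_poly X v) b)"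

text \<open>Symmetric data make the tensor product interpolant a sum of symmetrized products.\<close>

lemma symmetric_interpolant_bipoly:
  assumes X: "finite X" "card X = m + 1" and c: "\<And>u v. c u v = c v u"
  shows "\<exists>A\<in>bipoly_space m. \<forall>a b. A (uv_image a b) = lagrange_sum X c a b"
proof -
  let ?l = "lagrange_poly X"
  have "\<forall>u v. \<exists>G. u \<in> X \<longrightarrow> v \<in> X \<longrightarrow> G \<in> bipoly_space m \<and>
     (\<forall>a b. G (uv_image a b) = poly (?l u) a * poly (?l v) b + poly (?l v) a * poly (?l u) b)"
    using symmetrized_product_bipoly degree_lagrange_poly[OF X(1)] X(2) by (metis add_diff_cancel_right')
  then obtain G where G: "\<And>u v. u \<in> X \<Longrightarrow> v \<in> X \<Longrightarrow> G u v \<in> bipoly_space m"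
    "\<And>u v a b. u \<in> X \<Longrightarrow> v \<in> X \<Longrightarrow> G u v (uv_image a b) = poly (?l u) a * poly (?l v) b + poly (?l v) a * poly (?l u) b"
    by metis
  define A where "A z = (\<Sum>u\<in>X. \<Sum>v\<in>X. (c u v / 2) * G u v z)" for z
  have "A \<in> bipoly_space m" unfolding A_def[abs_def] by (intro bipoly_sum bipoly_cmult G)
  moreover have "A (uv_image a b) = lagrange_sum X c a b" for a b
  proof -
    let ?S = "lagrange_sum X c a b"
    have "A (uv_image a b) = (\<Sum>u\<in>X. \<Sum>v\<in>X. c u v * poly (?l u) a * poly (?l v) b / 2 + c v u * poly (?l v) a * poly (?l u) b / 2)"
      unfolding A_def
    proof (intro sum.cong refl)
      fix u v assume uv: "u \<in> X" "v \<in> X"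
      show "c u v / 2 * G u v (uv_image a b) = c u v * poly (?l u) a * poly (?l v) b / 2 + c v u * poly (?l v) a * poly (?l u) b / 2"
        unfolding G(2)[OF uv] c[of v u] by (simp add: algebra_simps)
    qed
    also have "\<dots> = ?S / 2 + (\<Sum>u\<in>X. \<Sum>v\<in>X. c v u * poly (?l v) a * poly (?l u) b) / 2"
      by (simp add: lagrange_sum_def sum.distrib sum_divide_distrib)
    also have "(\<Sum>u\<in>X. \<Sum>v\<in>X. c v u * poly (?l v) a * poly (?l u) b) = ?S"
      unfolding lagrange_sum_def by (rule sum.swap)
    finally show ?thesis by simp
  qed
  ultimately show ?thesis by blast
qed

lemma lagrange_sum_node:
  assumes "finite X" "u' \<in> X" "v' \<in> X"
  shows "lagrange_sum X c u' v' = c u' v'"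
proof -
  have "lagrange_sum X c u' v' = (\<Sum>u\<in>X. \<Sum>v\<in>X. if v = v' then (if u = u' then c u v else 0) else 0)"
    unfolding lagrange_sum_def using assms by (intro sum.cong refl) (auto simp: lagrange_poly_node)
  then show ?thesis using assms by (simp add: sum.delta)
qed

text \<open>The powers of \<open>s\<close> and \<open>d\<close> at the point and at the node combine into the weights of both variables.\<close>

lemma lagrange_sum_bound:
  assumes X: "finite X" "\<And>x. x \<in> X \<Longrightarrow> -1 < x \<and> x < 1" and a: "-1 \<le> a" "a \<le> 1" and b: "-1 \<le> b" "b \<le> 1"
    and g: "\<And>u v. u \<in> X \<Longrightarrow> v \<in> X \<Longrightarrow> \<bar>g u v\<bar> \<le> 1"
    and c: "\<And>u v. u \<in> X \<Longrightarrow> v \<in> X \<Longrightarrow> c u v = g u v / (sum_coord u v ^ k * diff_coord u v ^ i)"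
  shows "\<bar>sum_coord a b ^ k * diff_coord a b ^ i * lagrange_sum X c a b\<bar>
     \<le> weighted_lebesgue X i k a * weighted_lebesgue X i k b"
proof -
  let ?l = "lagrange_poly X" and ?w = "weight_ratio i k"
  let ?S = "sum_coord a b ^ k * diff_coord a b ^ i"
  have "\<bar>?S * lagrange_sum X c a b\<bar> = \<bar>\<Sum>u\<in>X. \<Sum>v\<in>X. ?S * (c u v * poly (?l u) a * poly (?l v) b)\<bar>"
    by (simp only: lagrange_sum_def sum_distrib_left)
  also have "\<dots> \<le> (\<Sum>u\<in>X. \<Sum>v\<in>X. \<bar>?S * (c u v * poly (?l u) a * poly (?l v) b)\<bar>)"
    by (rule order.trans[OF sum_abs sum_mono]) (rule sum_abs)
  also have "\<dots> \<le> (\<Sum>u\<in>X. \<Sum>v\<in>X. (\<bar>poly (?l u) a\<bar> * ?w a u) * (\<bar>poly (?l v) b\<bar> * ?w b v))"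
  proof (intro sum_mono)
    fix u v assume uv: "u \<in> X" "v \<in> X"
    note pos = X(2)[OF uv(1)] X(2)[OF uv(2)]
    have w: "?w a u * ?w b v = ?S / (sum_coord u v ^ k * diff_coord u v ^ i)"
      unfolding weight_ratio_def sum_coord_def diff_coord_def
      by (simp add: real_sqrt_divide real_sqrt_mult power_mult_distrib power_divide mult_ac)
    have nn: "?w a u * ?w b v \<ge> 0" using pos a b unfolding weight_ratio_def by simp
    have eq: "?S * (c u v * poly (?l u) a * poly (?l v) b) = g u v * ((?w a u * ?w b v) * (poly (?l u) a * poly (?l v) b))"
      unfolding w c[OF uv] by simp
    have "\<bar>?S * (c u v * poly (?l u) a * poly (?l v) b)\<bar> = \<bar>g u v\<bar> * (\<bar>?w a u * ?w b v\<bar> * (\<bar>poly (?l u) a\<bar> * \<bar>poly (?l v) b\<bar>))"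
      unfolding eq by (simp only: abs_mult)
    also have "\<bar>?w a u * ?w b v\<bar> = ?w a u * ?w b v" using nn by (rule abs_of_nonneg)
    finally have "\<bar>?S * (c u v * poly (?l u) a * poly (?l v) b)\<bar> = \<bar>g u v\<bar> * ((?w a u * ?w b v) * (\<bar>poly (?l u) a\<bar> * \<bar>poly (?l v) b\<bar>))" .
    also have "\<dots> \<le> 1 * ((?w a u * ?w b v) * (\<bar>poly (?l u) a\<bar> * \<bar>poly (?l v) b\<bar>))"
      using g[OF uv] nn by (intro mult_right_mono) auto
    finally show "\<bar>?S * (c u v * poly (?l u) a * poly (?l v) b)\<bar> \<le> (\<bar>poly (?l u) a\<bar> * ?w a u) * (\<bar>poly (?l v) b\<bar> * ?w b v)"
      by (simp add: mult_ac)
  qed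
  also have "\<dots> = weighted_lebesgue X i k a * weighted_lebesgue X i k b"
    unfolding weighted_lebesgue_def sum_product ..
  finally show ?thesis .
qed

lemma interp_space_in_bipoly:
  assumes ab: "\<alpha> > -1" "\<beta> > -1" and F: "F \<in> interp_space \<alpha> \<beta> (k + 2)"
  shows "F \<in> bipoly_space (2 * (k + 2))"
proof -
  obtain A B C E where dec: "A \<in> bipoly_space (k + 1)" "B \<in> bipoly_space (k + 1)" "C \<in> bipoly_space (k + 1)" "E \<in> bipoly_space (k + 1)"
    and F: "F = parity_form A B C E"
    using F unfolding interp_space_iff[OF ab] by blast
  show ?thesis
    unfolding F parity_form_def[abs_def]
    by (intro bipoly_add bipoly_mono[OF antisym_in_bipoly[OF dec(4)]]
        bipoly_mono[OF bipoly_sq_image[OF dec(1)]]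
        bipoly_mono[OF bipoly_mult[OF bipoly_add[OF bipoly_fst bipoly_snd] bipoly_sq_image[OF dec(2)]]]
        bipoly_mono[OF bipoly_mult[OF bipoly_diff[OF bipoly_fst bipoly_snd] bipoly_sq_image[OF dec(3)]]]) auto
qed

text \<open>The four signs separate the four parity components at each pair of zeros, because \<open>s\<close> and \<open>d\<close> do not
  vanish there. Each component is then zero on a grid that is too large for its degree.\<close>

lemma interp_space_unisolvent:
  assumes ab: "\<alpha> > -1" "\<beta> > -1" and F: "F \<in> interp_space \<alpha> \<beta> (k + 2)"
    and z: "\<And>z. z \<in> cubature_nodes \<alpha> \<beta> (k + 2) \<Longrightarrow> F z = 0"
  shows "F = (\<lambda>z. 0)"
proof -
  define X where "X = {x. -1 < x \<and> x < 1 \<and> poly (jacobi \<alpha> \<beta> (k + 2)) x = 0}"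
  have X: "finite X" "card X = k + 2"
    using card_jacobi_zeros[OF ab, of "k + 2"] by (auto simp: X_def intro: card_ge_0_finite)
  obtain A B C E where dec: "A \<in> bipoly_space (k + 1)" "B \<in> bipoly_space (k + 1)" "C \<in> bipoly_space (k + 1)" "E \<in> bipoly_space (k + 1)"
    and Feq: "F = parity_form A B C E"
    using F unfolding interp_space_iff[OF ab] by blast
  have grid: "A (uv_image u v) = 0 \<and> B (uv_image u v) = 0 \<and> C (uv_image u v) = 0 \<and> E (uv_image u v) = 0"
    if uv: "u \<in> X" "v \<in> X" for u v
  proof -
    define s d where "s = sum_coord u v" and "d = diff_coord u v"
    have pos: "1 + u > 0" "1 + v > 0" "1 - u > 0" "1 - v > 0" using uv by (auto simp: X_def)
    have sd: "s > 0" "d > 0" "uv_image u v = (s\<^sup>2, d\<^sup>2)"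
      using pos by (auto simp: s_def d_def sum_coord_def diff_coord_def uv_image_def)
    have "A (s\<^sup>2, d\<^sup>2) + (e * s) * B (s\<^sup>2, d\<^sup>2) + (f * d) * C (s\<^sup>2, d\<^sup>2) + (e * s) * (f * d) * E (s\<^sup>2, d\<^sup>2) = 0"
      if "e \<in> {1, -1}" "f \<in> {1, -1}" for e f
    proof -
      have "sd_point (e * s) (f * d) \<in> sign_nodes u v" using that by (auto simp: sign_nodes_def s_def d_def)
      then have "F (sd_point (e * s) (f * d)) = 0"
        using z uv unfolding cubature_nodes_eq[OF ab] X_def by blast
      moreover have "(e * s)\<^sup>2 = s\<^sup>2" "(f * d)\<^sup>2 = d\<^sup>2" using that by auto
      ultimately show ?thesis unfolding Feq by (simp only: parity_form_sd_point)
    qed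
    from this[of 1 1] this[of 1 "-1"] this[of "-1" 1] this[of "-1" "-1"]
    have h: "A (s\<^sup>2, d\<^sup>2) + s * B (s\<^sup>2, d\<^sup>2) + d * C (s\<^sup>2, d\<^sup>2) + s * d * E (s\<^sup>2, d\<^sup>2) = 0"
      "A (s\<^sup>2, d\<^sup>2) + s * B (s\<^sup>2, d\<^sup>2) - d * C (s\<^sup>2, d\<^sup>2) - s * d * E (s\<^sup>2, d\<^sup>2) = 0"
      "A (s\<^sup>2, d\<^sup>2) - s * B (s\<^sup>2, d\<^sup>2) + d * C (s\<^sup>2, d\<^sup>2) - s * d * E (s\<^sup>2, d\<^sup>2) = 0"
      "A (s\<^sup>2, d\<^sup>2) - s * B (s\<^sup>2, d\<^sup>2) - d * C (s\<^sup>2, d\<^sup>2) + s * d * E (s\<^sup>2, d\<^sup>2) = 0"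
      by simp_all
    then have "A (s\<^sup>2, d\<^sup>2) = 0 \<and> s * B (s\<^sup>2, d\<^sup>2) = 0 \<and> d * C (s\<^sup>2, d\<^sup>2) = 0 \<and> s * d * E (s\<^sup>2, d\<^sup>2) = 0"
      by linarith
    then have "A (s\<^sup>2, d\<^sup>2) = 0 \<and> B (s\<^sup>2, d\<^sup>2) = 0 \<and> C (s\<^sup>2, d\<^sup>2) = 0 \<and> E (s\<^sup>2, d\<^sup>2) = 0"
      using sd(1,2) by simp
    then show ?thesis unfolding sd(3) .
  qed
  have card: "k + 1 < card X" using X by simp
  have zero: "A (uv_image u v) = 0" "B (uv_image u v) = 0" "C (uv_image u v) = 0" "E (uv_image u v) = 0" for u v
    using bipoly_zero_on_grid[OF dec(1) X(1) card] bipoly_zero_on_grid[OF dec(2) X(1) card]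
      bipoly_zero_on_grid[OF dec(3) X(1) card] bipoly_zero_on_grid[OF dec(4) X(1) card] grid by blast+
  show ?thesis
  proof (rule bipoly_eq_on_square[OF interp_space_in_bipoly[OF ab F] bipoly_zero])
    fix z assume "z \<in> square"
    then obtain \<theta> \<phi> where "z = (cos \<theta>, cos \<phi>)" by (rule square_cosE)
    then show "F z = 0" unfolding Feq parity_form_def antisym_def by (simp add: sq_image_cos zero)
  qed
qed

text \<open>The interpolant is the sum of four tensor product interpolants, of which the data are the signed
  averages of the values of \<open>f\<close> over the four points of a pair, divided by \<open>s\<close> and \<open>d\<close> as the parity
  requires.\<close>

lemma lagrange_interp_bound:
  assumes ab: "\<alpha> > -1" "\<beta> > -1"
    and f: "\<And>z. z \<in> square \<Longrightarrow> \<bar>f z\<bar> \<le> 1"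
    and W: "\<And>i j t. i \<le> 1 \<Longrightarrow> j \<le> 1 \<Longrightarrow> -1 \<le> t \<Longrightarrow> t \<le> 1 \<Longrightarrow>
       weighted_lebesgue {x. -1 < x \<and> x < 1 \<and> poly (jacobi \<alpha> \<beta> (k + 2)) x = 0} i j t \<le> W"
    and z: "z \<in> square"
  shows "\<bar>lagrange_interp \<alpha> \<beta> (k + 2) f z\<bar> \<le> 4 * W\<^sup>2"
proof -
  define X where "X = {x. -1 < x \<and> x < 1 \<and> poly (jacobi \<alpha> \<beta> (k + 2)) x = 0}"
  have X: "finite X" "card X = k + 2"
    using card_jacobi_zeros[OF ab, of "k + 2"] by (auto simp: X_def intro: card_ge_0_finite)
  have Xb: "-1 < x \<and> x < 1" if "x \<in> X" for x using that by (simp add: X_def)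
  define v where "v e e' a b = f (sd_point (e * sum_coord a b) (e' * diff_coord a b))" for e e' a b
  have vsym: "v e e' a b = v e e' b a" for e e' a b by (simp add: v_def sum_coord_commute diff_coord_commute)
  have vb: "\<bar>v e e' a b\<bar> \<le> 1" if "a \<in> X" "b \<in> X" "\<bar>e\<bar> \<le> 1" "\<bar>e'\<bar> \<le> 1" for e e' a b
    unfolding v_def using Xb that by (intro f sd_point_square) auto
  \<comment> \<open>The signs \<open>p\<close> and \<open>q\<close> are the parities in \<open>s\<close> and \<open>d\<close>.\<close>
  define g where "g p q a b = (v 1 1 a b + q * v 1 (-1) a b + p * v (-1) 1 a b + p * q * v (-1) (-1) a b) / 4" for p q a b :: real
  have gb: "\<bar>g p q a b\<bar> \<le> 1" if "a \<in> X" "b \<in> X" "p \<in> {1, -1}" "q \<in> {1, -1}" for p q a b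
    using that(3,4) vb[OF that(1,2), of 1 1] vb[OF that(1,2), of 1 "-1"] vb[OF that(1,2), of "-1" 1] vb[OF that(1,2), of "-1" "-1"]
    unfolding g_def by (auto simp: abs_le_iff)
  define c where "c p q i j a b = g p q a b / (sum_coord a b ^ j * diff_coord a b ^ i)" for p q and i j :: nat and a b
  have csym: "c p q i j a b = c p q i j b a" for p q i j a b
    by (simp add: c_def g_def vsym[of _ _ a b] sum_coord_commute[of a b] diff_coord_commute[of a b])
  have ex: "\<exists>A\<in>bipoly_space (k + 1). \<forall>a b. A (uv_image a b) = lagrange_sum X (c p q i j) a b" for p q i j
    using X csym by (intro symmetric_interpolant_bipoly) auto
  obtain A where A: "A \<in> bipoly_space (k + 1)" "\<And>a b. A (uv_image a b) = lagrange_sum X (c 1 1 0 0) a b" using ex[of 1 1 0 0] by blast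
  obtain B where B: "B \<in> bipoly_space (k + 1)" "\<And>a b. B (uv_image a b) = lagrange_sum X (c (-1) 1 0 1) a b" using ex[of "-1" 1 0 1] by blast
  obtain C where C: "C \<in> bipoly_space (k + 1)" "\<And>a b. C (uv_image a b) = lagrange_sum X (c 1 (-1) 1 0) a b" using ex[of 1 "-1" 1 0] by blast
  obtain E where E: "E \<in> bipoly_space (k + 1)" "\<And>a b. E (uv_image a b) = lagrange_sum X (c (-1) (-1) 1 1) a b" using ex[of "-1" "-1" 1 1] by blast
  define F where "F = parity_form A B C E"
  have FI: "F \<in> interp_space \<alpha> \<beta> (k + 2)"
    unfolding interp_space_iff[OF ab] F_def
    by (intro exI[of _ A] exI[of _ B] exI[of _ C] exI[of _ E] conjI refl A(1) B(1) C(1) E(1))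
  have Fnode: "F y = f y" if "y \<in> cubature_nodes \<alpha> \<beta> (k + 2)" for y
  proof -
    have "y \<in> (\<Union>a\<in>X. \<Union>b\<in>X. sign_nodes a b)"
      using that unfolding cubature_nodes_eq[OF ab] X_def .
    then obtain a b where ab': "a \<in> X" "b \<in> X" "y \<in> sign_nodes a b" by blast
    from ab'(3) have "\<exists>e\<in>{1, -1}. \<exists>e'\<in>{1, -1}. y = sd_point (e * sum_coord a b) (e' * diff_coord a b)"
      by (auto simp: sign_nodes_def)
    with ab' obtain e e' where y: "a \<in> X" "b \<in> X" "e \<in> {1, -1}" "e' \<in> {1, -1}"
      "y = sd_point (e * sum_coord a b) (e' * diff_coord a b)" by blast
    define s d where "s = sum_coord a b" and "d = diff_coord a b"
    have pos: "1 + a > 0" "1 + b > 0" "1 - a > 0" "1 - b > 0" using Xb[OF y(1)] Xb[OF y(2)] by auto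
    have sd: "s > 0" "d > 0" "uv_image a b = (s\<^sup>2, d\<^sup>2)"
      using pos by (auto simp: s_def d_def sum_coord_def diff_coord_def uv_image_def)
    have sq: "(e * s)\<^sup>2 = s\<^sup>2" "(e' * d)\<^sup>2 = d\<^sup>2" using y(3,4) by auto
    have vals: "A (s\<^sup>2, d\<^sup>2) = g 1 1 a b" "B (s\<^sup>2, d\<^sup>2) = g (-1) 1 a b / s" "C (s\<^sup>2, d\<^sup>2) = g 1 (-1) a b / d"
      "E (s\<^sup>2, d\<^sup>2) = g (-1) (-1) a b / (s * d)"
      unfolding sd(3)[symmetric] A B C E lagrange_sum_node[OF X(1) y(1,2)]
      by (simp_all add: c_def s_def d_def)
    have "F y = g 1 1 a b + (e * s) * (g (-1) 1 a b / s) + (e' * d) * (g 1 (-1) a b / d) + (e * s) * (e' * d) * (g (-1) (-1) a b / (s * d))"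
      unfolding F_def y(5) s_def[symmetric] d_def[symmetric] parity_form_sd_point[OF sq] vals ..
    also have "\<dots> = g 1 1 a b + e * g (-1) 1 a b + e' * g 1 (-1) a b + e * e' * g (-1) (-1) a b"
      using sd by simp
    also have "\<dots> = v e e' a b" using y(3,4) by (auto simp: g_def field_simps)
    also have "\<dots> = f y" by (simp add: v_def y)
    finally show ?thesis .
  qed
  have "lagrange_interp \<alpha> \<beta> (k + 2) f = F"
    unfolding lagrange_interp_def
  proof (rule the_equality)
    show "F \<in> interp_space \<alpha> \<beta> (k + 2) \<and> (\<forall>z\<in>cubature_nodes \<alpha> \<beta> (k + 2). F z = f z)"
      using FI Fnode by blast
    fix q assume q: "q \<in> interp_space \<alpha> \<beta> (k + 2) \<and> (\<forall>z\<in>cubature_nodes \<alpha> \<beta> (k + 2). q z = f z)"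
    have "(\<lambda>z. q z + (- 1) * F z) = (\<lambda>z. 0)"
    proof (rule interp_space_unisolvent[OF ab])
      show "(\<lambda>z. q z + (- 1) * F z) \<in> interp_space \<alpha> \<beta> (k + 2)"
        using q FI by (intro interp_space_add interp_space_cmult) auto
    qed (use q Fnode in auto)
    then show "q = F" by (simp add: fun_eq_iff)
  qed
  moreover have "\<bar>F z\<bar> \<le> 4 * W\<^sup>2"
  proof -
    obtain \<theta> \<phi> where zz: "z = (cos \<theta>, cos \<phi>)" using z by (rule square_cosE)
    define a b where "a = cos (\<theta> - \<phi>)" and "b = cos (\<theta> + \<phi>)"
    have ab': "-1 \<le> a" "a \<le> 1" "-1 \<le> b" "b \<le> 1" by (auto simp: a_def b_def)
    have im: "sq_image z = uv_image a b" unfolding zz a_def b_def by (rule sq_image_cos)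
    have s: "\<bar>fst z + snd z\<bar> = sum_coord a b" and d: "\<bar>fst z - snd z\<bar> = diff_coord a b"
      using im unfolding sq_image_def uv_image_def sum_coord_def diff_coord_def
      by (metis Pair_inject real_sqrt_abs)+
    have bound: "\<bar>sum_coord a b ^ j * diff_coord a b ^ i * lagrange_sum X (c p q i j) a b\<bar> \<le> W\<^sup>2"
      if "p \<in> {1, -1}" "q \<in> {1, -1}" "i \<le> 1" "j \<le> 1" for p q i j
    proof -
      have "\<bar>sum_coord a b ^ j * diff_coord a b ^ i * lagrange_sum X (c p q i j) a b\<bar>
        \<le> weighted_lebesgue X i j a * weighted_lebesgue X i j b"
        by (rule lagrange_sum_bound[OF X(1) Xb ab', of "g p q"]) (use gb that in \<open>auto simp: c_def\<close>)
      also have "\<dots> \<le> W * W"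
      proof (rule mult_mono)
        show le: "weighted_lebesgue X i j a \<le> W" "weighted_lebesgue X i j b \<le> W"
          using W[of i j] that ab' by (auto simp: X_def)
        show "0 \<le> weighted_lebesgue X i j b" by (rule weighted_lebesgue_nonneg[OF Xb ab'(3,4)])
        have "0 \<le> weighted_lebesgue X i j a" by (rule weighted_lebesgue_nonneg[OF Xb ab'(1,2)])
        then show "0 \<le> W" using le(1) by linarith
      qed
      finally show ?thesis by (simp add: power2_eq_square)
    qed
    have fE: "antisym E z = (fst z + snd z) * (fst z - snd z) * E (uv_image a b)"
      by (simp add: antisym_def im power2_eq_square algebra_simps)
    have "\<bar>A (uv_image a b)\<bar> \<le> W\<^sup>2" using bound[of 1 1 0 0] by (simp add: A)
    moreover have "\<bar>(fst z + snd z) * B (uv_image a b)\<bar> \<le> W\<^sup>2"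
      using bound[of "-1" 1 0 1] s by (simp add: B abs_mult)
    moreover have "\<bar>(fst z - snd z) * C (uv_image a b)\<bar> \<le> W\<^sup>2"
      using bound[of 1 "-1" 1 0] d by (simp add: C abs_mult)
    moreover have "\<bar>antisym E z\<bar> \<le> W\<^sup>2"
      using bound[of "-1" "-1" 1 1] s d unfolding fE by (simp add: E abs_mult)
    ultimately show ?thesis unfolding F_def parity_form_def im by linarith
  qed
  ultimately show ?thesis by simp
qed

lemma abs_le_1_of_uniform_norm:
  assumes "uniform_norm f \<le> 1" "z \<in> square"
  shows "\<bar>f z\<bar> \<le> 1"
proof -
  have "ennreal \<bar>f z\<bar> \<le> 1" using assms unfolding uniform_norm_def by (meson SUP_le_iff)
  then show ?thesis by simp
qed

theorem theorem6p6:
  fixes \<alpha> \<beta> :: real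
  assumes "\<alpha> \<ge> - 1 / 2" and "\<beta> \<ge> - 1 / 2"
  shows "\<exists>C :: real. \<forall>\<^sub>F n in sequentially.
           lebesgue_constant \<alpha> \<beta> n \<le>
             ennreal (C * (if max \<alpha> \<beta> > - 1 / 2
                           then real n powr (2 * max \<alpha> \<beta> + 1)
                           else (ln (real n))\<^sup>2))"
proof -
  have ab: "\<alpha> > -1" "\<beta> > -1" using assms by auto
  define \<sigma> \<tau> where "\<sigma> = \<alpha> + 1 / 2" and "\<tau> = \<beta> + 1 / 2"
  have st: "\<sigma> \<ge> 0" "\<tau> \<ge> 0" using assms by (auto simp: \<sigma>_def \<tau>_def)
  obtain C where C: "C \<ge> 0" "\<And>n P i k t. n \<ge> 2 \<Longrightarrow> jacobi_zeros \<sigma> \<tau> n P \<Longrightarrow> i \<le> 1 \<Longrightarrow> k \<le> 1 \<Longrightarrow> -1 \<le> t \<Longrightarrow> t \<le> 1 \<Longrightarrow>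
     weighted_lebesgue (jacobi_zeros.X P) i k t \<le> C * lebesgue_rate (max \<sigma> \<tau>) n"
    using weighted_lebesgue_bound[OF st] by blast
  have rate: "(lebesgue_rate (max \<sigma> \<tau>) n)\<^sup>2 = (if max \<alpha> \<beta> > - 1 / 2
                           then real n powr (2 * max \<alpha> \<beta> + 1) else (ln (real n))\<^sup>2)" for n
  proof -
    have m: "max \<sigma> \<tau> = max \<alpha> \<beta> + 1 / 2" by (auto simp: \<sigma>_def \<tau>_def max_def)
    have "(real n powr (max \<alpha> \<beta> + 1 / 2))\<^sup>2 = real n powr (2 * max \<alpha> \<beta> + 1)"
      by (simp add: power2_eq_square powr_add[symmetric])
    then show ?thesis unfolding lebesgue_rate_def m by auto
  qed
  have "lebesgue_constant \<alpha> \<beta> n \<le> ennreal (4 * C\<^sup>2 * (if max \<alpha> \<beta> > - 1 / 2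
                           then real n powr (2 * max \<alpha> \<beta> + 1) else (ln (real n))\<^sup>2))"
    if n: "n \<ge> 2" for n
  proof -
    \<comment> \<open>The index shift avoids truncated subtraction in \<open>n - 1\<close> and \<open>n - 2\<close>.\<close>
    obtain k where k: "n = k + 2" using n by (metis add.commute le_Suc_ex)
    let ?P = "jacobi \<alpha> \<beta> n"
    interpret jacobi_zeros \<sigma> \<tau> n ?P
      using st n degree_jacobi[OF ab] jacobi_ode_jacobi[OF ab] card_jacobi_zeros[OF ab]
      by unfold_locales (auto simp: \<sigma>_def \<tau>_def)
    define W where "W = C * lebesgue_rate (max \<sigma> \<tau>) n"
    have W: "weighted_lebesgue {x. -1 < x \<and> x < 1 \<and> poly (jacobi \<alpha> \<beta> (k + 2)) x = 0} i j t \<le> W"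
      if "i \<le> 1" "j \<le> 1" "-1 \<le> t" "t \<le> 1" for i j t
      using C(2)[OF n jacobi_zeros_axioms that] unfolding W_def X_def unfolding k .
    have "uniform_norm (lagrange_interp \<alpha> \<beta> n f) \<le> ennreal (4 * W\<^sup>2)"
      if f: "uniform_norm f \<le> 1" for f
      unfolding uniform_norm_def
    proof (rule SUP_least)
      fix z assume "z \<in> square"
      then have "\<bar>lagrange_interp \<alpha> \<beta> (k + 2) f z\<bar> \<le> 4 * W\<^sup>2"
        using abs_le_1_of_uniform_norm[OF f] W by (intro lagrange_interp_bound[OF ab]) auto
      then show "ennreal \<bar>lagrange_interp \<alpha> \<beta> n f z\<bar> \<le> ennreal (4 * W\<^sup>2)" unfolding k by (rule ennreal_leI)
    qed
    then have "lebesgue_constant \<alpha> \<beta> n \<le> ennreal (4 * W\<^sup>2)"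
      unfolding lebesgue_constant_def by (intro SUP_least) auto
    also have "4 * W\<^sup>2 = 4 * C\<^sup>2 * (if max \<alpha> \<beta> > - 1 / 2
                           then real n powr (2 * max \<alpha> \<beta> + 1) else (ln (real n))\<^sup>2)"
      unfolding rate[symmetric] W_def by (simp add: power_mult_distrib)
    finally show ?thesis .
  qed
  then show ?thesis by (intro exI[of _ "4 * C\<^sup>2"] eventually_sequentiallyI[of 2]) auto
qed

end
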